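(* Let $k\in\frac12\mathbb Z$ with $k<2$ and let $N$ be a positive integer. Let $(a^\pm(n))_{n\ge0}$, $(b^\pm(n))_{n\ge0}$ be sequences of complex numbers such that $a^\pm(n)=O(n^{\mu_f^\pm})$ and $b^\pm(n)=O(n^{\mu_g^\pm})$ for some $\mu_f^\pm,\mu_g^\pm\ge0$. Suppose that for all $$\rho>\max\left(1-k,\ \mu_g^+-\frac k2+\frac34,\ 2\mu_g^--2k+\frac52\right)$$ and all $x>0$ the following identity holds: $$\frac{1}{\Gamma(\rho+1)}\sum_{1\le n\le x}a^+(n)(x-n)^\rho+\frac{x^\rho}{2\pi i}\sum_{1\le n\le x}a^-(n)g_\rho(n,x)-Q_\rho(x)$$ $$=-i^k x^{\frac{\rho+k}{2}}\Big(\frac{\sqrt N}{2\pi}\Big)^{\rho}\sum_{n=1}^\infty\frac{b^+(n)}{n^{(\rho+k)/2}}J_{\rho+k}\Big(4\pi\sqrt{\tfrac{nx}{N}}\Big)$$ $$\quad- i^k x^{\frac{\rho+1}{2}}\Big(\frac{\sqrt N}{2\pi}\Big)^{\rho+k-1}\sum_{n=1}^\infty\frac{b^-(n)}{n^{\frac{\rho-1}{2}+k}}\int_0^{1/2}\frac{u^{k+\frac{\rho-3}{2}}}{(1-u)^{\frac{1+\rho}{2}}}J_{\rho+1}\Big(4\pi\sqrt{\tfrac{nx(1-u)}{Nu}}\Big)du,$$ where $Q_\rho$ and $g_\rho$ are defined in the context. For $\tau\in\mathbb H$ with $v=\operatorname{Im}\tau$ and $q=e^{2\pi i\tau}$ set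 $$f(\tau)=\sum_{n\ge0}a^+(n)q^n+a^-(0)v^{1-k}+\sum_{n\ge1}a^-(n)\Gamma(1-k,4\pi nv)q^{-n},$$ $$g(\tau)=\sum_{n\ge0}b^+(n)q^n+b^-(0)v^{1-k}+\sum_{n\ge1}b^-(n)\Gamma(1-k,4\pi nv)q^{-n}.$$ Further set $$\Lambda(f,s)=\int_0^\infty\left(f(it/\sqrt N)-a^+(0)-\frac{a^-(0)}{N^{(1-k)/2}}t^{1-k}\right)t^{s-1}\,dt,$$ and let $\Lambda(g,s)$ be the corresponding function for $g$ (with $b^\pm(0)$ in place of $a^\pm(0)$); the integrals are taken for $\operatorname{Re}(s)$ large and the functions continued from there. Then $\Lambda(f,s)$ and $\Lambda(g,s)$ are meromorphic in $\mathbb C$ and satisfy $\Lambda(f,s)=i^k\Lambda(g,k-s)$.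
   Context: Complex powers use the principal branch. $J_\nu$ is the Bessel function of the first kind and $\Gamma(s,z)=\int_z^\infty t^{s-1}e^{-t}dt$ ($z>0$). The functions in the hypothesis are $$Q_\rho(x)=x^\rho\left(-\frac{a^+(0)}{\Gamma(\rho+1)}+\frac{2\pi xN^{\frac k2-1}b^-(0)i^k}{\Gamma(\rho+2)}-\frac{a^-(0)x^{k-1}(2\pi)^{k-1}}{\Gamma(\rho+k)}+\frac{b^+(0)i^kx^k(2\pi)^k}{N^{k/2}\Gamma(\rho+k+1)}\right),$$ $$g_\rho(n,x)=\frac{2\pi i}{\Gamma(k+\rho)}\Big(1+\frac nx\Big)^\rho\int_{\frac{2n}{x+n}}^1 t^{-k}(1-t)^{k+\rho-1}\,dt .$$
   Formalization: The two Bessel series on the right of the assumed identity carry the sign +i^k instead of the printed −i^k; with the printed sign the claim fails, e.g. for the theta function with k=1/2, N=4. *)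

theory Defs
  imports "HOL-Complex_Analysis.Complex_Analysis"
begin

(* J_nu(x) for real x > 0; rGamma is the entire function 1/Gamma. *)
definition Bessel_J :: "real \<Rightarrow> real \<Rightarrow> real" where
  "Bessel_J \<nu> x =
     (x / 2) powr \<nu> * (\<Sum>m. (-1) ^ m * rGamma (\<nu> + real m + 1) / fact m * (x / 2) ^ (2 * m))"

definition upper_Gamma :: "real \<Rightarrow> real \<Rightarrow> real" where
  "upper_Gamma s z = (LBINT t:{z..}. t powr (s - 1) * exp (- t))"

(* i^k is the principal value "\<i> powr of_real k". *)
definition Q_fun ::
  "real \<Rightarrow> nat \<Rightarrow> complex \<Rightarrow> complex \<Rightarrow> complex \<Rightarrow> complex \<Rightarrow> real \<Rightarrow> real \<Rightarrow> complex" where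
  "Q_fun k N ap0 am0 bp0 bm0 \<rho> x =
     of_real (x powr \<rho>) *
       (- ap0 / of_real (Gamma (\<rho> + 1))
        + of_real (2 * pi * x * real N powr (k / 2 - 1)) * bm0 * \<i> powr of_real k
            / of_real (Gamma (\<rho> + 2))
        - am0 * of_real (x powr (k - 1) * (2 * pi) powr (k - 1)) / of_real (Gamma (\<rho> + k))
        + bp0 * \<i> powr of_real k * of_real (x powr k * (2 * pi) powr k)
            / of_real (real N powr (k / 2) * Gamma (\<rho> + k + 1)))"

definition g_fun :: "real \<Rightarrow> real \<Rightarrow> nat \<Rightarrow> real \<Rightarrow> complex" where
  "g_fun k \<rho> n x =
     2 * of_real pi * \<i> / of_real (Gamma (k + \<rho>)) * of_real ((1 + real n / x) powr \<rho>) *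
     of_real (LBINT t:{2 * real n / (x + real n)..1}. t powr (- k) * (1 - t) powr (k + \<rho> - 1))"

(* The n-th summands (n >= 1) of the two Bessel series. *)
definition Bessel_term_plus ::
  "real \<Rightarrow> nat \<Rightarrow> (nat \<Rightarrow> complex) \<Rightarrow> real \<Rightarrow> real \<Rightarrow> nat \<Rightarrow> complex" where
  "Bessel_term_plus k N bp \<rho> x n =
     bp n / of_real (real n powr ((\<rho> + k) / 2)) *
     of_real (Bessel_J (\<rho> + k) (4 * pi * sqrt (real n * x / real N)))"

definition Bessel_term_minus ::
  "real \<Rightarrow> nat \<Rightarrow> (nat \<Rightarrow> complex) \<Rightarrow> real \<Rightarrow> real \<Rightarrow> nat \<Rightarrow> complex" where
  "Bessel_term_minus k N bm \<rho> x n =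
     bm n / of_real (real n powr ((\<rho> - 1) / 2 + k)) *
     of_real (LBINT u:{0<..<1/2}.
       u powr (k + (\<rho> - 3) / 2) / (1 - u) powr ((1 + \<rho>) / 2) *
       Bessel_J (\<rho> + 1) (4 * pi * sqrt (real n * x * (1 - u) / (real N * u))))"

(* The Riesz-mean identity at (\<rho>, x), including convergence (not necessarily absolute) of both
   series on the right.

   Sign: both series enter with +i^k. With Q_fun as above (each constant term is the residue
   belonging to Lambda(f,s) = i^k Lambda(g,k-s)) the sign -i^k, which occurs in print, is
   incompatible with that functional equation. Example: k = 1/2, N = 4, f = theta(\<tau>) = sum over
   all integers m of q^(m^2), g = i^(-k) f; the identity is then Poisson summation for
   y \<mapsto> (x - y^2)^\<rho> on |y| < sqrt x, and has the sign +i^k. *)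
definition Riesz_identity ::
  "real \<Rightarrow> nat \<Rightarrow> (nat \<Rightarrow> complex) \<Rightarrow> (nat \<Rightarrow> complex) \<Rightarrow> (nat \<Rightarrow> complex) \<Rightarrow> (nat \<Rightarrow> complex)
     \<Rightarrow> real \<Rightarrow> real \<Rightarrow> bool" where
  "Riesz_identity k N ap am bp bm \<rho> x \<longleftrightarrow>
     summable (\<lambda>n. Bessel_term_plus k N bp \<rho> x (Suc n)) \<and>
     summable (\<lambda>n. Bessel_term_minus k N bm \<rho> x (Suc n)) \<and>
     1 / of_real (Gamma (\<rho> + 1)) *
         (\<Sum>n | 1 \<le> n \<and> real n \<le> x. ap n * of_real ((x - real n) powr \<rho>))
       + of_real (x powr \<rho>) / (2 * of_real pi * \<i>) *
         (\<Sum>n | 1 \<le> n \<and> real n \<le> x. am n * g_fun k \<rho> n x)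
       - Q_fun k N (ap 0) (am 0) (bp 0) (bm 0) \<rho> x
     = \<i> powr of_real k * of_real (x powr ((\<rho> + k) / 2) * (sqrt (real N) / (2 * pi)) powr \<rho>) *
         (\<Sum>n. Bessel_term_plus k N bp \<rho> x (Suc n))
       + \<i> powr of_real k *
         of_real (x powr ((\<rho> + 1) / 2) * (sqrt (real N) / (2 * pi)) powr (\<rho> + k - 1)) *
         (\<Sum>n. Bessel_term_minus k N bm \<rho> x (Suc n))"

definition harmonic_series ::
  "real \<Rightarrow> (nat \<Rightarrow> complex) \<Rightarrow> (nat \<Rightarrow> complex) \<Rightarrow> complex \<Rightarrow> complex" where
  "harmonic_series k cp cm \<tau> =
     (let v = Im \<tau>; q = exp (2 * of_real pi * \<i> * \<tau>) in
        (\<Sum>n. cp n * q ^ n) + cm 0 * of_real (v powr (1 - k)) +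
        (\<Sum>n. cm (Suc n) * of_real (upper_Gamma (1 - k) (4 * pi * real (Suc n) * v))
               * q powi (- int (Suc n))))"

definition Lambda_integrand ::
  "real \<Rightarrow> nat \<Rightarrow> (nat \<Rightarrow> complex) \<Rightarrow> (nat \<Rightarrow> complex) \<Rightarrow> complex \<Rightarrow> real \<Rightarrow> complex" where
  "Lambda_integrand k N cp cm s t =
     (harmonic_series k cp cm (\<i> * of_real (t / sqrt (real N))) - cp 0
        - cm 0 / of_real (real N powr ((1 - k) / 2)) * of_real (t powr (1 - k)))
     * of_real t powr (s - 1)"

(* L is the meromorphic function on the whole plane that is given by the (absolutely convergent)
   integral in some right half-plane. By the identity theorem there is at most one such L, since
   "nicely meromorphic" fixes the values: 0 at poles, the limit everywhere else. *)
definition is_Lambda ::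
  "real \<Rightarrow> nat \<Rightarrow> (nat \<Rightarrow> complex) \<Rightarrow> (nat \<Rightarrow> complex) \<Rightarrow> (complex \<Rightarrow> complex) \<Rightarrow> bool" where
  "is_Lambda k N cp cm L \<longleftrightarrow>
     L nicely_meromorphic_on UNIV \<and>
     (\<exists>\<sigma>. \<forall>s. Re s > \<sigma> \<longrightarrow>
        set_integrable lborel {0<..} (Lambda_integrand k N cp cm s) \<and>
        L s = (LBINT t:{0<..}. Lambda_integrand k N cp cm s t))"

end

theory Submission
  imports Defs "HOL-Real_Asymp.Real_Asymp"
begin

text \<open>
  Fix one large \<open>\<rho>\<close>, so that all series converge absolutely, and integrate the Riesz identity
  against \<open>e\<^sup>-\<^sup>x\<^sup>y dx\<close> over \<open>x > 0\<close>. With \<open>y = 2 \<pi> v\<close>, both sides become \<open>y\<^sup>-\<^sup>\<rho>\<^sup>-\<^sup>1\<close> times the values of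
  \<open>f\<close> and \<open>g\<close> on the imaginary axis: \<open>g\<^sub>\<rho>(n, x)\<close> is a convolution, whose transform is an incomplete Gamma
  function, and \<open>x\<^sup>\<nu>\<^sup>/\<^sup>2 J\<^sub>\<nu>(2 \<surd>(a x))\<close> transforms to a multiple of \<open>y\<^sup>-\<^sup>\<nu>\<^sup>-\<^sup>1 e\<^sup>-\<^sup>a\<^sup>/\<^sup>y\<close>. The interchange of sum and integral only needs
  that \<open>J\<^sub>\<nu>\<close> is bounded on \<open>(0, \<infinity>)\<close>. The \<open>Q\<^sub>\<rho>\<close> terms supply the constant terms, so that
  \<open>f(it / \<surd>N) = i\<^sup>k t\<^sup>-\<^sup>k g(i / (t \<surd>N))\<close>, and Riemann's splitting of the Mellin integral at \<open>t = 1\<close>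
  gives the continuation and the functional equation.
\<close>

section \<open>The Laplace transform\<close>

text \<open>Transforms are compared at each y > 0, so no inversion theorem is needed, and one \<rho>
  suffices because the common factor \<open>y powr (- \<rho> - 1)\<close> divides out while f and g
  do not involve \<rho>. The delicate half is the non-holomorphic one: the same incomplete Gamma
  function has to appear from two unlike sources. On the left it is the transform of a shifted power
  \<open>(w + 2 n) powr (- k)\<close>. On the right it comes from superposing e^(-a (1 - u) / (u y))
  over 0 < u < 1/2: v = 1/u turns the limit 1/2 into the lower limit 2 of a Gamma integral, and the
  -1 in (1 - u) / u = 1/u - 1 leaves the factor e^(a/y) that represents q^(-n). A bound for the
  Bessel function without any decay is enough since, for large \<rho>, the powers of n in the
  denominators make both series converge by themselves. A second obstacle is pointwise:
  \<open>is_Lambda\<close> prescribes the values at poles, so the functional equation must hold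
  there too. Hence one continuation is normalised by \<open>remove_sings\<close> and the other is
  defined as its reflection.\<close>

definition laplace_measure :: "real \<Rightarrow> real measure" where
  "laplace_measure y = density lborel (\<lambda>x. ennreal (indicator {0<..} x * exp (- (x * y))))"

lemma sets_lap [measurable_cong, simp]: "sets (laplace_measure y) = sets borel"
  by (simp add: laplace_measure_def)

lemma space_lap [simp]: "space (laplace_measure y) = UNIV"
  by (simp add: laplace_measure_def)

lemma lap_measurable_iff [simp]: "borel_measurable (laplace_measure y) = borel_measurable borel"
  by (rule measurable_cong_sets) auto

text \<open>Keeping the weight inside the measure means that Fubini, dominated summation and
  uniqueness of integrals apply to the bare functions of x; this fact is what admits the measure to
  Fubini.\<close>

lemma sigma_finite_lap: "sigma_finite_measure (laplace_measure y)"
  unfolding laplace_measure_def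
  by (subst sigma_finite_measure.sigma_finite_iff_density_finite'[OF lborel.sigma_finite_measure_axioms])
     auto

lemma AE_lap_pos: "AE x in laplace_measure y. x > 0"
  unfolding laplace_measure_def by (subst AE_density) (auto simp: indicator_def)

lemma has_bochner_integral_lap_iff:
  fixes f :: "real \<Rightarrow> 'a :: {banach, second_countable_topology}"
  assumes "f \<in> borel_measurable borel"
  shows "has_bochner_integral (laplace_measure y) f I \<longleftrightarrow>
           has_bochner_integral lborel (\<lambda>x. (indicator {0<..} x * exp (- (x * y))) *\<^sub>R f x) I"
  using assms unfolding laplace_measure_def
  by (simp add: has_bochner_integral_iff integrable_density integral_density)

lemma integrable_lap_bound:
  fixes f :: "real \<Rightarrow> 'a :: {banach, second_countable_topology}" and g :: "real \<Rightarrow> real"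
  assumes "integrable (laplace_measure y) g" and [measurable]: "f \<in> borel_measurable borel"
    and "\<And>x. x > 0 \<Longrightarrow> norm (f x) \<le> g x"
  shows "integrable (laplace_measure y) f"
  using assms(1)
proof (rule Bochner_Integration.integrable_bound)
  show "AE x in laplace_measure y. norm (f x) \<le> norm (g x)"
    using AE_lap_pos by eventually_elim (use assms(3) in force)
qed simp

lemma has_bochner_integral_lap_cong:
  fixes f g :: "real \<Rightarrow> 'a :: {banach, second_countable_topology}"
  assumes "f \<in> borel_measurable borel" "g \<in> borel_measurable borel"
    and "\<And>x. x > 0 \<Longrightarrow> f x = g x" "I = J"
  shows "has_bochner_integral (laplace_measure y) f I \<longleftrightarrow> has_bochner_integral (laplace_measure y) g J"
  using assms AE_lap_pos[of y]
  by (simp, intro has_bochner_integral_cong_AE) (auto elim!: eventually_mono)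

text \<open>Euler's Gamma integral under the scaling x -> y x. It is available as a gauge integral,
  and nonnegativity of the integrand carries it over to \<open>lborel\<close>.\<close>

lemma lap_powr:
  fixes p y :: real
  assumes "p > -1" "y > 0"
  shows "has_bochner_integral (laplace_measure y) (\<lambda>x. x powr p) (Gamma (p + 1) * y powr (- p - 1))"
proof -
  have "((\<lambda>t. t powr p / exp t) has_integral Gamma (p + 1)) {0..}"
    using Gamma_integral_real[of "p + 1"] assms by simp
  then have "(\<integral>\<^sup>+x. indicator {0..} x * ennreal (x powr p / exp x) \<partial>lborel) = ennreal (Gamma (p + 1))"
    using nn_integral_has_integral_lebesgue[of "{0..}" "\<lambda>t. t powr p / exp t" "Gamma (p+1)"]
    by (auto simp: indicator_mult_ennreal nn_integral_completion)
  then have "(\<integral>\<^sup>+x. ennreal (indicator {0<..} x * (x powr p / exp x)) \<partial>lborel) = ennreal (Gamma (p + 1))"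
    by (subst (asm) nn_integral_cong[where v = "\<lambda>x. ennreal (indicator {0<..} x * (x powr p / exp x))"])
       (auto simp: indicator_def)
  then have "has_bochner_integral lborel (\<lambda>x. indicator {0<..} x * (x powr p / exp x)) (Gamma (p + 1))"
    using assms by (intro has_bochner_integral_nn_integral) (auto intro!: Gamma_real_pos less_imp_le)
  then have "has_bochner_integral lborel (\<lambda>x. indicator {0<..} (y * x) * ((y * x) powr p / exp (y * x))) (Gamma (p + 1) / y)"
    by (subst (asm) lborel_has_bochner_integral_real_affine_iff[of y _ _ 0]) (use assms in \<open>auto simp: field_simps\<close>)
  \<comment> \<open>The factor \<open>y powr -p\<close> undoes the y^p produced by (y x)^p.\<close>
  then have "has_bochner_integral lborel (\<lambda>x. (y powr -p) * (indicator {0<..} (y * x) * ((y * x) powr p / exp (y * x)))) (y powr -p * (Gamma (p + 1) / y))"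
    by (rule has_bochner_integral_mult_right)
  also have "(\<lambda>x. (y powr -p) * (indicator {0<..} (y * x) * ((y * x) powr p / exp (y * x)))) =
     (\<lambda>x. (indicator {0<..} x * exp (- (x * y))) *\<^sub>R (x powr p))"
    using assms by (auto simp: fun_eq_iff indicator_def powr_mult exp_minus field_simps powr_minus zero_less_mult_iff)
  also have "y powr -p * (Gamma (p + 1) / y) = Gamma (p + 1) * y powr (- p - 1)"
    using assms by (simp add: powr_diff powr_minus field_simps)
  finally show ?thesis
    by (subst has_bochner_integral_lap_iff) auto
qed

text \<open>The translation rule. Because c is nonnegative, the translated half-line stays inside
  (0, infinity), where the measure lives.\<close>

lemma lap_shift:
  fixes h :: "real \<Rightarrow> 'a :: {banach, second_countable_topology}"
  assumes "has_bochner_integral (laplace_measure y) h I" "c \<ge> 0"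
  shows "has_bochner_integral (laplace_measure y) (\<lambda>x. indicator {c<..} x *\<^sub>R h (x - c)) (exp (- (c * y)) *\<^sub>R I)"
proof -
  have [measurable]: "h \<in> borel_measurable borel"
    using assms(1) by (auto simp: has_bochner_integral_iff dest: borel_measurable_integrable)
  have "has_bochner_integral lborel (\<lambda>x. (indicator {0<..} x * exp (- (x * y))) *\<^sub>R h x) I"
    using assms(1) by (subst (asm) has_bochner_integral_lap_iff) auto
  then have "has_bochner_integral lborel (\<lambda>x. (indicator {0<..} (-c + x) * exp (- ((-c + x) * y))) *\<^sub>R h (-c + x)) I"
    by (subst (asm) lborel_has_bochner_integral_real_affine_iff[of 1 _ _ "-c"]) auto
  then have "has_bochner_integral lborel (\<lambda>x. exp (-(c * y)) *\<^sub>R ((indicator {0<..} (-c + x) * exp (- ((-c + x) * y))) *\<^sub>R h (-c + x))) (exp (-(c * y)) *\<^sub>R I)"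
    by (intro has_bochner_integral_scaleR_right) auto
  also have "(\<lambda>x. exp (-(c * y)) *\<^sub>R ((indicator {0<..} (-c + x) * exp (- ((-c + x) * y))) *\<^sub>R h (-c + x))) =
     (\<lambda>x. (indicator {0<..} x * exp (- (x * y))) *\<^sub>R (indicator {c<..} x *\<^sub>R h (x - c)))"
    using assms(2) by (auto simp: fun_eq_iff indicator_def algebra_simps simp flip: exp_add)
  finally show ?thesis
    by (subst has_bochner_integral_lap_iff) auto
qed

lemma lap_convolution:
  fixes h1 h2 :: "real \<Rightarrow> real"
  assumes h1: "has_bochner_integral (laplace_measure y) h1 I1" and h2: "has_bochner_integral (laplace_measure y) h2 I2"
  shows "has_bochner_integral (laplace_measure y)
           (\<lambda>z. LBINT w:{0<..}. indicator {w<..} z * (h1 w * h2 (z - w))) (I1 * I2)"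
proof -
  interpret pair_sigma_finite lborel "laplace_measure y"
    by (intro pair_sigma_finite.intro sigma_finite_lap lborel.sigma_finite_measure_axioms)
  have [measurable]: "h1 \<in> borel_measurable borel" "h2 \<in> borel_measurable borel"
    using h1 h2 by (auto simp: has_bochner_integral_iff dest: borel_measurable_integrable)
  \<comment> \<open>Only z carries the exponential weight; w runs over plain Lebesgue measure. The
    missing e^(-w y) reappears when the inner z-integral is evaluated by \<open>lap_shift\<close>,
    which turns the w-integral into the transform of \<open>h1\<close>.\<close>
  define f where "f = (\<lambda>(w, z). indicator {0<..} w * (indicator {0<..} (z - w) * (h1 w * h2 (z - w))))"
  have f_meas [measurable]: "f \<in> borel_measurable (lborel \<Otimes>\<^sub>M laplace_measure y)"
    unfolding f_def by measurable
  have sh: "has_bochner_integral (laplace_measure y) (\<lambda>z. f (w, z)) (indicator {0<..} w * h1 w * exp (- (w * y)) * I2)" for w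
  proof (cases "w > 0")
    case True
    from has_bochner_integral_mult_right[OF lap_shift[OF h2, of w], of "h1 w"] True
    have "has_bochner_integral (laplace_measure y) (\<lambda>z. h1 w * (indicator {w<..} z * h2 (z - w))) (h1 w * (exp (- (w * y)) * I2))"
      by auto
    then show ?thesis using True by (simp add: f_def indicator_def mult_ac cong: if_cong)
  qed (auto simp: f_def)
  have h2n: "has_bochner_integral (laplace_measure y) (\<lambda>x. \<bar>h2 x\<bar>) (integral\<^sup>L (laplace_measure y) (\<lambda>x. \<bar>h2 x\<bar>))"
    using h2 by (auto simp: has_bochner_integral_iff)
  \<comment> \<open>The same computation with absolute values; it supplies the integrability that
    Fubini asks for.\<close>
  have shn: "has_bochner_integral (laplace_measure y) (\<lambda>z. norm (f (w, z)))
     (indicator {0<..} w * \<bar>h1 w\<bar> * exp (- (w * y)) * integral\<^sup>L (laplace_measure y) (\<lambda>x. \<bar>h2 x\<bar>))" for w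
  proof (cases "w > 0")
    case True
    from has_bochner_integral_mult_right[OF lap_shift[OF h2n, of w], of "\<bar>h1 w\<bar>"] True
    have "has_bochner_integral (laplace_measure y) (\<lambda>z. \<bar>h1 w\<bar> * (indicator {w<..} z * \<bar>h2 (z - w)\<bar>)) (\<bar>h1 w\<bar> * (exp (- (w * y)) * integral\<^sup>L (laplace_measure y) (\<lambda>x. \<bar>h2 x\<bar>)))"
      by auto
    then show ?thesis using True by (simp add: f_def indicator_def mult_ac abs_mult cong: if_cong)
  qed (auto simp: f_def)
  have h1L: "has_bochner_integral lborel (\<lambda>w. indicator {0<..} w * h1 w * exp (- (w * y))) I1"
    using h1 by (subst (asm) has_bochner_integral_lap_iff) (auto simp: mult_ac)
  have int: "integrable (lborel \<Otimes>\<^sub>M laplace_measure y) f"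
  proof (rule Fubini_integrable)
    have "integrable lborel (\<lambda>w. norm (indicator {0<..} w * h1 w * exp (- (w * y))) * integral\<^sup>L (laplace_measure y) (\<lambda>x. \<bar>h2 x\<bar>))"
      using h1L by (intro integrable_mult_left integrable_norm) (auto simp: has_bochner_integral_iff)
    then show "integrable lborel (\<lambda>w. \<integral>z. norm (f (w, z)) \<partial>laplace_measure y)"
      using has_bochner_integral_integral_eq[OF shn] by (simp add: abs_mult)
  qed (use sh in \<open>auto simp: has_bochner_integral_iff\<close>)
  have eq: "(LBINT w:{0<..}. indicator {w<..} z * (h1 w * h2 (z - w))) = (\<integral>w. f (w, z) \<partial>lborel)" for z
    unfolding set_lebesgue_integral_def by (intro Bochner_Integration.integral_cong) (auto simp: f_def indicator_def)
  have intz: "integrable (laplace_measure y) (\<lambda>z. \<integral>w. f (w, z) \<partial>lborel)"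
    using integrable_snd[of "\<lambda>w z. f (w, z)"] int by simp
  have "(\<integral>z. (\<integral>w. f (w, z) \<partial>lborel) \<partial>laplace_measure y) = (\<integral>w. (\<integral>z. f (w, z) \<partial>laplace_measure y) \<partial>lborel)"
    using Fubini_integral[of "\<lambda>w z. f (w, z)"] int by simp
  also have "\<dots> = (\<integral>w. indicator {0<..} w * h1 w * exp (- (w * y)) * I2 \<partial>lborel)"
    using has_bochner_integral_integral_eq[OF sh] by simp
  also have "\<dots> = I1 * I2"
    using h1L by (simp add: has_bochner_integral_iff)
  finally show ?thesis
    unfolding eq using intz by (simp add: has_bochner_integral_iff)
qed

section \<open>Incomplete Gamma functions as Laplace transforms\<close>

lemma integrable_lap_powr_tail:
  fixes p y z :: real
  assumes "y > 0" "z > 0"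
  shows "integrable (laplace_measure y) (\<lambda>t. indicator {z..} t * t powr p)"
proof (rule integrable_lap_bound)
  \<comment> \<open>The exponent p may be at most -1, so t^p itself need not be integrable near 0.
    For t >= z it is dominated by a power with the nonnegative exponent p + |p|.\<close>
  show "integrable (laplace_measure y) (\<lambda>t. z powr (- \<bar>p\<bar>) * t powr (p + \<bar>p\<bar>))"
    using lap_powr[of "p + \<bar>p\<bar>" y] assms by (auto simp: has_bochner_integral_iff)
  fix x :: real assume "x > 0"
  show "norm (indicator {z..} x * x powr p) \<le> z powr (- \<bar>p\<bar>) * x powr (p + \<bar>p\<bar>)"
  proof (cases "x \<ge> z")
    case True
    then have "z powr \<bar>p\<bar> \<le> x powr \<bar>p\<bar>" using assms by (intro powr_mono2) auto
    then show ?thesis using True assms \<open>x > 0\<close>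
      by (simp add: powr_add powr_minus field_simps)
  qed auto
qed auto

lemma integrable_powr_exp_tail:
  fixes p y z :: real
  assumes "y > 0" "z > 0"
  shows "integrable lborel (\<lambda>t. indicator {z..} t * (t powr p * exp (- (t * y))))"
proof -
  have "integrable lborel (\<lambda>t. (indicator {0<..} t * exp (- (t * y))) *\<^sub>R (indicator {z..} t * t powr p))"
    using integrable_lap_powr_tail[OF assms, of p] has_bochner_integral_lap_iff[of "\<lambda>t. indicator {z..} t * t powr p" y]
    by (auto simp: has_bochner_integral_iff)
  also have "(\<lambda>t. (indicator {0<..} t * exp (- (t * y))) *\<^sub>R (indicator {z..} t * t powr p)) =
      (\<lambda>t. indicator {z..} t * (t powr p * exp (- (t * y))))"
    using assms by (auto simp: fun_eq_iff indicator_def)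
  finally show ?thesis .
qed

lemma upper_Gamma_lap: "upper_Gamma s z = (\<integral>t. indicator {z..} t * t powr (s - 1) \<partial>laplace_measure 1)"
  if "z > 0"
proof -
  have "(\<integral>t. indicator {z..} t * t powr (s - 1) \<partial>laplace_measure 1) = 
    (\<integral>t. (indicator {0<..} t * exp (- (t * 1))) *\<^sub>R (indicator {z..} t * t powr (s - 1)) \<partial>lborel)"
    unfolding laplace_measure_def by (intro integral_density) auto
  also have "\<dots> = upper_Gamma s z"
    unfolding upper_Gamma_def set_lebesgue_integral_def using that
    by (intro Bochner_Integration.integral_cong) (auto simp: indicator_def)
  finally show ?thesis by simp
qed

text \<open>Substitute t = y (w + c) in the integral of t^(-k) e^(-t) over t >= c y. This is where
  the incomplete Gamma function enters on both sides of the identity.\<close>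

lemma lap_powr_shifted:
  fixes k c y :: real
  assumes "c > 0" "y > 0"
  shows "has_bochner_integral (laplace_measure y) (\<lambda>w. (w + c) powr (- k))
           (exp (c * y) * y powr (k - 1) * upper_Gamma (1 - k) (c * y))"
proof -
  have "has_bochner_integral (laplace_measure 1) (\<lambda>t. indicator {c * y..} t * t powr (- k)) (upper_Gamma (1 - k) (c * y))"
    using integrable_lap_powr_tail[of 1 "c*y" "-k"] assms by (simp add: has_bochner_integral_iff upper_Gamma_lap)
  then have "has_bochner_integral lborel (\<lambda>t. (indicator {0<..} t * exp (- (t * 1))) *\<^sub>R (indicator {c * y..} t * t powr (- k))) (upper_Gamma (1 - k) (c * y))"
    by (subst (asm) has_bochner_integral_lap_iff) auto
  then have "has_bochner_integral lborel (\<lambda>w. (indicator {0<..} (c * y + y * w) * exp (- ((c * y + y * w) * 1))) *\<^sub>R (indicator {c * y..} (c * y + y * w) * (c * y + y * w) powr (- k))) (upper_Gamma (1 - k) (c * y) / y)"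
    by (subst (asm) lborel_has_bochner_integral_real_affine_iff[of y _ _ "c * y"]) (use assms in \<open>auto simp: field_simps\<close>)
  then have "has_bochner_integral lborel (\<lambda>w. (exp (c * y) * y powr k) * ((indicator {0<..} (c * y + y * w) * exp (- ((c * y + y * w) * 1))) *\<^sub>R (indicator {c * y..} (c * y + y * w) * (c * y + y * w) powr (- k)))) ((exp (c * y) * y powr k) * (upper_Gamma (1 - k) (c * y) / y))"
    by (rule has_bochner_integral_mult_right)
  also have "(\<lambda>w. (exp (c * y) * y powr k) * ((indicator {0<..} (c * y + y * w) * exp (- ((c * y + y * w) * 1))) *\<^sub>R (indicator {c * y..} (c * y + y * w) * (c * y + y * w) powr (- k)))) =
     (\<lambda>w. indicator {0..} w * exp (- (w * y)) * (w + c) powr (- k))"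
  proof
    fix w
    have "(c * y + y * w) powr (- k) = (w + c) powr (-k) * y powr (-k)" if "w \<ge> 0"
      using that assms powr_mult[of "w + c" y "-k"] by (simp add: algebra_simps)
    moreover have "0 \<le> y * w \<longleftrightarrow> 0 \<le> w" using assms by (simp add: zero_le_mult_iff)
    moreover have "0 < c * y + y * w" if "w \<ge> 0" using that assms by (simp add: add_pos_nonneg)
    moreover have "exp (- (w * y)) = exp (c * y) * exp (- ((c * y + y * w) * 1))"
      by (simp add: mult.commute flip: exp_add)
    ultimately show "(exp (c * y) * y powr k) * ((indicator {0<..} (c * y + y * w) * exp (- ((c * y + y * w) * 1))) *\<^sub>R (indicator {c * y..} (c * y + y * w) * (c * y + y * w) powr (- k))) = indicator {0..} w * exp (- (w * y)) * (w + c) powr (- k)"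
      using assms by (auto simp: indicator_def powr_minus)
  qed
  also have "has_bochner_integral lborel (\<lambda>w. indicator {0..} w * exp (- (w * y)) * (w + c) powr (- k)) J \<longleftrightarrow>
     has_bochner_integral lborel (\<lambda>w. (indicator {0<..} w * exp (- (w * y))) *\<^sub>R (w + c) powr (- k)) J" for J
  proof (rule has_bochner_integral_cong_AE)
    show "AE w in lborel. indicator {0..} w * exp (- (w * y)) * (w + c) powr (- k) =
        (indicator {0<..} w * exp (- (w * y))) *\<^sub>R (w + c) powr (- k)"
      using AE_lborel_singleton[of 0] by eventually_elim (auto simp: indicator_def)
  qed auto
  finally have "has_bochner_integral lborel (\<lambda>w. (indicator {0<..} w * exp (- (w * y))) *\<^sub>R (w + c) powr (- k)) ((exp (c * y) * y powr k) * (upper_Gamma (1 - k) (c * y) / y))" .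
  then have "has_bochner_integral (laplace_measure y) (\<lambda>w. (w + c) powr (- k)) ((exp (c * y) * y powr k) * (upper_Gamma (1 - k) (c * y) / y))"
    by (subst has_bochner_integral_lap_iff) auto
  then show ?thesis using assms by (simp add: powr_diff)
qed

section \<open>Bessel functions\<close>

definition bessel_coeff :: "real \<Rightarrow> nat \<Rightarrow> real" where
  "bessel_coeff \<nu> m = (-1) ^ m * rGamma (\<nu> + real m + 1) / fact m"

text \<open>The Bessel-Clifford function at -z: for z > 0, J_\<nu>(2 sqrt z) = z^(\<nu>/2) times it.
  Splitting off the branch factor leaves an everywhere convergent power series, whose derivative
  merely raises \<nu> by one and changes the sign.\<close>

definition bessel_entire :: "real \<Rightarrow> real \<Rightarrow> real" where
  "bessel_entire \<nu> z = (\<Sum>m. bessel_coeff \<nu> m * z ^ m)"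

lemma Bessel_J_eq_entire: "Bessel_J \<nu> x = (x / 2) powr \<nu> * bessel_entire \<nu> (x\<^sup>2 / 4)"
  by (simp add: Bessel_J_def bessel_entire_def bessel_coeff_def power_mult power_divide)

text \<open>1/Gamma does not increase along \<nu> + 1, \<nu> + 2, ..., since Gamma(s + 1) = s
  Gamma(s) and each s passed is at least 1. The coefficients are thus dominated by those of an
  exponential series.\<close>

lemma abs_bessel_coeff_le:
  assumes "\<nu> \<ge> 0"
  shows "\<bar>bessel_coeff \<nu> m\<bar> \<le> rGamma (\<nu> + 1) / fact m"
proof -
  have pos: "rGamma (\<nu> + real m + 1) > 0" for m
    using assms by (simp add: rGamma_inverse_Gamma Gamma_real_pos)
  have "rGamma (\<nu> + real m + 1) \<le> rGamma (\<nu> + 1)"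
  proof (induction m)
    case (Suc m)
    have "rGamma (\<nu> + real (Suc m) + 1) \<le> (\<nu> + real m + 1) * rGamma (\<nu> + real (Suc m) + 1)"
      using assms pos[of "Suc m"] mult_right_mono[of 1 "\<nu> + real m + 1" "rGamma (\<nu> + real (Suc m) + 1)"] by simp
    also have "\<dots> = rGamma (\<nu> + real m + 1)"
      using rGamma_plus1[of "\<nu> + real m + 1"] by (simp add: algebra_simps)
    finally show ?case using Suc by linarith
  qed auto
  then show ?thesis
    using pos[of m] by (simp add: bessel_coeff_def abs_mult power_abs divide_right_mono)
qed

lemma summable_bessel_norm:
  assumes "\<nu> \<ge> 0"
  shows "summable (\<lambda>m. \<bar>bessel_coeff \<nu> m * z ^ m\<bar>)"
proof (rule summable_comparison_test'[where N = 0])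
  show "summable (\<lambda>m. rGamma (\<nu> + 1) * (\<bar>z\<bar> ^ m / fact m))"
    using summable_exp[of "\<bar>z\<bar>"] by (intro summable_mult) (simp add: divide_inverse mult.commute)
  show "norm \<bar>bessel_coeff \<nu> m * z ^ m\<bar> \<le> rGamma (\<nu> + 1) * (\<bar>z\<bar> ^ m / fact m)" if "m \<ge> 0" for m
    using mult_right_mono[OF abs_bessel_coeff_le[OF assms, of m], of "\<bar>z\<bar> ^ m"]
    by (simp add: abs_mult power_abs)
qed

lemma summable_bessel: "\<nu> \<ge> 0 \<Longrightarrow> summable (\<lambda>m. bessel_coeff \<nu> m * z ^ m)"
  by (rule summable_rabs_cancel) (rule summable_bessel_norm)

lemma DERIV_bessel_entire [derivative_intros]:
  assumes "\<nu> \<ge> 0" "(g has_real_derivative g') (at x within S)"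
  shows "((\<lambda>x. bessel_entire \<nu> (g x)) has_real_derivative - bessel_entire (\<nu> + 1) (g x) * g') (at x within S)"
proof -
  have "diffs (bessel_coeff \<nu>) m = - bessel_coeff (\<nu> + 1) m" for m
  proof -
    have "rGamma (\<nu> + real (Suc m) + 1) = rGamma (\<nu> + 1 + real m + 1)" by (simp add: algebra_simps)
    then show ?thesis by (simp add: diffs_def bessel_coeff_def fact_Suc del: of_nat_Suc)
  qed
  then have "(\<Sum>m. diffs (bessel_coeff \<nu>) m * z ^ m) = - bessel_entire (\<nu> + 1) z" for z
    using summable_bessel[of "\<nu> + 1" z] assms by (simp add: bessel_entire_def suminf_minus)
  moreover have "(bessel_entire \<nu> has_real_derivative (\<Sum>m. diffs (bessel_coeff \<nu>) m * z ^ m)) (at z)" for z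
    unfolding bessel_entire_def
    using summable_bessel[OF assms(1)] by (intro termdiffs_strong_converges_everywhere) auto
  ultimately have "(bessel_entire \<nu> has_real_derivative - bessel_entire (\<nu> + 1) z) (at z)" for z
    by simp
  from DERIV_chain2[OF this assms(2)] show ?thesis by simp
qed

text \<open>The classical J_\<nu> + J_(\<nu>+2) = (2 (\<nu> + 1) / x) J_(\<nu>+1) with z = x^2 / 4.
  It follows by comparing coefficients: the right side has no constant term, and its coefficient at
  m + 1 is the one at m of the series for \<nu> + 2.\<close>

lemma bessel_entire_recurrence:
  assumes "\<nu> \<ge> 0"
  shows "z * bessel_entire (\<nu> + 2) z = (\<nu> + 1) * bessel_entire (\<nu> + 1) z - bessel_entire \<nu> z"
proof -
  define a where "a = (\<lambda>m. (\<nu> + 1) * (bessel_coeff (\<nu> + 1) m * z ^ m) - bessel_coeff \<nu> m * z ^ m)"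
  have rG: "rGamma (\<nu> + 1 + real m) = (\<nu> + 1 + real m) * rGamma (\<nu> + 2 + real m)" for m
    using rGamma_plus1[of "\<nu> + 1 + real m"] by (simp add: algebra_simps)
  have a0: "a 0 = 0"
    using rG[of 0] by (simp add: a_def bessel_coeff_def algebra_simps)
  have aSuc: "a (Suc m) = z * (bessel_coeff (\<nu> + 2) m * z ^ m)" for m
  proof -
    have "a (Suc m) = (-1) ^ m * z ^ Suc m / fact (Suc m) * (rGamma (\<nu> + 1 + real (Suc m)) - (\<nu> + 1) * rGamma (\<nu> + 2 + real (Suc m)))"
      by (simp add: a_def bessel_coeff_def field_simps del: fact_Suc of_nat_Suc)
    also have "\<dots> = (-1) ^ m * z ^ Suc m * real (Suc m) / fact (Suc m) * rGamma (\<nu> + 2 + real (Suc m))"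
      proof -
      have "(\<nu> + 1 + real (Suc m)) * G - (\<nu> + 1) * G = real (Suc m) * G" for G
        by (simp add: algebra_simps)
      then show ?thesis by (subst rG) (simp only: times_divide_eq_left mult.assoc)
    qed
    also have "\<dots> = z * (bessel_coeff (\<nu> + 2) m * z ^ m)"
    proof -
      have "\<nu> + 2 + real (Suc m) = \<nu> + 2 + real m + 1" by simp
      then show ?thesis by (simp only: bessel_coeff_def fact_Suc power_Suc) simp
    qed
    finally show ?thesis .
  qed
  have "a sums ((\<nu> + 1) * bessel_entire (\<nu> + 1) z - bessel_entire \<nu> z)"
    unfolding a_def bessel_entire_def using assms
    by (intro sums_diff sums_mult summable_sums summable_bessel) auto
  then have "(\<lambda>m. a (Suc m)) sums ((\<nu> + 1) * bessel_entire (\<nu> + 1) z - bessel_entire \<nu> z)"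
    using a0 by (simp add: sums_Suc_iff)
  moreover have "(\<lambda>m. a (Suc m)) sums (z * bessel_entire (\<nu> + 2) z)"
    unfolding aSuc bessel_entire_def using assms by (intro sums_mult summable_sums summable_bessel) auto
  ultimately show ?thesis by (rule sums_unique2[symmetric])
qed

text \<open>
  Sonin's argument: \<open>w(z) = J\<^sub>\<nu>(2 \<surd>z)\<close> satisfies \<open>z (z w')' + (z - \<nu>\<^sup>2 / 4) w = 0\<close>, so that
  \<open>w\<^sup>2 + (z w')\<^sup>2 / (z - \<nu>\<^sup>2 / 4)\<close> decreases for \<open>z > \<nu>\<^sup>2 / 4\<close>.
\<close>
lemma Bessel_J_bounded:
  assumes "\<nu> \<ge> 0"
  obtains C where "\<And>x. x > 0 \<Longrightarrow> \<bar>Bessel_J \<nu> x\<bar> \<le> C"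
proof -
  define c where "c = \<nu>\<^sup>2 / 4"
  define A B where "A = bessel_entire \<nu>" and "B = bessel_entire (\<nu> + 1)"
  \<comment> \<open>For w = z^(\<nu>/2) A, i.e. w(z) = J_\<nu>(2 sqrt z), one has z w' = z^(\<nu>/2)
    D. So H in the next line is the quantity w^2 + (z w')^2 / (z - c), written without fractional
    powers inside the bracket.\<close>
  define D where "D = (\<lambda>z. \<nu> / 2 * A z - z * B z)"
  define H where "H = (\<lambda>z. z powr \<nu> * ((A z)\<^sup>2 + (D z)\<^sup>2 / (z - c)))"
  have c: "c \<ge> 0" by (simp add: c_def)
  have dA: "(A has_real_derivative - B z) (at z)" for z
    unfolding A_def B_def using assms by (auto intro!: derivative_eq_intros)
  \<comment> \<open>The recurrence eliminates order \<nu> + 2, so A and B form a closed first-order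
    system; this replaces Bessel's differential equation.\<close>
  have dB: "(B has_real_derivative (A z - (\<nu> + 1) * B z) / z) (at z)" if "z > 0" for z
  proof -
    have "(B has_real_derivative - bessel_entire (\<nu> + 2) z) (at z)"
      unfolding B_def using assms by (auto intro!: derivative_eq_intros simp: add_ac)
    also have "- bessel_entire (\<nu> + 2) z = (A z - (\<nu> + 1) * B z) / z"
      using bessel_entire_recurrence[OF assms, of z] that by (simp add: A_def B_def field_simps)
    finally show ?thesis .
  qed
  have dD: "(D has_real_derivative \<nu> / 2 * B z - A z) (at z)" if "z > 0" for z
    unfolding D_def using that
    by (auto intro!: derivative_eq_intros dA dB) (simp add: field_simps)
  have dH: "(H has_real_derivative - (z powr \<nu> * ((D z)\<^sup>2 / (z - c)\<^sup>2))) (at z)" if "z > c" for z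
  proof -
    have z: "z > 0" using that c by linarith
    define E where "E = \<nu> / 2 * B z - A z"
    have h1: "((\<lambda>z. z powr \<nu>) has_real_derivative \<nu> * z powr (\<nu> - 1)) (at z)"
      using z by (rule has_real_derivative_powr)
    have h2: "((\<lambda>z. (A z)\<^sup>2) has_real_derivative - (2 * A z * B z)) (at z)"
      by (auto intro!: derivative_eq_intros dA)
    have h3: "((\<lambda>z. (D z)\<^sup>2 / (z - c)) has_real_derivative (2 * D z * E * (z - c) - (D z)\<^sup>2) / (z - c)\<^sup>2) (at z)"
      using that z unfolding E_def
      by (auto intro!: derivative_eq_intros dD simp: power2_eq_square)
    have "(H has_real_derivative \<nu> * z powr (\<nu> - 1) * ((A z)\<^sup>2 + (D z)\<^sup>2 / (z - c)) +
       (- (2 * A z * B z) + (2 * D z * E * (z - c) - (D z)\<^sup>2) / (z - c)\<^sup>2) * z powr \<nu>) (at z)"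
      unfolding H_def by (rule DERIV_mult[OF h1 DERIV_add[OF h2 h3]])
    also have "\<nu> * z powr (\<nu> - 1) * ((A z)\<^sup>2 + (D z)\<^sup>2 / (z - c)) +
       (- (2 * A z * B z) + (2 * D z * E * (z - c) - (D z)\<^sup>2) / (z - c)\<^sup>2) * z powr \<nu> =
       z powr (\<nu> - 1) * (\<nu> * (A z)\<^sup>2 - 2 * z * A z * B z + (\<nu> * (D z)\<^sup>2 + 2 * z * D z * E) / (z - c))
       - z powr \<nu> * ((D z)\<^sup>2 / (z - c)\<^sup>2)"
    proof -
      have "\<nu> * t * (X + Y / w) + (- V + (2 * d * E * w - Y) / w\<^sup>2) * (z * t) =
         t * (\<nu> * X - z * V + (\<nu> * Y + 2 * z * d * E) / w) - z * t * (Y / w\<^sup>2)"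
        if "w \<noteq> 0" for X Y V w d t :: real
        using that by (simp add: field_simps power2_eq_square)
      from this[of "z - c" "z powr (\<nu> - 1)" "(A z)\<^sup>2" "(D z)\<^sup>2" "2 * A z * B z" "D z"]
      show ?thesis using z that by (simp add: powr_mult_base mult_ac)
    qed
    \<comment> \<open>This and the next identity make the mixed terms 2 A D cancel. What survives is
      the derivative of the factor 1 / (z - c), which has a sign.\<close>
    also have "\<nu> * (A z)\<^sup>2 - 2 * z * A z * B z = 2 * A z * D z"
      by (simp add: D_def power2_eq_square algebra_simps)
    also have "\<nu> * (D z)\<^sup>2 + 2 * z * D z * E = - (2 * A z * D z * (z - c))"
    proof -
      have "\<nu> * D z + 2 * z * E = - (2 * A z * (z - c))"
        by (simp add: D_def E_def c_def power2_eq_square algebra_simps)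
      then have "D z * (\<nu> * D z + 2 * z * E) = D z * (- (2 * A z * (z - c)))" by simp
      then show ?thesis by (simp add: power2_eq_square algebra_simps)
    qed
    finally show ?thesis using that by simp
  qed
  \<comment> \<open>The start is c + 1 since H is singular at c; the remaining range up to c + 1 is
    handled by compactness.\<close>
  have H_le: "H z \<le> H (c + 1)" if "z \<ge> c + 1" for z
  proof (rule DERIV_nonpos_imp_nonincreasing[OF that])
    fix x assume "c + 1 \<le> x" "x \<le> z"
    then have "x > c" by simp
    from dH[OF this] show "\<exists>y. DERIV H x :> y \<and> y \<le> 0" by (intro exI conjI) (assumption, simp)
  qed
  have contA: "continuous_on UNIV A"
    by (intro DERIV_continuous_on) (use dA in \<open>auto intro: DERIV_subset\<close>)
  have "bounded (A ` {0..c+1})"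
    by (intro compact_imp_bounded compact_continuous_image continuous_on_subset[OF contA]) auto
  then obtain K where K: "\<And>z. z \<in> {0..c+1} \<Longrightarrow> \<bar>A z\<bar> \<le> K" by (force simp: bounded_iff)
  show ?thesis
  proof (rule that)
    fix x :: real assume x: "x > 0"
    define z where "z = x\<^sup>2 / 4"
    have z: "z > 0" using x by (simp add: z_def)
    have "z powr (\<nu> / 2) = (x / 2) powr \<nu>"
    proof -
      have "z = (x / 2) powr 2" using x by (simp add: z_def power_divide)
      then show ?thesis by (simp add: powr_powr)
    qed
    then have J: "Bessel_J \<nu> x = z powr (\<nu> / 2) * A z"
      by (simp add: Bessel_J_eq_entire z_def A_def)
    have "\<bar>Bessel_J \<nu> x\<bar> \<le> (c + 1) powr (\<nu> / 2) * K \<or> \<bar>Bessel_J \<nu> x\<bar> \<le> sqrt (H (c + 1))"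
    proof (cases "z \<le> c + 1")
      case True
      then show ?thesis using K[of z] z assms c unfolding J abs_mult
        by (intro disjI1 mult_mono) (auto intro: powr_mono2)
    next
      case False
      have "(Bessel_J \<nu> x)\<^sup>2 = z powr \<nu> * (A z)\<^sup>2"
        using z powr_powr[of z "\<nu>/2" 2] by (simp add: J power_mult_distrib)
      \<comment> \<open>The second summand of H is nonnegative for z > c and is dropped.\<close>
      also have "\<dots> \<le> H z" using False by (simp add: H_def distrib_left)
      also have "\<dots> \<le> H (c + 1)" using False by (intro H_le) auto
      finally show ?thesis by (simp add: real_le_rsqrt)
    qed
    then show "\<bar>Bessel_J \<nu> x\<bar> \<le> max ((c + 1) powr (\<nu> / 2) * K) (sqrt (H (c + 1)))" by linarith
  qed
qed

section \<open>Laplace transforms of Bessel functions\<close>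

lemma borel_measurable_bessel_entire [measurable]: "bessel_entire \<nu> \<in> borel_measurable borel"
  unfolding bessel_entire_def by measurable

lemma borel_measurable_Bessel_J [measurable]: "Bessel_J \<nu> \<in> borel_measurable borel"
  unfolding Bessel_J_def by measurable

text \<open>The transform of x^(\<nu>+m) brings Gamma(\<nu> + m + 1), which cancels the
  \<open>rGamma\<close> in the coefficient and leaves the exponential series of -a/y. With absolute
  values the same computation gives the series of a/y, which justifies integrating term by
  term.\<close>

lemma lap_bessel_entire:
  assumes "\<nu> \<ge> 0" "a > 0" "y > 0"
  shows "has_bochner_integral (laplace_measure y) (\<lambda>x. x powr \<nu> * bessel_entire \<nu> (a * x))
           (y powr (- \<nu> - 1) * exp (- (a / y)))"
proof -
  define f where "f = (\<lambda>m x. x powr \<nu> * (bessel_coeff \<nu> m * (a * x) ^ m))"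
  have fI: "has_bochner_integral (laplace_measure y) (f m) (y powr (- \<nu> - 1) * ((- (a / y)) ^ m / fact m))"
    and fN: "has_bochner_integral (laplace_measure y) (\<lambda>x. norm (f m x)) (y powr (- \<nu> - 1) * ((a / y) ^ m / fact m))" for m
  proof -
    have "Gamma (\<nu> + real m + 1) > 0" using assms by (intro Gamma_real_pos) auto
    then have cG: "bessel_coeff \<nu> m * Gamma (\<nu> + real m + 1) = (-1) ^ m / fact m"
        "\<bar>bessel_coeff \<nu> m\<bar> * Gamma (\<nu> + real m + 1) = 1 / fact m"
      by (simp_all add: bessel_coeff_def rGamma_inverse_Gamma abs_mult power_abs)
    have *: "x powr (\<nu> + real m) = x powr \<nu> * x ^ m" if "x > 0" for x
      using that by (simp add: powr_add powr_realpow)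
    have **: "y powr (- (\<nu> + real m) - 1) = y powr (- \<nu> - 1) / y ^ m"
      using assms powr_diff[of y "- \<nu> - 1" "real m"] by (simp add: powr_realpow algebra_simps)
    have I: "has_bochner_integral (laplace_measure y) (\<lambda>x. x powr (\<nu> + real m)) (Gamma (\<nu> + real m + 1) * (y powr (- \<nu> - 1) / y ^ m))"
      using lap_powr[of "\<nu> + real m" y] assms unfolding ** by auto
    show "has_bochner_integral (laplace_measure y) (f m) (y powr (- \<nu> - 1) * ((- (a / y)) ^ m / fact m))"
      using has_bochner_integral_mult_right[OF I, of "bessel_coeff \<nu> m * a ^ m"]
    proof (rule has_bochner_integral_lap_cong[THEN iffD1, rotated -1])
      show "bessel_coeff \<nu> m * a ^ m * (Gamma (\<nu> + real m + 1) * (y powr (- \<nu> - 1) / y ^ m)) =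
            y powr (- \<nu> - 1) * ((- (a / y)) ^ m / fact m)"
      proof -
        have "bessel_coeff \<nu> m * a ^ m * (Gamma (\<nu> + real m + 1) * (y powr (- \<nu> - 1) / y ^ m)) =
            (bessel_coeff \<nu> m * Gamma (\<nu> + real m + 1)) * (y powr (- \<nu> - 1) * (a ^ m / y ^ m))" by simp
        then show ?thesis unfolding cG by (simp add: power_minus[of "a / y"] power_divide mult_ac)
      qed
    qed (auto simp: f_def * power_mult_distrib)
    show "has_bochner_integral (laplace_measure y) (\<lambda>x. norm (f m x)) (y powr (- \<nu> - 1) * ((a / y) ^ m / fact m))"
      using has_bochner_integral_mult_right[OF I, of "\<bar>bessel_coeff \<nu> m\<bar> * a ^ m"]
    proof (rule has_bochner_integral_lap_cong[THEN iffD1, rotated -1])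
      show "\<bar>bessel_coeff \<nu> m\<bar> * a ^ m * (Gamma (\<nu> + real m + 1) * (y powr (- \<nu> - 1) / y ^ m)) =
            y powr (- \<nu> - 1) * ((a / y) ^ m / fact m)"
      proof -
        have "\<bar>bessel_coeff \<nu> m\<bar> * a ^ m * (Gamma (\<nu> + real m + 1) * (y powr (- \<nu> - 1) / y ^ m)) =
            (\<bar>bessel_coeff \<nu> m\<bar> * Gamma (\<nu> + real m + 1)) * (y powr (- \<nu> - 1) * (a ^ m / y ^ m))" by simp
        then show ?thesis unfolding cG by (simp add: power_divide)
      qed
    qed (use assms in \<open>auto simp: f_def * power_mult_distrib abs_mult\<close>)
  qed
  have sum_f: "(\<Sum>m. f m x) = x powr \<nu> * bessel_entire \<nu> (a * x)" for x
    unfolding f_def bessel_entire_def using assms by (intro suminf_mult summable_bessel)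
  have summ: "AE x in laplace_measure y. summable (\<lambda>m. norm (f m x))"
    using summable_bessel_norm[OF assms(1)] by (auto simp: f_def abs_mult intro!: summable_mult)
  have exps: "(\<lambda>m. z ^ m / fact m) sums exp z" for z :: real
    using exp_converges[of z] by (simp add: field_simps)
  have summI: "summable (\<lambda>m. \<integral>x. norm (f m x) \<partial>laplace_measure y)"
    using sums_mult[OF exps, of "y powr (- \<nu> - 1)" "a / y"] has_bochner_integral_integral_eq[OF fN]
    by (simp add: sums_iff)
  have int: "integrable (laplace_measure y) (f m)" for m using fI by (auto simp: has_bochner_integral_iff)
  show ?thesis
    using integrable_suminf[OF int summ summI] integral_suminf[OF int summ summI]
      sums_mult[OF exps, of "y powr (- \<nu> - 1)" "- (a / y)"] has_bochner_integral_integral_eq[OF fI]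
    by (simp add: has_bochner_integral_iff sum_f sums_iff)
qed

lemma lap_Bessel_J:
  assumes "\<nu> \<ge> 0" "a > 0" "y > 0"
  shows "has_bochner_integral (laplace_measure y) (\<lambda>x. x powr (\<nu> / 2) * Bessel_J \<nu> (2 * sqrt (a * x)))
           (a powr (\<nu> / 2) * y powr (- \<nu> - 1) * exp (- (a / y)))"
proof -
  have eq: "a powr (\<nu> / 2) * (x powr \<nu> * bessel_entire \<nu> (a * x)) = x powr (\<nu> / 2) * Bessel_J \<nu> (2 * sqrt (a * x))"
    if "x > 0" for x
  proof -
    have "Bessel_J \<nu> (2 * sqrt (a * x)) = (sqrt (a * x)) powr \<nu> * bessel_entire \<nu> (a * x)"
      using that assms by (simp add: Bessel_J_eq_entire power_mult_distrib)
    also have "sqrt (a * x) powr \<nu> = a powr (\<nu> / 2) * x powr (\<nu> / 2)"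
      using that assms by (simp add: powr_half_sqrt[symmetric] powr_powr powr_mult mult.commute)
    finally have "x powr (\<nu> / 2) * Bessel_J \<nu> (2 * sqrt (a * x)) = a powr (\<nu> / 2) * (x powr (\<nu> / 2) * x powr (\<nu> / 2)) * bessel_entire \<nu> (a * x)"
      by simp
    then show ?thesis by (simp flip: powr_add)
  qed
  show ?thesis
    using has_bochner_integral_mult_right[OF lap_bessel_entire[OF assms], of "a powr (\<nu> / 2)"]
    by (rule has_bochner_integral_lap_cong[THEN iffD1, rotated -1]) (auto simp: eq)
qed

section \<open>Mellin transforms and the Hecke correspondence\<close>

lemma of_real_powr_exp: "t > 0 \<Longrightarrow> complex_of_real t powr z = exp (z * of_real (ln t))"
  by (simp add: powr_def Ln_of_real)

lemma of_real_powr_measurable [measurable]: "(\<lambda>t. complex_of_real t powr z) \<in> borel_measurable borel"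
  unfolding powr_def by measurable

lemma norm_of_real_powr: "t > 0 \<Longrightarrow> norm (complex_of_real t powr z) = t powr Re z"
  by (simp add: norm_powr_real_powr)

text \<open>A bridge: the fundamental theorem of calculus and the change of variables are used in
  gauge or completed Lebesgue form, everything else runs in \<open>lborel\<close>. Borel
  measurability makes the completion harmless.\<close>

lemma has_bochner_integral_lborel_from_lebesgue:
  fixes f :: "real \<Rightarrow> 'a :: euclidean_space"
  assumes "f absolutely_integrable_on S" "(f has_integral I) S"
    and [measurable]: "S \<in> sets borel" "f \<in> borel_measurable borel"
  shows "has_bochner_integral lborel (\<lambda>t. indicator S t *\<^sub>R f t) I"
proof -
  have m: "(\<lambda>t. indicator S t *\<^sub>R f t) \<in> borel_measurable lborel" by measurable
  have "integrable lborel (\<lambda>t. indicator S t *\<^sub>R f t)"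
    using assms(1) m unfolding set_integrable_def by (subst (asm) integrable_completion) auto
  moreover have "(LINT t:S|lebesgue. f t) = I"
    using set_lebesgue_integral_eq_integral(2)[OF assms(1)] assms(2) by (simp add: integral_unique)
  ultimately show ?thesis
    using m unfolding set_lebesgue_integral_def
    by (simp add: integral_completion has_bochner_integral_iff)
qed

text \<open>The substitution t = 1/u. It serves twice: to fold the part of a Mellin integral below 1
  onto a tail, and to bring the u-integral over (0, 1/2) into Gamma form.\<close>

lemma has_bochner_integral_inversion:
  fixes f :: "real \<Rightarrow> 'a :: euclidean_space"
  assumes [measurable]: "f \<in> borel_measurable borel"
    and I: "has_bochner_integral lborel (\<lambda>u. indicator {1..} u *\<^sub>R ((1 / u\<^sup>2) *\<^sub>R f (1 / u))) I"
  shows "has_bochner_integral lborel (\<lambda>t. indicator {0<..1} t *\<^sub>R f t) I"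
proof -
  let ?h = "\<lambda>u::real. - (1 / u\<^sup>2)"
  let ?f = "\<lambda>u. \<bar>?h u\<bar> *\<^sub>R f (1 / u)"
  have m: "(\<lambda>u. indicator {1..} u *\<^sub>R ?f u) \<in> borel_measurable lborel" by measurable
  have int: "integrable lborel (\<lambda>u. indicator {1..} u *\<^sub>R ?f u)"
    and val: "(\<integral>u. indicator {1..} u *\<^sub>R ?f u \<partial>lborel) = I"
    using I by (auto simp: has_bochner_integral_iff)
  have a: "?f absolutely_integrable_on {1..}"
    using int m unfolding set_integrable_def by (subst integrable_completion) auto
  have b: "integral {1..} ?f = I"
    using set_lebesgue_integral_eq_integral(2)[OF a] val m
    by (simp add: set_lebesgue_integral_def integral_completion)
  have img: "(\<lambda>u::real. 1 / u) ` {1..} = {0<..1}"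
  proof safe
    fix x :: real assume "x \<in> {0<..1}"
    then show "x \<in> (\<lambda>u::real. 1 / u) ` {1..}"
      by (intro image_eqI[of _ _ "1 / x"]) (auto simp: field_simps)
  qed (auto simp: field_simps)
  have "f absolutely_integrable_on (\<lambda>u. 1 / u) ` {1..} \<and> integral ((\<lambda>u. 1 / u) ` {1..}) f = I"
    using a b
    by (subst has_absolute_integral_change_of_variables_real[of "{1..}" "\<lambda>u. 1 / u" ?h f I, symmetric])
       (auto intro!: derivative_eq_intros simp: inj_on_def power2_eq_square)
  then show ?thesis unfolding img
    by (intro has_bochner_integral_lborel_from_lebesgue)
       (auto simp: has_integral_integral[symmetric] dest: set_lebesgue_integral_eq_integral(1) intro: integrable_integral)
qed

text \<open>The source of every pole term of the continuation.\<close>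

lemma has_bochner_integral_powr_01:
  assumes "Re z > 0"
  shows "has_bochner_integral lborel (\<lambda>t. indicator {0<..1} t *\<^sub>R (complex_of_real t powr (z - 1))) (1 / z)"
proof (rule has_bochner_integral_lborel_from_lebesgue)
  have "((\<lambda>t. complex_of_real t powr (z - 1)) has_integral
            (of_real 1 powr z / z - of_real 0 powr z / z)) {0..1}" using assms
    by (intro fundamental_theorem_of_calculus_interior)
       (auto intro!: continuous_intros derivative_eq_intros has_vector_derivative_real_field)
  then have "((\<lambda>t. complex_of_real t powr (z - 1)) has_integral 1 / z) {0..1}" by simp
  then show *: "((\<lambda>t. complex_of_real t powr (z - 1)) has_integral 1 / z) {0<..1}"
    by (rule has_integral_spike_set_eq[THEN iffD1, rotated -1]) (auto intro: negligible_subset[of "{0}"])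
  have "(\<lambda>t. t powr (Re z - 1)) integrable_on {0<..1}"
    using assms by (intro integrable_on_powr_from_0') auto
  then have "(\<lambda>t. norm (complex_of_real t powr (z - 1))) integrable_on {0<..1}"
    by (rule integrable_eq) (auto simp: norm_of_real_powr)
  then show "(\<lambda>t. complex_of_real t powr (z - 1)) absolutely_integrable_on {0<..1}"
    using * by (intro absolutely_integrable_onI) (auto simp: has_integral_integrable)
qed auto

section \<open>The entire part of a Mellin transform\<close>

lemma mellin_tail_integrable:
  fixes h :: "real \<Rightarrow> complex"
  assumes [measurable]: "h \<in> borel_measurable borel"
    and "c > 0" and bound: "\<And>t. t \<ge> 1 \<Longrightarrow> norm (h t) \<le> C * exp (- (c * t))"
  shows "integrable lborel (\<lambda>t. indicator {1..} t *\<^sub>R (norm (h t) * t powr p))"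
proof (rule Bochner_Integration.integrable_bound)
  have "integrable lborel (\<lambda>t. (indicator {0<..} t * exp (- (t * c))) *\<^sub>R (indicator {1..} t * t powr p))"
    using integrable_lap_powr_tail[OF assms(2), of 1 p] has_bochner_integral_lap_iff[of "\<lambda>t. indicator {1..} t * t powr p" c]
    by (auto simp: has_bochner_integral_iff)
  then show "integrable lborel (\<lambda>t. C * ((indicator {0<..} t * exp (- (t * c))) *\<^sub>R (indicator {1..} t * t powr p)))"
    by (rule integrable_mult_right)
  show "AE t in lborel. norm (indicator {1..} t *\<^sub>R (norm (h t) * t powr p)) \<le>
      norm (C * ((indicator {0<..} t * exp (- (t * c))) *\<^sub>R (indicator {1..} t * t powr p)))"
  proof (intro AE_I2)
    fix t :: real
    show "norm (indicator {1..} t *\<^sub>R (norm (h t) * t powr p)) \<le>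
      norm (C * ((indicator {0<..} t * exp (- (t * c))) *\<^sub>R (indicator {1..} t * t powr p)))"
    proof (cases "t \<ge> 1")
      case True
      have "norm (h t) \<le> \<bar>C * exp (- (c * t))\<bar>" using bound[OF True] by linarith
      from mult_right_mono[OF this, of "t powr p"] show ?thesis
        using True by (simp add: abs_mult mult_ac)
    qed auto
  qed
qed measurable

definition mellin_tail :: "(real \<Rightarrow> complex) \<Rightarrow> complex \<Rightarrow> complex" where
  "mellin_tail h s = (LBINT t:{1..}. h t * of_real t powr (s - 1))"

lemma mellin_tail_has_integral:
  fixes h :: "real \<Rightarrow> complex"
  assumes [measurable]: "h \<in> borel_measurable borel"
    and "c > 0" and "\<And>t. t \<ge> 1 \<Longrightarrow> norm (h t) \<le> C * exp (- (c * t))"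
  shows "has_bochner_integral lborel (\<lambda>t. indicator {1..} t *\<^sub>R (h t * of_real t powr (s - 1))) (mellin_tail h s)"
proof -
  have "integrable lborel (\<lambda>t. indicator {1..} t *\<^sub>R (h t * of_real t powr (s - 1)))"
  proof (rule Bochner_Integration.integrable_bound[OF mellin_tail_integrable[OF assms, of "Re s - 1"]])
    show "AE t in lborel. norm (indicator {1..} t *\<^sub>R (h t * of_real t powr (s - 1)))
       \<le> norm (indicator {1..} t *\<^sub>R (norm (h t) * t powr (Re s - 1)))"
      by (intro AE_I2) (auto simp: indicator_def norm_mult norm_of_real_powr)
  qed measurable
  then show ?thesis
    by (simp add: has_bochner_integral_iff mellin_tail_def set_lebesgue_integral_def)
qed

text \<open>Expanding \<open>t\<^sup>s\<^sup>-\<^sup>1\<close> in powers of \<open>s - 1\<close> gives a power series that converges everywhere.\<close>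
lemma mellin_tail_holomorphic:
  fixes h :: "real \<Rightarrow> complex"
  assumes [measurable]: "h \<in> borel_measurable borel"
    and "c > 0" and "\<And>t. t \<ge> 1 \<Longrightarrow> norm (h t) \<le> C * exp (- (c * t))"
  shows "mellin_tail h holomorphic_on UNIV"
proof -
  define f where "f = (\<lambda>w j t. indicator {1..} t *\<^sub>R (h t * (w * of_real (ln t)) ^ j / fact j))"
  define a where "a = (\<lambda>j. \<integral>t. f 1 j t \<partial>lborel)"
  have f_meas [measurable]: "f w j \<in> borel_measurable borel" for w j unfolding f_def by measurable
  have nf: "norm (f w j t) = indicator {1..} t * (norm (h t) * ((norm w * ln t) ^ j / fact j))" for w j t
    by (auto simp: f_def norm_mult norm_power norm_divide indicator_def power_mult_distrib)
  have exps: "(\<lambda>j. z ^ j / fact j) sums exp z" for z :: "'a :: {real_normed_field, banach}"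
    using exp_converges[of z] by (simp add: scaleR_conv_of_real field_simps)
  have "(\<lambda>j. a j * (s - 1) ^ j) sums mellin_tail h s" for s
  proof -
    let ?w = "s - 1"
    \<comment> \<open>For t >= 1 the logarithm is nonnegative, so the norms of the terms sum to
      |h(t)| e^(|s-1| ln t) = |h(t)| t^|s-1|. This single integrable function dominates all partial
      sums.\<close>
    define g where "g = (\<lambda>t. indicator {1..} t *\<^sub>R (norm (h t) * t powr (norm ?w)))"
    have g_int: "integrable lborel g" unfolding g_def by (rule mellin_tail_integrable[OF assms])
    have ns: "(\<lambda>j. norm (f ?w j t)) sums g t" for t
    proof (cases "t \<ge> 1")
      case True
      then show ?thesis
        using sums_mult[OF exps[of "norm ?w * ln t"], of "norm (h t)"]
        by (simp add: nf g_def powr_def)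
    qed (auto simp: nf g_def)
    have f_le: "norm (f ?w j t) \<le> norm (g t)" for j t
      using sum_le_suminf[of "\<lambda>j. norm (f ?w j t)" "{j}"] ns[of t] by (auto simp: sums_iff)
    have f_int: "integrable lborel (f ?w j)" for j
      using f_le by (intro Bochner_Integration.integrable_bound[OF g_int]) auto
    have summ: "AE t in lborel. summable (\<lambda>j. norm (f ?w j t))"
      using ns by (auto simp: sums_iff)
    have "summable (\<lambda>j. \<integral>t. norm (f ?w j t) \<partial>lborel)"
    proof (rule summableI_nonneg_bounded)
      fix n
      have "(\<Sum>j<n. \<integral>t. norm (f ?w j t) \<partial>lborel) = (\<integral>t. (\<Sum>j<n. norm (f ?w j t)) \<partial>lborel)"
        using f_int by (subst Bochner_Integration.integral_sum) auto
      also have "\<dots> \<le> integral\<^sup>L lborel g"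
      proof (rule integral_mono)
        show "(\<Sum>j<n. norm (f ?w j t)) \<le> g t" for t
          using sum_le_suminf[of "\<lambda>j. norm (f ?w j t)" "{..<n}"] ns[of t] by (auto simp: sums_iff)
      qed (use f_int g_int in auto)
      finally show "(\<Sum>j<n. \<integral>t. norm (f ?w j t) \<partial>lborel) \<le> integral\<^sup>L lborel g" .
    qed auto
    from sums_integral[OF f_int summ this]
    have "(\<lambda>j. \<integral>t. f ?w j t \<partial>lborel) sums (\<integral>t. (\<Sum>j. f ?w j t) \<partial>lborel)" .
    moreover have "(\<integral>t. f ?w j t \<partial>lborel) = a j * ?w ^ j" for j
    proof -
      have "f ?w j t = f 1 j t * ?w ^ j" for t by (simp add: f_def power_mult_distrib scaleR_conv_of_real)
      then show ?thesis by (simp add: a_def)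
    qed
    moreover have "(\<Sum>j. f ?w j t) = indicator {1..} t *\<^sub>R (h t * of_real t powr (s - 1))" for t
    proof (cases "t \<ge> 1")
      case True
      then show ?thesis
        using sums_mult[OF exps[of "?w * of_real (ln t)"], of "h t"]
        by (simp add: f_def of_real_powr_exp sums_iff)
    qed (auto simp: f_def)
    ultimately show ?thesis by (simp add: mellin_tail_def set_lebesgue_integral_def)
  qed
  then have "mellin_tail h holomorphic_on ball 1 r" for r
    by (intro power_series_holomorphic) auto
  from holomorphic_on_imp_differentiable_at[OF this open_ball]
  have "mellin_tail h field_differentiable at s" if "s \<in> ball 1 r" for s r using that by blast
  from this[of s "dist 1 s + 1" for s] show ?thesis
    by (auto simp: holomorphic_on_def field_differentiable_at_within)
qed


text \<open>The closed form of Riemann's splitting. Here \<open>a0\<close>, \<open>a1\<close> and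
  \<open>b0\<close>, \<open>b1\<close> are the coefficients of 1 and t^(1-k) removed from the two
  functions, w is the root number (later i^k), and each fraction is an integral of a pure power over
  (0, 1].\<close>

definition mellin_ext ::
  "real \<Rightarrow> complex \<Rightarrow> (real \<Rightarrow> complex) \<Rightarrow> (real \<Rightarrow> complex) \<Rightarrow>
     complex \<Rightarrow> complex \<Rightarrow> complex \<Rightarrow> complex \<Rightarrow> complex \<Rightarrow> complex" where
  "mellin_ext k w h g a0 a1 b0 b1 s =
     mellin_tail h s + w * mellin_tail g (of_real k - s)
       + w * b0 / (s - of_real k) + w * b1 / (s - 1) - a0 / s - a1 / (s + 1 - of_real k)"

text \<open>Under s -> k - s the two tails trade places and the four pole terms are permuted with a
  change of sign. Exchanging the functions inverts the root number.\<close>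

lemma mellin_ext_reflect:
  assumes "w \<noteq> 0"
  shows "mellin_ext k w h g a0 a1 b0 b1 s = w * mellin_ext k (1 / w) g h b0 b1 a0 a1 (of_real k - s)"
proof -
  have e: "of_real k - (of_real k - s) = s" "of_real k - s - of_real k = - s"
    "of_real k - s - 1 = - (s + 1 - of_real k)" "of_real k - s + 1 - of_real k = - (s - 1)"
    by (auto simp: algebra_simps)
  have "of_real k - s = - (s - of_real k)" by simp
  moreover have "B + w * A + w * b0 / Y + w * b1 / Z - a0 / S - a1 / X =
      w * (A + 1 / w * B + 1 / w * a0 / (- S) + 1 / w * a1 / (- X) - b0 / (- Y) - b1 / (- Z))" for A B S X Y Z
    using assms by (simp add: ring_distribs)
  ultimately show ?thesis
    unfolding mellin_ext_def e by metis
qed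

lemma mellin_tail_analytic:
  fixes h :: "real \<Rightarrow> complex"
  assumes "h \<in> borel_measurable borel"
    and "c > 0" and "\<And>t. t \<ge> 1 \<Longrightarrow> norm (h t) \<le> C * exp (- (c * t))"
    and "f analytic_on A"
  shows "(\<lambda>s. mellin_tail h (f s)) analytic_on A"
proof -
  have "mellin_tail h analytic_on UNIV"
    using mellin_tail_holomorphic[OF assms(1-3)] by (simp add: analytic_on_open)
  from analytic_on_compose_gen[OF assms(4) this] show ?thesis by (simp add: o_def)
qed

text \<open>Above 1 the integral is a tail. Below 1 the transformation law replaces F by G(1/t),
  whose decaying part becomes a tail by inversion and whose constant terms become powers of t. The
  conditions on Re s make all four exponents s, s - 1, s - k, s + 1 - k positive in real
  part.\<close>

lemma mellin_ext_has_integral: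
  fixes F G :: "real \<Rightarrow> complex" and k :: real and w a0 a1 b0 b1 :: complex
  defines "h \<equiv> \<lambda>t. F t - a0 - a1 * of_real (t powr (1 - k))"
  defines "g \<equiv> \<lambda>t. G t - b0 - b1 * of_real (t powr (1 - k))"
  assumes [measurable]: "F \<in> borel_measurable borel" "G \<in> borel_measurable borel"
    and c: "c > 0"
    and h_bound: "\<And>t. t \<ge> 1 \<Longrightarrow> norm (h t) \<le> C * exp (- (c * t))"
    and g_bound: "\<And>t. t \<ge> 1 \<Longrightarrow> norm (g t) \<le> C * exp (- (c * t))"
    and trans: "\<And>t. t > 0 \<Longrightarrow> F t = w * of_real (t powr (- k)) * G (1 / t)"
    and s: "Re s > 1" "Re s > k"
  shows "has_bochner_integral lborel (\<lambda>t. indicator {0<..} t *\<^sub>R (h t * of_real t powr (s - 1)))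
           (mellin_ext k w h g a0 a1 b0 b1 s)"
proof -
  have hm [measurable]: "h \<in> borel_measurable borel" and gm [measurable]: "g \<in> borel_measurable borel"
    unfolding h_def g_def by measurable
  have tail_h: "has_bochner_integral lborel (\<lambda>t. indicator {1..} t *\<^sub>R (h t * of_real t powr (s - 1))) (mellin_tail h s)"
    by (rule mellin_tail_has_integral[OF hm c h_bound])
  have tail_g: "has_bochner_integral lborel (\<lambda>t. indicator {0<..1} t *\<^sub>R (of_real (t powr (- k)) * g (1 / t) * of_real t powr (s - 1)))
      (mellin_tail g (of_real k - s))"
  proof (rule has_bochner_integral_inversion)
    have "indicator {1..} u *\<^sub>R (1 / u\<^sup>2) *\<^sub>R (of_real ((1 / u) powr - k) * g (1 / (1 / u)) * of_real (1 / u) powr (s - 1)) =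
        indicator {1..} u *\<^sub>R (g u * of_real u powr (of_real k - s - 1))" for u :: real
    proof (cases "u \<ge> 1")
      case True
      have "(1 / u\<^sup>2) * (1 / u) powr - k = u powr (k - 2)"
        using True by (simp add: powr_minus powr_divide powr_diff field_simps)
      then have "(1 / u\<^sup>2) *\<^sub>R (of_real ((1 / u) powr - k) * g (1 / (1 / u)) * of_real (1 / u) powr (s - 1)) =
          of_real (u powr (k - 2)) * of_real (1 / u) powr (s - 1) * g u"
        by (simp only: scaleR_conv_of_real flip: mult.assoc of_real_mult) simp
      also have "of_real (u powr (k - 2)) * of_real (1 / u) powr (s - 1) = of_real u powr (of_real k - s - 1)"
      proof -
        have "of_real (u powr (k - 2)) = complex_of_real u powr of_real (k - 2)"
          using True by (simp only: powr_of_real)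
        then show ?thesis using True
          by (simp only: of_real_powr_exp zero_less_divide_1_iff) (simp add: of_real_powr_exp ln_div ring_distribs flip: exp_add)
      qed
      finally show ?thesis by simp
    qed auto
    then show "has_bochner_integral lborel
     (\<lambda>u. indicator {1..} u *\<^sub>R (1 / u\<^sup>2) *\<^sub>R (of_real ((1 / u) powr - k) * g (1 / (1 / u)) * of_real (1 / u) powr (s - 1)))
     (mellin_tail g (of_real k - s))"
      using mellin_tail_has_integral[OF gm c g_bound, of "of_real k - s"] by simp
  qed measurable
  define P where "P = (\<lambda>z t. indicator {0<..1} t *\<^sub>R (complex_of_real t powr (z - 1)))"
  have P: "has_bochner_integral lborel (\<lambda>t. A * P z t) (A / z)" if "Re z > 0" for A z
    using has_bochner_integral_mult_right[OF has_bochner_integral_powr_01[OF that], of A] by (simp add: P_def)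
  define T where "T = (\<lambda>t. w * (indicator {0<..1} t *\<^sub>R (of_real (t powr (- k)) * g (1 / t) * of_real t powr (s - 1)))
      + w * b0 * P (s - of_real k) t + w * b1 * P (s - 1) t - a0 * P s t - a1 * P (s + 1 - of_real k) t)"
  have T: "has_bochner_integral lborel T
     (w * mellin_tail g (of_real k - s) + w * b0 / (s - of_real k) + w * b1 / (s - 1) - a0 / s - a1 / (s + 1 - of_real k))"
    unfolding T_def using s
    by (intro has_bochner_integral_add has_bochner_integral_diff P has_bochner_integral_mult_right tail_g) auto
  have T_eq: "T t = indicator {0<..1} t *\<^sub>R (h t * of_real t powr (s - 1))" for t
  proof (cases "t \<in> {0<..1}")
    case True
    then have t: "t > 0" by simp
    have p: "of_real t powr (s - of_real k - 1) = of_real (t powr (-k)) * of_real t powr (s - 1)"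
      "of_real t powr (s - 1 - 1) = of_real (1 / t) * of_real t powr (s - 1)"
      "of_real t powr (s + 1 - of_real k - 1) = of_real (t powr (1 - k)) * of_real t powr (s - 1)"
    proof -
      have *: "complex_of_real (t powr r) = exp (of_real r * of_real (ln t))" for r
        using t by (simp add: powr_def exp_of_real flip: of_real_mult)
      have **: "complex_of_real (1 / t) = exp (- of_real (ln t))"
        using t by (simp add: exp_minus exp_of_real field_simps)
      show "of_real t powr (s - of_real k - 1) = of_real (t powr (-k)) * of_real t powr (s - 1)"
        "of_real t powr (s - 1 - 1) = of_real (1 / t) * of_real t powr (s - 1)"
        "of_real t powr (s + 1 - of_real k - 1) = of_real (t powr (1 - k)) * of_real t powr (s - 1)"
        unfolding * ** of_real_powr_exp[OF t] by (simp_all add: algebra_simps flip: exp_add)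
    qed
    \<comment> \<open>Hence the t^(1-k) term of G contributes the pole term at s = 1, whatever k
      is.\<close>
    have "t powr (- k) * (1 / t) powr (1 - k) = 1 / t"
      using t by (simp add: powr_divide powr_diff powr_minus field_simps)
    then have q: "complex_of_real (t powr (- k)) * of_real ((1 / t) powr (1 - k)) = of_real (1 / t)"
      by (metis of_real_mult)
    have "h t = w * of_real (t powr (- k)) * (g (1 / t) + b0 + b1 * of_real ((1 / t) powr (1 - k))) - a0 - a1 * of_real (t powr (1 - k))"
      using trans[OF t] by (simp add: h_def g_def)
    also have "\<dots> = w * of_real (t powr (- k)) * g (1 / t) + w * b0 * of_real (t powr (- k)) + w * b1 * (of_real (t powr (- k)) * of_real ((1 / t) powr (1 - k))) - a0 - a1 * of_real (t powr (1 - k))"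
      by (simp only: ring_distribs mult_ac)
    finally have h: "h t = w * of_real (t powr (- k)) * g (1 / t) + w * b0 * of_real (t powr (- k)) + w * b1 * of_real (1 / t) - a0 - a1 * of_real (t powr (1 - k))"
      unfolding q .
    show ?thesis using True unfolding T_def P_def p h
      by (simp add: ring_distribs mult_ac)
  qed (auto simp: T_def P_def)
  have "has_bochner_integral lborel (\<lambda>t. T t + indicator {1..} t *\<^sub>R (h t * of_real t powr (s - 1)))
     ((w * mellin_tail g (of_real k - s) + w * b0 / (s - of_real k) + w * b1 / (s - 1) - a0 / s - a1 / (s + 1 - of_real k)) + mellin_tail h s)"
    by (intro has_bochner_integral_add T tail_h)
  also have "(w * mellin_tail g (of_real k - s) + w * b0 / (s - of_real k) + w * b1 / (s - 1) - a0 / s - a1 / (s + 1 - of_real k)) + mellin_tail h s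
     = mellin_ext k w h g a0 a1 b0 b1 s" by (simp add: mellin_ext_def)
  finally have "has_bochner_integral lborel (\<lambda>t. T t + indicator {1..} t *\<^sub>R (h t * of_real t powr (s - 1))) (mellin_ext k w h g a0 a1 b0 b1 s)" .
  moreover have "has_bochner_integral lborel (\<lambda>t. T t + indicator {1..} t *\<^sub>R (h t * of_real t powr (s - 1))) J \<longleftrightarrow>
      has_bochner_integral lborel (\<lambda>t. indicator {0<..} t *\<^sub>R (h t * of_real t powr (s - 1))) J" for J
  proof (rule has_bochner_integral_cong_AE)
    show "AE t in lborel. T t + indicator {1..} t *\<^sub>R (h t * of_real t powr (s - 1)) =
        indicator {0<..} t *\<^sub>R (h t * of_real t powr (s - 1))"
      \<comment> \<open>The two pieces overlap only at t = 1.\<close>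
      using AE_lborel_singleton[of 1] by eventually_elim (auto simp: T_eq indicator_def)
  qed (auto simp: T_eq)
  ultimately show ?thesis by simp
qed

lemma hecke_functional_equation:
  fixes F G :: "real \<Rightarrow> complex" and k :: real and w a0 a1 b0 b1 :: complex
  defines "h \<equiv> \<lambda>t. F t - a0 - a1 * of_real (t powr (1 - k))"
  defines "g \<equiv> \<lambda>t. G t - b0 - b1 * of_real (t powr (1 - k))"
  assumes Fm [measurable]: "F \<in> borel_measurable borel" and Gm [measurable]: "G \<in> borel_measurable borel"
    and w: "w \<noteq> 0" and c: "c > 0"
    and h_bound: "\<And>t. t \<ge> 1 \<Longrightarrow> norm (h t) \<le> C * exp (- (c * t))"
    and g_bound: "\<And>t. t \<ge> 1 \<Longrightarrow> norm (g t) \<le> C * exp (- (c * t))"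
    and trans: "\<And>t. t > 0 \<Longrightarrow> F t = w * of_real (t powr (- k)) * G (1 / t)"
  obtains Lf Lg \<sigma> where "Lf nicely_meromorphic_on UNIV" "Lg nicely_meromorphic_on UNIV"
    "\<And>s. Re s > \<sigma> \<Longrightarrow> has_bochner_integral lborel (\<lambda>t. indicator {0<..} t *\<^sub>R (h t * of_real t powr (s - 1))) (Lf s)"
    "\<And>s. Re s > \<sigma> \<Longrightarrow> has_bochner_integral lborel (\<lambda>t. indicator {0<..} t *\<^sub>R (g t * of_real t powr (s - 1))) (Lg s)"
    "\<And>s. Lf s = w * Lg (of_real k - s)"
proof -
  have hm: "h \<in> borel_measurable borel" and gm: "g \<in> borel_measurable borel"
    unfolding h_def g_def by measurable
  define Mg where "Mg = mellin_ext k (1 / w) g h b0 b1 a0 a1"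
  define Mf where "Mf = mellin_ext k w h g a0 a1 b0 b1"
  define Lg where "Lg = remove_sings Mg"
  \<comment> \<open>With this definition the functional equation holds at every point, poles
    included. The work left is that \<open>Lf\<close> is nicely meromorphic and agrees with the
    splitting formula \<open>Mf\<close> where the integral converges.\<close>
  define Lf where "Lf = (\<lambda>s. w * Lg (of_real k - s))"
  note an = mellin_tail_analytic[OF hm c h_bound] mellin_tail_analytic[OF gm c g_bound]
  have "Mg meromorphic_on UNIV"
    unfolding Mg_def mellin_ext_def
    by (intro meromorphic_intros analytic_on_imp_meromorphic_on an) (auto intro!: analytic_intros)
  then have Lg: "Lg nicely_meromorphic_on UNIV"
    unfolding Lg_def by (rule remove_sings_nicely_meromorphic)
  have "Lg meromorphic_on UNIV" using Lg by (simp add: nicely_meromorphic_on_def)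
  \<comment> \<open>The reflection carries punctured neighbourhoods to punctured neighbourhoods, so
    it commutes with \<open>remove_sings\<close>.\<close>
  have fm: "filtermap (\<lambda>s. of_real k - s) (at z) = at (of_real k - z)" for z :: complex
    using filtermap_at_shift[of "- of_real k" "- z"]
    by (simp add: filtermap_filtermap algebra_simps flip: filtermap_at_minus)
  have refl_mero: "(\<lambda>s. Mg (of_real k - s)) meromorphic_on UNIV"
    by (rule meromorphic_on_compose[OF \<open>Mg meromorphic_on UNIV\<close>]) (auto intro!: analytic_intros)
  have "remove_sings (\<lambda>s. Mg (of_real k - s)) nicely_meromorphic_on UNIV"
    by (rule remove_sings_nicely_meromorphic[OF refl_mero])
  moreover have rs: "remove_sings (\<lambda>s. Mg (of_real k - s)) s = Lg (of_real k - s)" for s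
    using remove_sings_compose[OF fm[of s], of Mg] by (simp add: Lg_def o_def)
  ultimately have "(\<lambda>s. Lg (of_real k - s)) nicely_meromorphic_on UNIV"
    by (simp flip: rs)
  then have Lf: "Lf nicely_meromorphic_on UNIV"
    unfolding Lf_def by (rule nicely_meromorphic_on_cmult_left)
  have ext_an: "mellin_ext k w' u v p0 p1 q0 q1 analytic_on {s}"
    if "Re s > 1" "Re s > k"
      and "\<And>f. f analytic_on {s} \<Longrightarrow> (\<lambda>z. mellin_tail u (f z)) analytic_on {s}"
        "\<And>f. f analytic_on {s} \<Longrightarrow> (\<lambda>z. mellin_tail v (f z)) analytic_on {s}"
    for s w' u v p0 p1 q0 q1
  proof -
    have "s \<noteq> 0" "s \<noteq> 1" "s \<noteq> of_real k" "s + 1 \<noteq> of_real k"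
      using that(1,2) by (auto simp: complex_eq_iff)
    then show ?thesis unfolding mellin_ext_def
      by (intro analytic_intros that) auto
  qed
  have Lg_eq: "Lg s = Mg s" if "Re s > 1" "Re s > k" for s
    unfolding Lg_def Mg_def using that by (intro remove_sings_at_analytic ext_an an)
  have Lf_eq: "Lf s = Mf s" if "Re s > 1" "Re s > k" for s
  proof -
    have "Mf analytic_on {s}" unfolding Mf_def using that by (intro ext_an an)
    then have "(\<lambda>s. 1 / w * Mf s) analytic_on {s}" by (intro analytic_intros)
    \<comment> \<open>The symmetry of the closed formula ties the reflected \<open>Mg\<close> to
      \<open>Mf\<close>.\<close>
    moreover have "(\<lambda>s. Mg (of_real k - s)) = (\<lambda>s. 1 / w * Mf s)"
      using mellin_ext_reflect[OF w] w by (auto simp: Mg_def Mf_def)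
    ultimately have "Lg (of_real k - s) = 1 / w * Mf s"
      by (subst rs[symmetric]) (simp add: remove_sings_at_analytic)
    then show ?thesis using w by (simp add: Lf_def)
  qed
  \<comment> \<open>The law at 1/t solved for G: the hypotheses are symmetric in F and G, with 1/w
    in place of w.\<close>
  have trans': "G t = 1 / w * of_real (t powr (- k)) * F (1 / t)" if "t > 0" for t
    using trans[of "1 / t"] that w by (simp add: powr_divide powr_minus field_simps)
  show ?thesis
  proof (rule that[OF Lf Lg])
    fix s :: complex assume s: "Re s > max 1 k"
    show "has_bochner_integral lborel (\<lambda>t. indicator {0<..} t *\<^sub>R (h t * of_real t powr (s - 1))) (Lf s)"
      using mellin_ext_has_integral[OF Fm Gm c h_bound[unfolded h_def] g_bound[unfolded g_def] trans, of s] s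
      by (simp add: Lf_eq Mf_def h_def g_def)
    show "has_bochner_integral lborel (\<lambda>t. indicator {0<..} t *\<^sub>R (g t * of_real t powr (s - 1))) (Lg s)"
      using mellin_ext_has_integral[OF Gm Fm c g_bound[unfolded g_def] h_bound[unfolded h_def] trans', of s] s
      by (simp add: Lg_eq Mg_def h_def g_def)
  qed (simp add: Lf_def)
qed

section \<open>Coefficient sequences and harmonic series\<close>

lemma bigo_powr_bound:
  fixes a :: "nat \<Rightarrow> complex"
  assumes "a \<in> O(\<lambda>n. of_real (real n powr \<mu>))" "\<mu> \<ge> 0"
  obtains C where "C \<ge> 0" "\<And>n. n \<ge> 1 \<Longrightarrow> norm (a n) \<le> C * real n powr \<mu>"
proof -
  obtain c where c: "c > 0" "eventually (\<lambda>n. norm (a n) \<le> c * norm (complex_of_real (real n powr \<mu>))) at_top"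
    using landau_o.bigE[OF assms(1)] by blast
  then obtain n0 where n0: "\<And>n. n \<ge> n0 \<Longrightarrow> norm (a n) \<le> c * real n powr \<mu>"
    by (auto simp: eventually_at_top_linorder)
  \<comment> \<open>The sum S absorbs the finitely many n below \<open>n0\<close>; since \<mu> is
    nonnegative, n^\<mu> is at least 1 for n >= 1.\<close>
  define S where "S = (\<Sum>n<n0. norm (a n))"
  have "S \<ge> 0" by (auto simp: S_def intro: sum_nonneg)
  show ?thesis
  proof (rule that[of "c + S"])
    show "c + S \<ge> 0" using c \<open>S \<ge> 0\<close> by simp
    fix n :: nat assume n: "n \<ge> 1"
    show "norm (a n) \<le> (c + S) * real n powr \<mu>"
    proof (cases "n < n0")
      case True
      then have "norm (a n) \<le> S" unfolding S_def by (intro member_le_sum) auto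
      also have "\<dots> \<le> (c + S) * 1" using c by simp
      also have "\<dots> \<le> (c + S) * real n powr \<mu>"
        using n assms(2) c \<open>S \<ge> 0\<close> by (intro mult_left_mono ge_one_powr_ge_zero) auto
      finally show ?thesis .
    next
      case False
      then have "norm (a n) \<le> c * real n powr \<mu>" using n0 by auto
      also have "\<dots> \<le> (c + S) * real n powr \<mu>" using \<open>S \<ge> 0\<close> by (intro mult_right_mono) auto
      finally show ?thesis .
    qed
  qed
qed

lemma summable_powr_Suc:
  fixes p :: real
  assumes "p < -1"
  shows "summable (\<lambda>n. real (Suc n) powr p)"
  using assms summable_Suc_iff[of "\<lambda>n. real n powr p"] by (simp add: summable_real_powr_iff)

lemma summable_powr_exp_Suc:
  fixes \<mu> c :: real
  assumes "c > 0"
  shows "summable (\<lambda>n. real (Suc n) powr \<mu> * exp (- (c * real (Suc n))))"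
proof (rule summable_comparison_test_bigo)
  show "summable (\<lambda>n. norm (real (Suc n) powr (-2)))"
    using summable_powr_Suc[of "-2"] by simp
  show "(\<lambda>n. real (Suc n) powr \<mu> * exp (- (c * real (Suc n)))) \<in> O(\<lambda>n. real (Suc n) powr (-2))"
    using assms by real_asymp
qed

section \<open>Bounds and measurability for the harmonic series\<close>

lemma upper_Gamma_nonneg: "upper_Gamma s z \<ge> 0" if "z > 0"
  using that by (subst upper_Gamma_lap) auto

text \<open>For t >= z, e^(-t) <= e^(-3z/4) e^(-t/4), and the last factor keeps the integral finite.
  The rate must exceed 1/2, because the argument will be z = 2 n y against the growing factor e^(n
  y); with 3/4 a decay e^(-n y/2) remains.\<close>

lemma upper_Gamma_exp_bound:
  assumes "z0 > 0"
  obtains K where "K \<ge> 0" "\<And>z. z \<ge> z0 \<Longrightarrow> upper_Gamma s z \<le> K * exp (- (3 / 4 * z))"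
proof -
  define f where "f = (\<lambda>t. indicator {z0..} t * t powr (s - 1) * exp (- (t / 4)))"
  have int: "integrable lborel f"
    using integrable_powr_exp_tail[of "1 / 4" z0 "s - 1"] assms by (simp add: f_def mult.assoc)
  show ?thesis
  proof (rule that)
    show "integral\<^sup>L lborel f \<ge> 0" by (rule integral_nonneg_AE) (auto simp: f_def)
    fix z assume z: "z \<ge> z0"
    have "upper_Gamma s z \<le> (\<integral>t. exp (- (3 / 4 * z)) * f t \<partial>lborel)"
      unfolding upper_Gamma_def set_lebesgue_integral_def
    proof (rule integral_mono)
      show "integrable lborel (\<lambda>t. indicator {z..} t *\<^sub>R (t powr (s - 1) * exp (- t)))"
        using integrable_powr_exp_tail[of 1 z "s - 1"] assms z by simp
      show "integrable lborel (\<lambda>t. exp (- (3 / 4 * z)) * f t)" using int by simp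
      fix t
      have "exp (- t) \<le> exp (- (3 / 4 * z)) * exp (- (t / 4))" if "t \<ge> z"
        using that by (simp flip: exp_add)
      from mult_left_mono[OF this, of "t powr (s - 1)"]
      show "indicator {z..} t *\<^sub>R (t powr (s - 1) * exp (- t)) \<le> exp (- (3 / 4 * z)) * f t"
        using z by (auto simp: f_def indicator_def mult_ac)
    qed
    then show "upper_Gamma s z \<le> integral\<^sup>L lborel f * exp (- (3 / 4 * z))" by (simp add: mult.commute)
  qed
qed

lemma borel_measurable_upper_Gamma [measurable]: "upper_Gamma s \<in> borel_measurable borel"
proof -
  have "(\<lambda>z. \<integral>t. (if z \<le> t then t powr (s - 1) * exp (- t) else 0) \<partial>lborel) \<in> borel_measurable borel"
    by measurable
  also have "(\<lambda>z. \<integral>t. (if z \<le> t then t powr (s - 1) * exp (- t) else 0) \<partial>lborel) = upper_Gamma s"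
    unfolding upper_Gamma_def set_lebesgue_integral_def
    by (intro ext Bochner_Integration.integral_cong) (auto simp: indicator_def)
  finally show ?thesis .
qed

text \<open>With y = 2 pi v this and the next definition are the parts of the harmonic series
  indexed by n >= 1 at \<tau> = i v: q^n = e^(-n y), and q^(-n) Gamma(1 - k, 4 pi n v) = e^(n y)
  Gamma(1 - k, 2 n y).\<close>

definition plus_part :: "(nat \<Rightarrow> complex) \<Rightarrow> real \<Rightarrow> complex" where
  "plus_part c y = (\<Sum>n. c (Suc n) * of_real (exp (- (real (Suc n) * y))))"

definition minus_part :: "real \<Rightarrow> (nat \<Rightarrow> complex) \<Rightarrow> real \<Rightarrow> complex" where
  "minus_part k c y =
     (\<Sum>n. c (Suc n) * of_real (exp (real (Suc n) * y) * upper_Gamma (1 - k) (2 * real (Suc n) * y)))"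

lemma borel_measurable_plus_part [measurable]: "plus_part c \<in> borel_measurable borel"
  unfolding plus_part_def by measurable

lemma borel_measurable_minus_part [measurable]: "minus_part k c \<in> borel_measurable borel"
  unfolding minus_part_def by measurable

lemma exp_series_decay:
  fixes c :: "nat \<Rightarrow> complex" and r :: "nat \<Rightarrow> real \<Rightarrow> real"
  assumes c: "\<And>n. n \<ge> 1 \<Longrightarrow> norm (c n) \<le> C * real n powr \<mu>" "C \<ge> 0" and "y0 > 0" "K \<ge> 0"
    and r: "\<And>n y. n \<ge> 1 \<Longrightarrow> y \<ge> y0 \<Longrightarrow> \<bar>r n y\<bar> \<le> K * exp (- (real n * y / 2))"
  obtains M where "M \<ge> 0" "\<And>y. y \<ge> y0 \<Longrightarrow> summable (\<lambda>n. norm (c (Suc n) * of_real (r (Suc n) y)))"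
    "\<And>y. y \<ge> y0 \<Longrightarrow> norm (\<Sum>n. c (Suc n) * of_real (r (Suc n) y)) \<le> M * exp (- (y / 4))"
proof -
  define d where "d = (\<lambda>n. C * K * (real (Suc n) powr \<mu> * exp (- (y0 / 4 * real (Suc n)))))"
  have sd: "summable d" unfolding d_def using assms(3) by (intro summable_mult summable_powr_exp_Suc) simp
  have d0: "d n \<ge> 0" for n using assms by (simp add: d_def)
  have le: "norm (c (Suc n) * of_real (r (Suc n) y)) \<le> d n * exp (- (y / 4))" if y: "y \<ge> y0" for n y
  proof -
    have "norm (c (Suc n) * of_real (r (Suc n) y)) \<le>
        (C * real (Suc n) powr \<mu>) * (K * exp (- (real (Suc n) * y / 2)))"
      unfolding norm_mult norm_of_real using assms y by (intro mult_mono c r) auto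
    also have "\<dots> \<le> (C * real (Suc n) powr \<mu>) * (K * (exp (- (y0 / 4 * real (Suc n))) * exp (- (y / 4))))"
    proof -
    have "exp (- (real (Suc n) * y / 2)) \<le> exp (- (y0 / 4 * real (Suc n))) * exp (- (y / 4))"
    proof -
      define N where "N = real (Suc n)"
      \<comment> \<open>The exponent N y / 2 is divided evenly: one quarter of N y gives summability
        over n uniformly in y >= y0, the other gives the decay in y.\<close>
      have "N * y0 \<le> N * y" "1 * y \<le> N * y"
        using y assms(3) by (auto simp: N_def intro!: mult_left_mono mult_right_mono)
      then have "- (N * y / 2) \<le> - (y0 / 4 * N) + - (y / 4)" by (simp add: mult.commute)
      then show ?thesis unfolding N_def exp_add[symmetric] by (simp only: exp_le_cancel_iff)
    qed
    then show ?thesis using assms by (intro mult_left_mono) auto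
    qed
    also have "\<dots> = d n * exp (- (y / 4))" by (simp add: d_def mult_ac)
    finally show ?thesis .
  qed
  show ?thesis
  proof (rule that)
    show "suminf d \<ge> 0" by (intro suminf_nonneg sd d0)
    fix y assume y: "y \<ge> y0"
    have sd': "summable (\<lambda>n. d n * exp (- (y / 4)))" using sd by (rule summable_mult2)
    show *: "summable (\<lambda>n. norm (c (Suc n) * of_real (r (Suc n) y)))"
      by (rule summable_comparison_test'[OF sd', where N = 0]) (use le[OF y] in auto)
    have "norm (\<Sum>n. c (Suc n) * of_real (r (Suc n) y)) \<le> (\<Sum>n. norm (c (Suc n) * of_real (r (Suc n) y)))"
      by (rule summable_norm[OF *])
    also have "\<dots> \<le> (\<Sum>n. d n * exp (- (y / 4)))" by (intro suminf_le le y * sd')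
    also have "\<dots> = suminf d * exp (- (y / 4))" by (rule suminf_mult2[OF sd, symmetric])
    finally show "norm (\<Sum>n. c (Suc n) * of_real (r (Suc n) y)) \<le> suminf d * exp (- (y / 4))" .
  qed
qed

lemma plus_part_decay:
  assumes "\<And>n. n \<ge> 1 \<Longrightarrow> norm (c n) \<le> C * real n powr \<mu>" "C \<ge> 0" and "y0 > 0"
  obtains M where "M \<ge> 0" "\<And>y. y \<ge> y0 \<Longrightarrow> summable (\<lambda>n. norm (c (Suc n) * of_real (exp (- (real (Suc n) * y)))))"
    "\<And>y. y \<ge> y0 \<Longrightarrow> norm (plus_part c y) \<le> M * exp (- (y / 4))"
proof -
  have "\<bar>exp (- (real n * y))\<bar> \<le> 1 * exp (- (real n * y / 2))" if "n \<ge> 1" "y \<ge> y0" for n y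
    using that assms(3) by simp
  from exp_series_decay[OF assms zero_le_one this] that show ?thesis
    unfolding plus_part_def by blast
qed

lemma minus_part_decay:
  assumes "\<And>n. n \<ge> 1 \<Longrightarrow> norm (c n) \<le> C * real n powr \<mu>" "C \<ge> 0" and "y0 > 0"
  obtains M where "M \<ge> 0" "\<And>y. y \<ge> y0 \<Longrightarrow>
      summable (\<lambda>n. norm (c (Suc n) * of_real (exp (real (Suc n) * y) * upper_Gamma (1 - k) (2 * real (Suc n) * y))))"
    "\<And>y. y \<ge> y0 \<Longrightarrow> norm (minus_part k c y) \<le> M * exp (- (y / 4))"
proof -
  obtain K where K: "K \<ge> 0" "\<And>z. z \<ge> 2 * y0 \<Longrightarrow> upper_Gamma (1 - k) z \<le> K * exp (- (3 / 4 * z))"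
    using upper_Gamma_exp_bound[of "2 * y0" "1 - k"] assms(3) by auto
  have "\<bar>exp (real n * y) * upper_Gamma (1 - k) (2 * real n * y)\<bar> \<le> K * exp (- (real n * y / 2))"
    if "n \<ge> 1" "y \<ge> y0" for n y
  proof -
    have "real n * y \<ge> 1 * y0" using that assms(3) by (intro mult_mono) auto
    then have "exp (real n * y) * upper_Gamma (1 - k) (2 * real n * y) \<le> exp (real n * y) * (K * exp (- (3 / 4 * (2 * real n * y))))"
      by (intro mult_left_mono K) auto
    also have "\<dots> = K * (exp (real n * y) * exp (- (3 / 4 * (2 * real n * y))))" by simp
    also have "\<dots> = K * exp (- (real n * y / 2))" by (simp flip: exp_add)
    finally show ?thesis
      using upper_Gamma_nonneg[of "2 * real n * y" "1 - k"] that assms(3) by (simp add: abs_mult)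
  qed
  from exp_series_decay[OF assms K(1) this] that show ?thesis
    unfolding minus_part_def by blast
qed

lemma harmonic_series_imag_axis:
  assumes cp: "\<And>n. n \<ge> 1 \<Longrightarrow> norm (cp n) \<le> C * real n powr \<mu>" "C \<ge> 0" and "v > 0"
  shows "harmonic_series k cp cm (\<i> * of_real v) =
    cp 0 + plus_part cp (2 * pi * v) + cm 0 * of_real (v powr (1 - k)) + minus_part k cm (2 * pi * v)"
proof -
  have q: "exp (2 * of_real pi * \<i> * (\<i> * of_real v)) ^ n = complex_of_real (exp (- (real n * (2 * pi * v))))" for n
  proof -
    have "2 * of_real pi * \<i> * (\<i> * of_real v) = complex_of_real (- (2 * pi * v))"
      by (simp add: complex_eq_iff)
    then have "exp (2 * of_real pi * \<i> * (\<i> * of_real v)) ^ n = complex_of_real (exp (- (2 * pi * v)) ^ n)"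
      by (simp only: exp_of_real of_real_power)
    also have "exp (- (2 * pi * v)) ^ n = exp (- (real n * (2 * pi * v)))"
      using exp_of_nat_mult[of n "- (2 * pi * v)"] by (simp only: mult_minus_right)
    finally show ?thesis .
  qed
  have q': "exp (2 * of_real pi * \<i> * (\<i> * of_real v)) powi (- int (Suc n)) = complex_of_real (exp (real (Suc n) * (2 * pi * v)))" for n
    unfolding power_int_minus power_int_of_nat q exp_minus of_real_inverse inverse_inverse_eq ..
  have pos: "2 * pi * v > 0" using assms(3) by simp
  have "summable (\<lambda>n. norm (cp (Suc n) * of_real (exp (- (real (Suc n) * (2 * pi * v))))))"
    by (rule plus_part_decay[of cp C \<mu> "2 * pi * v"]) (use cp pos in blast)+
  then have "summable (\<lambda>n. cp (Suc n) * of_real (exp (- (real (Suc n) * (2 * pi * v)))))"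
    by (rule summable_norm_cancel)
  then have "summable (\<lambda>n. cp n * of_real (exp (- (real n * (2 * pi * v)))))"
    by (subst summable_Suc_iff[symmetric])
  from suminf_split_head[OF this]
  have *: "(\<Sum>n. cp n * of_real (exp (- (real n * (2 * pi * v))))) = cp 0 + plus_part cp (2 * pi * v)"
    by (simp add: plus_part_def)
  show ?thesis
  proof -
    have "4 * pi * real (Suc n) * v = 2 * real (Suc n) * (2 * pi * v)" for n by simp
    moreover have "Im (\<i> * of_real v) = v" by simp
    ultimately show ?thesis
      unfolding harmonic_series_def Let_def q q' * minus_part_def of_real_mult by (simp only: mult_ac)
  qed
qed

section \<open>Laplace transform of the Riesz means\<close>

lemma has_bochner_integral_lap_series:
  fixes c :: "nat \<Rightarrow> complex" and r :: "nat \<Rightarrow> real \<Rightarrow> real"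
  assumes r: "\<And>n. has_bochner_integral (laplace_measure y) (r n) (R n)"
    and S: "\<And>n. (\<integral>x. \<bar>r n x\<bar> \<partial>laplace_measure y) \<le> S n" "summable (\<lambda>n. norm (c n) * S n)"
    and summ: "\<And>x. x > 0 \<Longrightarrow> summable (\<lambda>n. norm (c n) * \<bar>r n x\<bar>)"
  shows "has_bochner_integral (laplace_measure y) (\<lambda>x. \<Sum>n. c n * of_real (r n x)) (\<Sum>n. c n * of_real (R n))"
proof -
  define f where "f = (\<lambda>n x. c n * complex_of_real (r n x))"
  have f: "has_bochner_integral (laplace_measure y) (f n) (c n * of_real (R n))" for n
    unfolding f_def using r by (intro has_bochner_integral_mult_right has_bochner_integral_of_real) auto
  then have int: "integrable (laplace_measure y) (f n)" for n by (auto simp: has_bochner_integral_iff)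
  have ae: "AE x in laplace_measure y. summable (\<lambda>n. norm (f n x))"
    using AE_lap_pos by eventually_elim (use summ in \<open>simp add: f_def norm_mult\<close>)
  have "summable (\<lambda>n. \<integral>x. norm (f n x) \<partial>laplace_measure y)"
  proof (rule summable_comparison_test'[OF S(2), where N = 0])
    fix n
    show "norm (\<integral>x. norm (f n x) \<partial>laplace_measure y) \<le> norm (c n) * S n"
      using mult_left_mono[OF S(1)[of n], of "norm (c n)"] by (simp add: f_def norm_mult)
  qed
  from integrable_suminf[OF int ae this] integral_suminf[OF int ae this]
  have "has_bochner_integral (laplace_measure y) (\<lambda>x. \<Sum>n. f n x) (\<Sum>n. c n * of_real (R n))"
    unfolding has_bochner_integral_integral_eq[OF f] has_bochner_integral_iff by simp
  then show ?thesis by (simp only: f_def)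
qed

text \<open>The version for Riesz means: the kernels are nonnegative, so their L^1 norms are the
  transforms themselves, and at each x only finitely many terms are nonzero.\<close>

lemma has_bochner_integral_lap_series_nonneg:
  fixes c :: "nat \<Rightarrow> complex" and r :: "nat \<Rightarrow> real \<Rightarrow> real"
  assumes r: "\<And>n. has_bochner_integral (laplace_measure y) (r n) (R n)" "\<And>n x. r n x \<ge> 0"
    and "summable (\<lambda>n. norm (c n) * R n)" and "\<And>x. finite {n. r n x \<noteq> 0}"
  shows "has_bochner_integral (laplace_measure y) (\<lambda>x. \<Sum>n. c n * of_real (r n x)) (\<Sum>n. c n * of_real (R n))"
proof (rule has_bochner_integral_lap_series[OF r(1) _ assms(3)])
  show "(\<integral>x. \<bar>r n x\<bar> \<partial>laplace_measure y) \<le> R n" for n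
    using r by (auto simp: has_bochner_integral_iff)
  show "summable (\<lambda>n. norm (c n) * \<bar>r n x\<bar>)" for x
    by (rule summable_finite[OF assms(4)[of x]]) auto
qed

text \<open>The version for Bessel series: the terms oscillate, and a bound separated in n and x
  takes the place of their signs.\<close>

lemma has_bochner_integral_lap_series_dominated:
  fixes c :: "nat \<Rightarrow> complex" and r :: "nat \<Rightarrow> real \<Rightarrow> real"
  assumes r: "\<And>n. has_bochner_integral (laplace_measure y) (r n) (R n)"
    and D: "\<And>n x. x > 0 \<Longrightarrow> \<bar>r n x\<bar> \<le> D n * x powr q" "summable (\<lambda>n. norm (c n) * D n)"
    and q: "q > -1" and y: "y > 0"
  shows "has_bochner_integral (laplace_measure y) (\<lambda>x. \<Sum>n. c n * of_real (r n x)) (\<Sum>n. c n * of_real (R n))"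
proof (rule has_bochner_integral_lap_series[OF r])
  let ?I = "Gamma (q + 1) * y powr (- q - 1)"
  have I: "has_bochner_integral (laplace_measure y) (\<lambda>x. D n * x powr q) (D n * ?I)" for n
    by (intro has_bochner_integral_mult_right lap_powr q y)
  show "(\<integral>x. \<bar>r n x\<bar> \<partial>laplace_measure y) \<le> D n * ?I" for n
  proof -
    have "integrable (laplace_measure y) (r n)" using r[of n] by (simp add: has_bochner_integral_iff)
    then have rI: "integrable (laplace_measure y) (\<lambda>x. \<bar>r n x\<bar>)" by simp
    have II: "integrable (laplace_measure y) (\<lambda>x. D n * x powr q)" using I[of n] unfolding has_bochner_integral_iff by blast
    have "(\<integral>x. \<bar>r n x\<bar> \<partial>laplace_measure y) \<le> (\<integral>x. D n * x powr q \<partial>laplace_measure y)"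
    proof (rule integral_mono_AE[OF rI II])
      show "AE x in laplace_measure y. \<bar>r n x\<bar> \<le> D n * x powr q"
        using AE_lap_pos by eventually_elim (use D in auto)
    qed
    then show ?thesis unfolding has_bochner_integral_integral_eq[OF I] .
  qed
  show "summable (\<lambda>n. norm (c n) * (D n * ?I))"
    using summable_mult2[OF D(2), of ?I] by (simp add: mult_ac)
  show "summable (\<lambda>n. norm (c n) * \<bar>r n x\<bar>)" if "x > 0" for x
  proof (rule summable_comparison_test'[OF summable_mult2[OF D(2), of "x powr q"], where N = 0])
    show "norm (norm (c n) * \<bar>r n x\<bar>) \<le> norm (c n) * D n * x powr q" for n
      using mult_left_mono[OF D(1)[OF that, of n], of "norm (c n)"] by (simp add: mult_ac)
  qed
qed

text \<open>At n = x both assumptions apply, so the boundary term must vanish. For (x - n)^\<rho> it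
  does because \<open>0 powr \<rho>\<close> is 0; for the non-holomorphic kernel it is an integral
  over an empty range.\<close>

lemma sum_le_real_eq_suminf:
  fixes f :: "nat \<Rightarrow> complex"
  assumes "\<And>n. n \<ge> 1 \<Longrightarrow> real n \<ge> x \<Longrightarrow> g n = 0" "\<And>n. n \<ge> 1 \<Longrightarrow> real n \<le> x \<Longrightarrow> g n = f n"
  shows "(\<Sum>n | 1 \<le> n \<and> real n \<le> x. f n) = (\<Sum>n. g (Suc n))"
proof -
  have fin: "finite {n. real (Suc n) \<le> x}"
    by (rule finite_subset[of _ "{..nat \<lceil>x\<rceil>}"]) (auto, linarith)
  have "(\<Sum>n. g (Suc n)) = (\<Sum>n\<in>{n. real (Suc n) \<le> x}. g (Suc n))"
    by (rule suminf_finite[OF fin]) (use assms(1) in auto)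
  also have "\<dots> = (\<Sum>n | 1 \<le> n \<and> real n \<le> x. g n)"
    by (rule sum.reindex_bij_witness[of _ "\<lambda>n. n - 1" Suc]) auto
  also have "\<dots> = (\<Sum>n | 1 \<le> n \<and> real n \<le> x. f n)"
    using assms(2) by (intro sum.cong) auto
  finally show ?thesis by simp
qed

lemma finite_Suc_less: "finite {n. (indicator {real (Suc n)<..} x :: real) * h n \<noteq> 0}"
  by (rule finite_subset[of _ "{..nat \<lceil>x\<rceil>}"]) (auto simp: indicator_def, linarith)

lemma lap_riesz_plus:
  fixes ap :: "nat \<Rightarrow> complex"
  assumes "y > 0" "\<rho> > -1" "summable (\<lambda>n. norm (ap (Suc n) * of_real (exp (- (real (Suc n) * y)))))"
  shows "has_bochner_integral (laplace_measure y)
     (\<lambda>x. 1 / of_real (Gamma (\<rho> + 1)) * (\<Sum>n | 1 \<le> n \<and> real n \<le> x. ap n * of_real ((x - real n) powr \<rho>)))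
     (of_real (y powr (- \<rho> - 1)) * plus_part ap y)"
proof -
  have G: "Gamma (\<rho> + 1) > 0" using assms by (intro Gamma_real_pos) auto
  define r where "r = (\<lambda>n x. indicator {real (Suc n)<..} x * (x - real (Suc n)) powr \<rho>)"
  have "has_bochner_integral (laplace_measure y) (\<lambda>x. \<Sum>n. ap (Suc n) * of_real (r n x))
     (\<Sum>n. ap (Suc n) * of_real (exp (- (real (Suc n) * y)) * (Gamma (\<rho> + 1) * y powr (- \<rho> - 1))))"
  proof (rule has_bochner_integral_lap_series_nonneg)
    show "has_bochner_integral (laplace_measure y) (r n) (exp (- (real (Suc n) * y)) * (Gamma (\<rho> + 1) * y powr (- \<rho> - 1)))" for n
      using lap_shift[OF lap_powr[OF assms(2,1)], of "real (Suc n)"] by (simp add: r_def)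
    show "summable (\<lambda>n. norm (ap (Suc n)) * (exp (- (real (Suc n) * y)) * (Gamma (\<rho> + 1) * y powr (- \<rho> - 1))))"
      using summable_mult2[OF assms(3), of "Gamma (\<rho> + 1) * y powr (- \<rho> - 1)"] by (simp add: norm_mult mult_ac)
    show "finite {n. r n x \<noteq> 0}" for x unfolding r_def by (rule finite_Suc_less)
  qed (auto simp: r_def)
  from has_bochner_integral_mult_right[OF this, of "1 / of_real (Gamma (\<rho> + 1))"]
  have "has_bochner_integral (laplace_measure y) (\<lambda>x. 1 / of_real (Gamma (\<rho> + 1)) * (\<Sum>n. ap (Suc n) * of_real (r n x)))
     (1 / of_real (Gamma (\<rho> + 1)) * (\<Sum>n. ap (Suc n) * of_real (exp (- (real (Suc n) * y)) * (Gamma (\<rho> + 1) * y powr (- \<rho> - 1)))))" .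
  also have "(\<lambda>x. \<Sum>n. ap (Suc n) * of_real (r n x)) = (\<lambda>x. \<Sum>n | 1 \<le> n \<and> real n \<le> x. ap n * of_real ((x - real n) powr \<rho>))"
    unfolding r_def
    by (intro ext sum_le_real_eq_suminf[symmetric, where g = "\<lambda>n. ap n * of_real (indicator {real n<..} _ * (_ - real n) powr \<rho>)"])
       (auto simp: indicator_def)
  also have "(\<Sum>n. ap (Suc n) * of_real (exp (- (real (Suc n) * y)) * (Gamma (\<rho> + 1) * y powr (- \<rho> - 1)))) =
      plus_part ap y * of_real (Gamma (\<rho> + 1) * y powr (- \<rho> - 1))"
    unfolding plus_part_def
    by (subst suminf_mult2[OF summable_norm_cancel[OF assms(3)]]) (simp add: mult_ac)
  finally show ?thesis using G by (simp add: mult_ac)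
qed

text \<open>Used with c = n and p = k + \<rho>: the powers of y then combine to y^(-\<rho>-1), and
  the later shift by n reduces e^(2 n y) to e^(n y), the value of q^(-n).\<close>

lemma lap_riesz_kernel:
  assumes "y > 0" "c > 0" "p > 0"
  shows "has_bochner_integral (laplace_measure y)
     (\<lambda>z. LBINT w:{0<..}. indicator {w<..} z * ((w + 2 * c) powr (- k) * (z - w) powr (p - 1)))
     (exp (2 * c * y) * y powr (k - 1) * upper_Gamma (1 - k) (2 * c * y) * (Gamma p * y powr (- p)))"
  using lap_convolution[OF lap_powr_shifted[of "2 * c" y k] lap_powr[of "p - 1" y]] assms by simp

text \<open>The substitution \<open>t = (w + 2 n) / (x + n)\<close> turns \<open>g\<^sub>\<rho>(n, x)\<close> into a convolution at \<open>x - n\<close>.\<close>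
lemma g_fun_eq_convolution:
  assumes "n \<ge> 1" "x \<ge> real n"
  shows "of_real (x powr \<rho>) / (2 * of_real pi * \<i>) * g_fun k \<rho> n x =
    of_real (1 / Gamma (k + \<rho>) *
      (LBINT w:{0<..}. indicator {w<..} (x - real n) * ((w + 2 * real n) powr (- k) * (x - real n - w) powr (k + \<rho> - 1))))"
proof -
  define X where "X = x + real n"
  define p where "p = k + \<rho>"
  have X: "X > 0" "x > 0" using assms by (auto simp: X_def)
  define f where "f = (\<lambda>t. indicator {2 * real n / X..1} t * (t powr (- k) * (1 - t) powr (p - 1)))"
  define h where "h = (\<lambda>w. indicator {0<..} w * (indicator {w<..} (x - real n) * ((w + 2 * real n) powr (- k) * (x - real n - w) powr (p - 1))))"
  define C where "C = (LBINT w:{0<..}. indicator {w<..} (x - real n) * ((w + 2 * real n) powr (- k) * (x - real n - w) powr (p - 1)))"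
  have [measurable]: "f \<in> borel_measurable borel" "h \<in> borel_measurable borel"
    unfolding f_def h_def by (simp_all add: indicator_def)
  have "(LBINT t:{2 * real n / X..1}. t powr (- k) * (1 - t) powr (p - 1)) = integral\<^sup>L lborel f"
    by (simp add: set_lebesgue_integral_def f_def)
  also have "\<dots> = (1 / X) * (\<integral>w. f (2 * real n / X + 1 / X * w) \<partial>lborel)"
    using X lborel_integral_real_affine[of "1 / X" f "2 * real n / X"] by simp
  also have "(\<integral>w. f (2 * real n / X + 1 / X * w) \<partial>lborel) = (\<integral>w. X powr (k - (p - 1)) * h w \<partial>lborel)"
  proof (rule integral_cong_AE)
    have pw: "f (2 * real n / X + 1 / X * w) = X powr (k - (p - 1)) * h w"
      \<comment> \<open>Only at these two points can the closed t-interval and the strict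
        inequalities in h disagree.\<close>
      if w: "w \<noteq> 0" "w \<noteq> x - real n" for w
    proof -
      have t: "2 * real n / X + 1 / X * w = (w + 2 * real n) / X" by (simp add: add_divide_distrib)
      have "1 - (w + 2 * real n) / X = (X - (w + 2 * real n)) / X" using X by (simp add: diff_divide_distrib)
      then have t': "1 - (w + 2 * real n) / X = (x - real n - w) / X" by (simp add: X_def)
      have iff1: "2 * real n / X \<le> (w + 2 * real n) / X \<longleftrightarrow> 0 \<le> w" using X by (simp add: divide_le_cancel)
      have iff2: "(w + 2 * real n) / X \<le> 1 \<longleftrightarrow> w \<le> x - real n" using X by (simp add: divide_le_eq) (auto simp: X_def)
      show ?thesis
      proof (cases "0 < w \<and> w < x - real n")
        case True
        then have "((w + 2 * real n) / X) powr - k * ((x - real n - w) / X) powr (p - 1) =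
            (w + 2 * real n) powr - k * (x - real n - w) powr (p - 1) * (1 / (X powr - k * X powr (p - 1)))"
          using X by (simp add: powr_divide)
        also have "1 / (X powr - k * X powr (p - 1)) = X powr (k - (p - 1))"
        proof -
          have "X powr (k - (p - 1)) * (X powr - k * X powr (p - 1)) = 1"
            using X unfolding powr_add[symmetric] by simp
          moreover have "X powr - k * X powr (p - 1) \<noteq> 0" using X by simp
          ultimately show ?thesis by (metis nonzero_divide_eq_eq)
        qed
        finally show ?thesis using True iff1 iff2 unfolding f_def h_def t t' by (simp add: indicator_def)
      next
        case False
        then have "w < 0 \<or> w > x - real n" using w by linarith
        then show ?thesis using iff1 iff2 unfolding f_def h_def t by (auto simp: indicator_def)
      qed
    qed
    have "AE w in lborel. (w :: real) \<noteq> 0 \<and> w \<noteq> x - real n"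
      by (intro AE_conjI AE_lborel_singleton)
    then show "AE w in lborel. f (2 * real n / X + 1 / X * w) = X powr (k - (p - 1)) * h w"
      by eventually_elim (blast intro: pw)
  qed simp_all
  also have "\<dots> = X powr (k - (p - 1)) * C" by (simp add: C_def h_def set_lebesgue_integral_def)
  finally have I: "(LBINT t:{2 * real n / X..1}. t powr (- k) * (1 - t) powr (p - 1)) = 1 / X * (X powr (k - (p - 1)) * C)" .
  have e1: "x powr \<rho> * (1 + real n / x) powr \<rho> = X powr \<rho>"
  proof -
    have "x * (1 + real n / x) = X" using X by (simp add: X_def distrib_left)
    moreover have "1 + real n / x \<ge> 0" using X by simp
    ultimately show ?thesis using X powr_mult[of x "1 + real n / x" \<rho>] by simp
  qed
  \<comment> \<open>The powers of X = x + n cancel exactly: \<rho> from the prefactor, -1 from the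
    Jacobian, k - (k + \<rho> - 1) from the integrand. This is what makes the kernel a genuine
    convolution.\<close>
  have e2: "X powr \<rho> * (1 / X * (X powr (k - (p - 1)))) = 1"
  proof -
    have "X powr \<rho> * (1 / X * (X powr (k - (p - 1)))) = X powr (\<rho> + (k - (p - 1)) - 1)"
      using X by (simp add: powr_add powr_diff)
    also have "\<dots> = 1" using X by (simp add: p_def)
    finally show ?thesis .
  qed
  have e: "x powr \<rho> * (1 + real n / x) powr \<rho> * (1 / X * (X powr (k - (p - 1)) * C)) = C"
    unfolding e1 using arg_cong[OF e2, of "\<lambda>u. u * C"] by (simp only: mult.assoc mult_1)
  have cancel: "cx / P * (P / cg * cb * ct) = 1 / cg * (cx * cb * ct)" if "P \<noteq> 0"
    for P cx cg cb ct :: complex using that by simp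
  have P: "2 * of_real pi * \<i> \<noteq> 0" by simp
  have "of_real (x powr \<rho>) / (2 * of_real pi * \<i>) * g_fun k \<rho> n x =
     of_real (1 / Gamma p * (x powr \<rho> * (1 + real n / x) powr \<rho> * (LBINT t:{2 * real n / X..1}. t powr (- k) * (1 - t) powr (p - 1))))"
    unfolding g_fun_def X_def p_def by (simp only: cancel[OF P] of_real_mult of_real_divide of_real_1)
  then show ?thesis unfolding I e by (simp only: C_def p_def)
qed

lemma lap_riesz_minus:
  fixes am :: "nat \<Rightarrow> complex"
  assumes "y > 0" "k + \<rho> > 0"
    and summ: "summable (\<lambda>n. norm (am (Suc n) * of_real (exp (real (Suc n) * y) * upper_Gamma (1 - k) (2 * real (Suc n) * y))))"
  shows "has_bochner_integral (laplace_measure y)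
     (\<lambda>x. of_real (x powr \<rho>) / (2 * of_real pi * \<i>) * (\<Sum>n | 1 \<le> n \<and> real n \<le> x. am n * g_fun k \<rho> n x))
     (of_real (y powr (- \<rho> - 1)) * minus_part k am y)"
proof -
  define C where "C = (\<lambda>n z. LBINT w:{0<..}. indicator {w<..} z * ((w + 2 * real n) powr (- k) * (z - w) powr (k + \<rho> - 1)))"
  define r where "r = (\<lambda>n x. indicator {real n<..} x * (1 / Gamma (k + \<rho>) * C n (x - real n)))"
  have G: "Gamma (k + \<rho>) > 0" using assms by (intro Gamma_real_pos)
  have C0: "C n z \<ge> 0" for n z unfolding C_def set_lebesgue_integral_def
    by (rule integral_nonneg_AE) auto
  \<comment> \<open>The case z = 0 is the boundary term n = x.\<close>
  have Cz: "C n z = 0" if "z \<le> 0" for n z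
  proof -
    have "C n z = (LBINT w:{0::real<..}. 0)" unfolding C_def
      by (rule set_lebesgue_integral_cong) (use that in \<open>auto simp: indicator_def\<close>)
    then show ?thesis by simp
  qed
  have "has_bochner_integral (laplace_measure y) (\<lambda>x. \<Sum>n. am (Suc n) * of_real (r (Suc n) x))
     (\<Sum>n. am (Suc n) * of_real (exp (real (Suc n) * y) * upper_Gamma (1 - k) (2 * real (Suc n) * y) * y powr (- \<rho> - 1)))"
  proof (rule has_bochner_integral_lap_series_nonneg)
    fix n
    define N where "N = real (Suc n)"
    have N: "N > 0" by (simp add: N_def)
    have "has_bochner_integral (laplace_measure y) (\<lambda>z. 1 / Gamma (k + \<rho>) * C (Suc n) z)
       (1 / Gamma (k + \<rho>) * (exp (2 * N * y) * y powr (k - 1) * upper_Gamma (1 - k) (2 * N * y) * (Gamma (k + \<rho>) * y powr (- (k + \<rho>)))))"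
      unfolding C_def N_def[symmetric] by (intro has_bochner_integral_mult_right lap_riesz_kernel assms N)
    from lap_shift[OF this, of N] N
    have "has_bochner_integral (laplace_measure y) (r (Suc n)) (exp (- (N * y)) * (1 / Gamma (k + \<rho>) * (exp (2 * N * y) * y powr (k - 1) * upper_Gamma (1 - k) (2 * N * y) * (Gamma (k + \<rho>) * y powr (- (k + \<rho>))))))"
      by (simp add: r_def N_def)
    also have "exp (- (N * y)) * (1 / Gamma (k + \<rho>) * (exp (2 * N * y) * y powr (k - 1) * upper_Gamma (1 - k) (2 * N * y) * (Gamma (k + \<rho>) * y powr (- (k + \<rho>))))) =
       (exp (- (N * y)) * exp (2 * N * y)) * upper_Gamma (1 - k) (2 * N * y) * (y powr (k - 1) * y powr (- (k + \<rho>)))"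
      using G by simp
    also have "exp (- (N * y)) * exp (2 * N * y) = exp (N * y)" unfolding exp_add[symmetric] by simp
    also have "y powr (k - 1) * y powr (- (k + \<rho>)) = y powr (- \<rho> - 1)" unfolding powr_add[symmetric] by (rule arg_cong[where f = "\<lambda>u. y powr u"]) simp
    finally show "has_bochner_integral (laplace_measure y) (r (Suc n)) (exp (real (Suc n) * y) * upper_Gamma (1 - k) (2 * real (Suc n) * y) * y powr (- \<rho> - 1))"
      by (simp only: N_def)
  next
    have "norm (am (Suc n) * of_real (exp (real (Suc n) * y) * upper_Gamma (1 - k) (2 * real (Suc n) * y))) =
       norm (am (Suc n)) * (exp (real (Suc n) * y) * upper_Gamma (1 - k) (2 * real (Suc n) * y))" for n
      using upper_Gamma_nonneg[of "2 * real (Suc n) * y" "1 - k"] assms(1)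
      unfolding norm_mult norm_of_real by (simp add: abs_mult)
    then have "summable (\<lambda>n. norm (am (Suc n)) * (exp (real (Suc n) * y) * upper_Gamma (1 - k) (2 * real (Suc n) * y)))"
      using summ by (simp only:)
    from summable_mult2[OF this, of "y powr (- \<rho> - 1)"]
    show "summable (\<lambda>n. norm (am (Suc n)) * (exp (real (Suc n) * y) * upper_Gamma (1 - k) (2 * real (Suc n) * y) * y powr (- \<rho> - 1)))"
      by (simp only: mult.assoc)
    show "finite {n. r (Suc n) x \<noteq> 0}" for x unfolding r_def by (rule finite_Suc_less)
    show "r (Suc n) x \<ge> 0" for n x using C0 G unfolding r_def by (intro mult_nonneg_nonneg) auto
  qed
  also have "(\<lambda>x. \<Sum>n. am (Suc n) * of_real (r (Suc n) x)) =
     (\<lambda>x. of_real (x powr \<rho>) / (2 * of_real pi * \<i>) * (\<Sum>n | 1 \<le> n \<and> real n \<le> x. am n * g_fun k \<rho> n x))"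
  proof
    fix x
    have "(\<Sum>n | 1 \<le> n \<and> real n \<le> x. am n * (of_real (x powr \<rho>) / (2 * of_real pi * \<i>) * g_fun k \<rho> n x)) = (\<Sum>n. am (Suc n) * of_real (r (Suc n) x))"
    proof (rule sum_le_real_eq_suminf[where g = "\<lambda>n. am n * of_real (r n x)"])
      fix n :: nat assume "n \<ge> 1" "real n \<le> x"
      then show "am n * of_real (r n x) = am n * (of_real (x powr \<rho>) / (2 * of_real pi * \<i>) * g_fun k \<rho> n x)"
        using Cz[of "x - real n" n] by (subst g_fun_eq_convolution) (auto simp: r_def indicator_def C_def)
    qed (auto simp: r_def)
    then show "(\<Sum>n. am (Suc n) * of_real (r (Suc n) x)) =
      of_real (x powr \<rho>) / (2 * of_real pi * \<i>) * (\<Sum>n | 1 \<le> n \<and> real n \<le> x. am n * g_fun k \<rho> n x)"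
      by (simp add: sum_distrib_left mult_ac)
  qed
  also have "(\<Sum>n. am (Suc n) * of_real (exp (real (Suc n) * y) * upper_Gamma (1 - k) (2 * real (Suc n) * y) * y powr (- \<rho> - 1))) =
     minus_part k am y * of_real (y powr (- \<rho> - 1))"
    unfolding minus_part_def
    by (subst suminf_mult2[OF summable_norm_cancel[OF summ]]) (simp add: mult_ac)
  finally show ?thesis by (simp add: mult.commute)
qed

text \<open>Each Gamma value in a denominator is the one that \<open>lap_powr\<close> produces for
  its power of x. Apart from the common y^(-\<rho>-1) there remain the constant terms of f, namely 1
  and y^(1-k), and those of g after inversion, namely y^(-k) and 1/y.\<close>

lemma lap_Q_fun:
  assumes "y > 0" "\<rho> > -1" "k + \<rho> > 0"
  shows "has_bochner_integral (laplace_measure y) (Q_fun k N ap0 am0 bp0 bm0 \<rho>)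
    (of_real (y powr (- \<rho> - 1)) *
      (- ap0 + bm0 * \<i> powr of_real k * of_real (2 * pi * real N powr (k / 2 - 1) / y)
       - am0 * of_real ((2 * pi) powr (k - 1) * y powr (1 - k))
       + bp0 * \<i> powr of_real k * of_real ((2 * pi) powr k / real N powr (k / 2) * y powr (- k))))"
proof -
  have G: "Gamma (\<rho> + 1) > 0" "Gamma (\<rho> + 2) > 0" "Gamma (\<rho> + k) > 0" "Gamma (\<rho> + k + 1) > 0"
    using assms by (auto intro!: Gamma_real_pos)
  have P: "has_bochner_integral (laplace_measure y) (\<lambda>x. A * complex_of_real (x powr p)) (A * of_real (Gamma (p + 1) * y powr (- p - 1)))"
    if "p > -1" for A p
    using that assms by (intro has_bochner_integral_mult_right has_bochner_integral_of_real lap_powr)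
  let ?A = "- ap0 / of_real (Gamma (\<rho> + 1))"
  let ?B = "of_real (2 * pi * real N powr (k / 2 - 1)) * bm0 * \<i> powr of_real k / of_real (Gamma (\<rho> + 2))"
  let ?C = "am0 * of_real ((2 * pi) powr (k - 1)) / of_real (Gamma (\<rho> + k))"
  let ?D = "bp0 * \<i> powr of_real k * of_real ((2 * pi) powr k) / of_real (real N powr (k / 2) * Gamma (\<rho> + k + 1))"
  have I: "has_bochner_integral (laplace_measure y)
     (\<lambda>x. ?A * of_real (x powr \<rho>) + ?B * of_real (x powr (\<rho> + 1)) - ?C * of_real (x powr (\<rho> + k - 1)) + ?D * of_real (x powr (\<rho> + k)))
     (?A * of_real (Gamma (\<rho> + 1) * y powr (- \<rho> - 1)) + ?B * of_real (Gamma (\<rho> + 1 + 1) * y powr (- (\<rho> + 1) - 1))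
       - ?C * of_real (Gamma (\<rho> + k - 1 + 1) * y powr (- (\<rho> + k - 1) - 1)) + ?D * of_real (Gamma (\<rho> + k + 1) * y powr (- (\<rho> + k) - 1)))"
    using assms by (intro has_bochner_integral_add has_bochner_integral_diff P) auto
  have m: "(\<lambda>x. ?A * of_real (x powr \<rho>) + ?B * of_real (x powr (\<rho> + 1)) - ?C * of_real (x powr (\<rho> + k - 1)) + ?D * of_real (x powr (\<rho> + k))) \<in> borel_measurable borel"
    by measurable
  have Qm: "Q_fun k N ap0 am0 bp0 bm0 \<rho> \<in> borel_measurable borel"
    unfolding Q_fun_def by measurable
  have Y: "y powr (- (\<rho> + 1) - 1) = y powr (- \<rho> - 1) / y"
    "y powr (- (\<rho> + k - 1) - 1) = y powr (- \<rho> - 1) * y powr (1 - k)"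
    "y powr (- (\<rho> + k) - 1) = y powr (- \<rho> - 1) * y powr (- k)"
    using assms by (auto simp: powr_diff powr_minus powr_add field_simps power2_eq_square)
  show ?thesis
  proof (rule has_bochner_integral_lap_cong[OF m Qm, THEN iffD1, OF _ _ I])
    fix x :: real assume x: "x > 0"
    have X: "x powr (\<rho> + 1) = x powr \<rho> * x" "x powr (\<rho> + k - 1) = x powr \<rho> * x powr (k - 1)"
        "x powr (\<rho> + k) = x powr \<rho> * x powr k"
      using x by (simp_all add: powr_add powr_diff)
    show "?A * of_real (x powr \<rho>) + ?B * of_real (x powr (\<rho> + 1)) - ?C * of_real (x powr (\<rho> + k - 1)) + ?D * of_real (x powr (\<rho> + k)) =
       Q_fun k N ap0 am0 bp0 bm0 \<rho> x"
      unfolding Q_fun_def X by (simp add: ring_distribs mult_ac)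
  next
    show "?A * of_real (Gamma (\<rho> + 1) * y powr (- \<rho> - 1)) + ?B * of_real (Gamma (\<rho> + 1 + 1) * y powr (- (\<rho> + 1) - 1))
       - ?C * of_real (Gamma (\<rho> + k - 1 + 1) * y powr (- (\<rho> + k - 1) - 1)) + ?D * of_real (Gamma (\<rho> + k + 1) * y powr (- (\<rho> + k) - 1)) =
      of_real (y powr (- \<rho> - 1)) *
      (- ap0 + bm0 * \<i> powr of_real k * of_real (2 * pi * real N powr (k / 2 - 1) / y)
       - am0 * of_real ((2 * pi) powr (k - 1) * y powr (1 - k))
       + bp0 * \<i> powr of_real k * of_real ((2 * pi) powr k / real N powr (k / 2) * y powr (- k)))"
    proof -
      have e: "\<rho> + 1 + 1 = \<rho> + 2" "\<rho> + k - 1 + 1 = \<rho> + k" by simp_all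
      have "complex_of_real (Gamma (\<rho> + 1)) \<noteq> 0" "complex_of_real (Gamma (\<rho> + 2)) \<noteq> 0"
        "complex_of_real (Gamma (\<rho> + k)) \<noteq> 0" "complex_of_real (Gamma (\<rho> + k + 1)) \<noteq> 0"
        using G by (simp_all only: of_real_eq_0_iff)
      then show ?thesis unfolding Y e by (simp add: ring_distribs mult_ac)
    qed
  qed
qed

section \<open>Laplace transform of the Bessel series\<close>

text \<open>The n-th term transforms into e^(-n y') with y' = 4 pi^2 / (N y), since the factor
  n^((\<rho>+k)/2) from the Bessel transform cancels the denominator. The uniform bound for the
  Bessel function gives the majorant; its lack of decay is paid for by the summability
  assumption.\<close>

lemma lap_bessel_plus:
  fixes bp :: "nat \<Rightarrow> complex"
  assumes "y > 0" "N > 0" "\<rho> + k \<ge> 0"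
    and summ: "summable (\<lambda>n. norm (bp (Suc n)) * real (Suc n) powr (- ((\<rho> + k) / 2)))"
    and sb: "\<And>x. x > 0 \<Longrightarrow> summable (\<lambda>n. Bessel_term_plus k N bp \<rho> x (Suc n))"
    and sp: "summable (\<lambda>n. norm (bp (Suc n) * of_real (exp (- (real (Suc n) * (4 * pi\<^sup>2 / (real N * y)))))))"
  shows "has_bochner_integral (laplace_measure y)
     (\<lambda>x. of_real (x powr ((\<rho> + k) / 2) * (sqrt (real N) / (2 * pi)) powr \<rho>) * (\<Sum>n. Bessel_term_plus k N bp \<rho> x (Suc n)))
     (of_real ((2 * pi) powr k / real N powr (k / 2) * y powr (- \<rho> - k - 1)) * plus_part bp (4 * pi\<^sup>2 / (real N * y)))"
proof -
  define q where "q = (\<rho> + k) / 2"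
  define A where "A = (sqrt (real N) / (2 * pi)) powr \<rho>"
  \<comment> \<open>Chosen so that 4 pi sqrt(n x / N) = 2 sqrt(a x), the form required by
    \<open>lap_Bessel_J\<close>.\<close>
  define a where "a = (\<lambda>n. 4 * pi\<^sup>2 * real n / real N)"
  define r where "r = (\<lambda>n x. A * (real n powr (- q) * (x powr q * Bessel_J (\<rho> + k) (2 * sqrt (a n * x)))))"
  have N: "real N > 0" using assms by simp
  have A: "A > 0" using N by (simp add: A_def)
  have q: "q \<ge> 0" "\<rho> + k = 2 * q" using assms by (auto simp: q_def)
  obtain M where M: "\<And>x. x > 0 \<Longrightarrow> \<bar>Bessel_J (\<rho> + k) x\<bar> \<le> M" using Bessel_J_bounded[OF assms(3)] by blast
  have a: "a (Suc n) > 0" for n using N by (simp add: a_def)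
  let ?R = "\<lambda>n. A * (real (Suc n) powr (- q) * (a (Suc n) powr q * y powr (- (\<rho> + k) - 1) * exp (- (a (Suc n) / y))))"
  have I: "has_bochner_integral (laplace_measure y) (\<lambda>x. \<Sum>n. bp (Suc n) * of_real (r (Suc n) x)) (\<Sum>n. bp (Suc n) * of_real (?R n))"
  proof (rule has_bochner_integral_lap_series_dominated[where q = q and D = "\<lambda>n. A * M * real (Suc n) powr (- q)"])
    show "has_bochner_integral (laplace_measure y) (r (Suc n)) (?R n)" for n
      unfolding r_def using lap_Bessel_J[OF assms(3) a[of n] assms(1)]
      by (intro has_bochner_integral_mult_right) (simp add: q_def)
    show "\<bar>r (Suc n) x\<bar> \<le> A * M * real (Suc n) powr (- q) * x powr q" if "x > 0" for n x
    proof -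
      have "\<bar>r (Suc n) x\<bar> = (A * real (Suc n) powr (- q) * x powr q) * \<bar>Bessel_J (\<rho> + k) (2 * sqrt (a (Suc n) * x))\<bar>"
        using A by (simp add: r_def abs_mult)
      also have "\<dots> \<le> (A * real (Suc n) powr (- q) * x powr q) * M"
        using A that a[of n] by (intro mult_left_mono M) auto
      finally show ?thesis by (simp add: mult_ac)
    qed
    show "summable (\<lambda>n. norm (bp (Suc n)) * (A * M * real (Suc n) powr (- q)))"
      using summable_mult[OF summ, of "A * M"] by (simp add: q_def mult_ac)
  qed (use q assms in auto)
  have eq: "(\<Sum>n. bp (Suc n) * of_real (r (Suc n) x)) =
      of_real (x powr ((\<rho> + k) / 2) * A) * (\<Sum>n. Bessel_term_plus k N bp \<rho> x (Suc n))" if x: "x > 0" for x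
  proof -
    have J: "4 * pi * sqrt (real n * x / real N) = 2 * sqrt (a n * x)" for n
    proof -
      have "a n * x = (2 * pi)\<^sup>2 * (real n * x / real N)" by (simp add: a_def power2_eq_square)
      then have "sqrt (a n * x) = 2 * pi * sqrt (real n * x / real N)"
        by (simp only: real_sqrt_mult real_sqrt_abs) simp
      then show ?thesis by simp
    qed
    have t: "bp (Suc n) * of_real (r (Suc n) x) = of_real (x powr q * A) * Bessel_term_plus k N bp \<rho> x (Suc n)" for n
      unfolding Bessel_term_plus_def J r_def q_def[symmetric]
      by (simp add: powr_minus divide_inverse mult_ac)
    show ?thesis unfolding t q_def[symmetric] by (rule suminf_mult[OF sb[OF x]])
  qed
  have val: "(\<Sum>n. bp (Suc n) * of_real (?R n)) =
      of_real ((2 * pi) powr k / real N powr (k / 2) * y powr (- \<rho> - k - 1)) * plus_part bp (4 * pi\<^sup>2 / (real N * y))"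
  proof -
    have "?R n = (2 * pi) powr k / real N powr (k / 2) * y powr (- \<rho> - k - 1) * exp (- (real (Suc n) * (4 * pi\<^sup>2 / (real N * y))))" for n
    proof -
      have aq: "a (Suc n) powr q = (2 * pi) powr (\<rho> + k) * real (Suc n) powr q / real N powr q"
      proof -
        have "a (Suc n) = (2 * pi) powr 2 * real (Suc n) / real N" by (simp add: a_def power_mult_distrib)
        then have "a (Suc n) powr q = ((2 * pi) powr 2) powr q * real (Suc n) powr q / real N powr q"
          by (simp only: powr_divide powr_mult)
        then show ?thesis by (simp only: powr_powr q)
      qed
      have A': "A = real N powr (\<rho> / 2) / (2 * pi) powr \<rho>"
        using N by (simp add: A_def powr_divide powr_half_sqrt[symmetric] powr_powr)
      have "real N powr q = real N powr (\<rho> / 2) * real N powr (k / 2)" by (simp add: q_def add_divide_distrib powr_add)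
      moreover have "(2 * pi) powr (\<rho> + k) = (2 * pi) powr \<rho> * (2 * pi) powr k" by (simp add: powr_add)
      moreover have "real (Suc n) powr (- q) * real (Suc n) powr q = 1" by (simp flip: powr_add)
      moreover have "a (Suc n) / y = real (Suc n) * (4 * pi\<^sup>2 / (real N * y))" by (simp add: a_def)
      moreover have "?R n = A * (real (Suc n) powr (- q) * real (Suc n) powr q) * ((2 * pi) powr (\<rho> + k) / real N powr q) * y powr (- \<rho> - k - 1) * exp (- (a (Suc n) / y))"
        unfolding aq by simp
      ultimately show ?thesis using N unfolding A' by simp
    qed
    then show ?thesis unfolding plus_part_def
      by (subst suminf_mult[OF summable_norm_cancel[OF sp], symmetric]) (simp add: mult_ac)
  qed
  have m: "(\<lambda>x. \<Sum>n. bp (Suc n) * of_real (r (Suc n) x)) \<in> borel_measurable borel"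
    unfolding r_def by measurable
  have m': "(\<lambda>x. of_real (x powr ((\<rho> + k) / 2) * (sqrt (real N) / (2 * pi)) powr \<rho>) * (\<Sum>n. Bessel_term_plus k N bp \<rho> x (Suc n))) \<in> borel_measurable borel"
    unfolding Bessel_term_plus_def by measurable
  show ?thesis
    by (rule has_bochner_integral_lap_cong[OF m m', THEN iffD1, OF _ _ I]) (simp_all only: eq val flip: A_def)
qed

text \<open>With v = 1/u the integral becomes that of v^(-k) e^(-\<beta> v) over v > 2. The cut at u
  = 1/2 is thus the origin of the factor 2 in the argument of the incomplete Gamma function.\<close>

lemma upper_Gamma_inverted:
  assumes "\<beta> > 0"
  shows "has_bochner_integral lborel (\<lambda>u. indicator {0<..<1/2} u * (u powr (k - 2) * exp (- (\<beta> / u))))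
    (\<beta> powr (k - 1) * upper_Gamma (1 - k) (2 * \<beta>))"
proof -
  define f where "f = (\<lambda>u. indicator {0<..<1/2} u * (u powr (k - 2) * exp (- (\<beta> / u))))"
  have fm: "f \<in> borel_measurable borel" unfolding f_def by (simp add: indicator_def)
  have "has_bochner_integral (laplace_measure \<beta>) (\<lambda>w. (w + 2) powr (- k)) (exp (2 * \<beta>) * \<beta> powr (k - 1) * upper_Gamma (1 - k) (2 * \<beta>))"
    using assms by (intro lap_powr_shifted) auto
  from lap_shift[OF this, of 2]
  \<comment> \<open>Translating by 2 turns (w + 2)^(-k) on w > 0 into x^(-k) on x > 2 and cancels
    the factor e^(2 \<beta>).\<close>
  have "has_bochner_integral (laplace_measure \<beta>) (\<lambda>x. indicator {2<..} x * x powr (- k))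
     (exp (- (2 * \<beta>)) * exp (2 * \<beta>) * (\<beta> powr (k - 1) * upper_Gamma (1 - k) (2 * \<beta>)))"
    by (simp add: mult.assoc)
  also have "exp (- (2 * \<beta>)) * exp (2 * \<beta>) = 1" unfolding exp_add[symmetric] by simp
  finally have "has_bochner_integral lborel (\<lambda>x. (indicator {0<..} x * exp (- (x * \<beta>))) *\<^sub>R (indicator {2<..} x * x powr (- k)))
     (\<beta> powr (k - 1) * upper_Gamma (1 - k) (2 * \<beta>))"
    by (subst (asm) has_bochner_integral_lap_iff) auto
  also have "(\<lambda>x. (indicator {0<..} x * exp (- (x * \<beta>))) *\<^sub>R (indicator {2<..} x * x powr (- k))) =
      (\<lambda>u. indicator {1..} u *\<^sub>R ((1 / u\<^sup>2) *\<^sub>R f (1 / u)))"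
  proof
    fix v :: real
    show "(indicator {0<..} v * exp (- (v * \<beta>))) *\<^sub>R (indicator {2<..} v * v powr (- k)) = indicator {1..} v *\<^sub>R ((1 / v\<^sup>2) *\<^sub>R f (1 / v))"
    proof (cases "v > 2")
      case True
      have "(1 / v\<^sup>2) * (1 / v) powr (k - 2) = 1 / (v powr 2 * v powr (k - 2))"
        using True by (simp add: powr_divide)
      also have "v powr 2 * v powr (k - 2) = v powr k" unfolding powr_add[symmetric] by simp
      finally have "(1 / v\<^sup>2) * (1 / v) powr (k - 2) = v powr (- k)" by (simp add: powr_minus_divide)
      moreover have "f (1 / v) = (1 / v) powr (k - 2) * exp (- (v * \<beta>))"
        using True by (simp add: f_def mult.commute)
      ultimately show ?thesis using True by (simp add: indicator_def flip: mult.assoc)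
    next
      case False
      then have "v \<ge> 1 \<Longrightarrow> f (1 / v) = 0" by (auto simp: f_def indicator_def field_simps)
      with False show ?thesis by (auto simp: indicator_def)
    qed
  qed
  finally have "has_bochner_integral lborel (\<lambda>t. indicator {0<..1} t *\<^sub>R f t) (\<beta> powr (k - 1) * upper_Gamma (1 - k) (2 * \<beta>))"
    by (rule has_bochner_integral_inversion[OF fm])
  also have "(\<lambda>t. indicator {0<..1} t *\<^sub>R f t) = f" by (auto simp: fun_eq_iff f_def indicator_def)
  finally show ?thesis by (simp add: f_def)
qed

lemma integrable_beta_weight:
  fixes e q :: real
  assumes "e > -1" "q \<ge> 0"
  shows "integrable lborel (\<lambda>u. indicator {0<..<1/2} u * (u powr e / (1 - u) powr q))"
proof (rule Bochner_Integration.integrable_bound)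
  have "(\<lambda>x. x powr e) integrable_on {0<..1}" using assms by (intro integrable_on_powr_from_0') auto
  then have "has_bochner_integral lborel (\<lambda>u. indicator {0<..1} u *\<^sub>R (u powr e)) (integral {0<..1} (\<lambda>x. x powr e))"
    by (intro has_bochner_integral_lborel_from_lebesgue nonnegative_absolutely_integrable_1 integrable_integral) auto
  then show "integrable lborel (\<lambda>u. 2 powr q * (indicator {0<..1} u *\<^sub>R (u powr e)))"
    by (intro integrable_mult_right) (simp add: has_bochner_integral_iff)
  show "(\<lambda>u. indicator {0<..<1/2} u * (u powr e / (1 - u) powr q)) \<in> borel_measurable lborel"
    by (simp add: indicator_def)
  show "AE u in lborel. norm (indicator {0<..<1/2} u * (u powr e / (1 - u) powr q)) \<le> norm (2 powr q * (indicator {0<..1} u *\<^sub>R (u powr e)))"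
  proof (rule AE_I2)
    fix u :: real
    show "norm (indicator {0<..<1/2} u * (u powr e / (1 - u) powr q)) \<le> norm (2 powr q * (indicator {0<..1} u *\<^sub>R (u powr e)))"
    proof (cases "u \<in> {0<..<1/2}")
      case True
      \<comment> \<open>On the interval 1 - u stays above 1/2, so only the singularity of u^e at 0
        matters.\<close>
      have "1 / 2 powr q = (1 / 2) powr q" by (simp add: powr_divide)
      also have "\<dots> \<le> (1 - u) powr q" using True assms by (intro powr_mono2) auto
      finally have "1 \<le> 2 powr q * (1 - u) powr q" by (simp add: divide_le_eq mult.commute)
      then have "u powr e * 1 \<le> u powr e * (2 powr q * (1 - u) powr q)" by (intro mult_left_mono) auto
      moreover have "(1 - u) powr q > 0" using True by simp
      ultimately show ?thesis using True by (simp add: divide_le_eq mult_ac)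
    qed auto
  qed
qed

text \<open>Fubini, with the bound M and the integrable weight h as majorant. At fixed u the
  transform is a multiple of e^(-a (1 - u) / (u y)) = e^(a/y) e^(-a/(u y)), and the u-integral is
  then \<open>upper_Gamma_inverted\<close>. The second claim is uniform in a up to the constant M,
  as the series over n requires.\<close>

lemma lap_bessel_kernel:
  fixes k \<rho> a y M :: real
  defines "h \<equiv> \<lambda>u. indicator {0<..<1/2} u * (u powr (k + (\<rho> - 3) / 2) / (1 - u) powr ((1 + \<rho>) / 2))"
  defines "K \<equiv> \<lambda>x. \<integral>u. h u * Bessel_J (\<rho> + 1) (2 * sqrt (a * ((1 - u) / u) * x)) \<partial>lborel"
  assumes "\<rho> \<ge> 0" "k + (\<rho> - 3) / 2 > -1" "a > 0" "y > 0"
    and M: "\<And>x. x > 0 \<Longrightarrow> \<bar>Bessel_J (\<rho> + 1) x\<bar> \<le> M"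
  shows "has_bochner_integral (laplace_measure y) (\<lambda>x. x powr ((\<rho> + 1) / 2) * K x)
      (a powr ((\<rho> + 1) / 2) * y powr (- \<rho> - 2) * ((a / y) powr (k - 1) * (exp (a / y) * upper_Gamma (1 - k) (2 * a / y))))"
    and "\<And>x. x > 0 \<Longrightarrow> \<bar>K x\<bar> \<le> M * integral\<^sup>L lborel h"
proof -
  interpret pair_sigma_finite lborel "laplace_measure y"
    by (intro pair_sigma_finite.intro sigma_finite_lap lborel.sigma_finite_measure_axioms)
  define q where "q = (\<rho> + 1) / 2"
  have q: "q > 0" "(1 + \<rho>) / 2 = q" "\<rho> + 1 = 2 * q" using assms by (auto simp: q_def)
  have h_int: "integrable lborel h" unfolding h_def using assms by (intro integrable_beta_weight) auto
  have hm [measurable]: "h \<in> borel_measurable borel" using h_int by (auto dest: borel_measurable_integrable)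
  have h0: "h u \<ge> 0" for u by (auto simp: h_def)
  have hz: "h u = 0" if "u \<notin> {0<..<1/2}" for u using that by (simp add: h_def)
  have "M \<ge> 0" using M[of 1] by linarith
  define J where "J = (\<lambda>u x. Bessel_J (\<rho> + 1) (2 * sqrt (a * ((1 - u) / u) * x)))"
  have au: "a * ((1 - u) / u) > 0" if "u \<in> {0<..<1/2}" for u using that assms by auto
  have hJ: "\<bar>h u * J u x\<bar> \<le> M * h u" if "x > 0" for u x
  proof (cases "u \<in> {0<..<1/2}")
    case True
    have "a * ((1 - u) / u) * x > 0" using au[OF True] that by (rule mult_pos_pos)
    then have "\<bar>J u x\<bar> \<le> M" unfolding J_def by (intro M) simp
    from mult_left_mono[OF this h0[of u]] show ?thesis using h0[of u] by (simp add: abs_mult mult_ac)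
  qed (simp add: hz)
  define f where "f = (\<lambda>(u, x). h u * (x powr q * J u x))"
  have f_meas: "f \<in> borel_measurable (lborel \<Otimes>\<^sub>M laplace_measure y)"
    unfolding f_def J_def by measurable
  have fu: "has_bochner_integral (laplace_measure y) (\<lambda>x. f (u, x))
      (a powr q * y powr (- \<rho> - 2) * exp (a / y) * (indicator {0<..<1/2} u * (u powr (k - 2) * exp (- ((a / y) / u)))))" for u
  proof (cases "u \<in> {0<..<1/2}")
    case True
    let ?b = "a * ((1 - u) / u)"
    have "has_bochner_integral (laplace_measure y) (\<lambda>x. x powr ((\<rho> + 1) / 2) * Bessel_J (\<rho> + 1) (2 * sqrt (?b * x)))
        (?b powr ((\<rho> + 1) / 2) * y powr (- (\<rho> + 1) - 1) * exp (- (?b / y)))"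
      using assms(3,6) au[OF True] by (intro lap_Bessel_J) auto
    then have "has_bochner_integral (laplace_measure y) (\<lambda>x. h u * (x powr q * J u x))
        (h u * (?b powr ((\<rho> + 1) / 2) * y powr (- (\<rho> + 1) - 1) * exp (- (?b / y))))"
      unfolding q_def J_def by (rule has_bochner_integral_mult_right)
    also have "h u * (?b powr ((\<rho> + 1) / 2) * y powr (- (\<rho> + 1) - 1) * exp (- (?b / y))) =
      a powr q * y powr (- \<rho> - 2) * exp (a / y) * (indicator {0<..<1/2} u * (u powr (k - 2) * exp (- ((a / y) / u))))"
    proof -
      \<comment> \<open>The weight is made for this: its power of 1 - u cancels the one from the
        transform, and k + (\<rho> - 3)/2 - (\<rho> + 1)/2 = k - 2.\<close>
      have "h u * ?b powr ((\<rho> + 1) / 2) = a powr q * (u powr (k + (\<rho> - 3) / 2) / u powr q)"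
        using True assms(5) by (simp add: h_def q powr_mult powr_divide)
      also have "u powr (k + (\<rho> - 3) / 2) / u powr q = u powr (k - 2)"
        unfolding powr_diff[symmetric] by (rule arg_cong[where f = "\<lambda>v. u powr v"]) (simp add: q_def field_simps)
      finally have 1: "h u * ?b powr ((\<rho> + 1) / 2) = a powr q * u powr (k - 2)" .
      have 2: "exp (- (?b / y)) = exp (a / y) * exp (- ((a / y) / u))"
        unfolding exp_add[symmetric] using True assms(6) by (simp add: field_simps)
      have 3: "- (\<rho> + 1) - 1 = - \<rho> - 2" by simp
      have "h u * (?b powr ((\<rho> + 1) / 2) * y powr (- (\<rho> + 1) - 1) * exp (- (?b / y))) =
         (h u * ?b powr ((\<rho> + 1) / 2)) * y powr (- (\<rho> + 1) - 1) * exp (- (?b / y))" by simp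
      also have "\<dots> = a powr q * y powr (- \<rho> - 2) * exp (a / y) * (u powr (k - 2) * exp (- ((a / y) / u)))"
        unfolding 1 2 3 by simp
      finally show ?thesis using True by simp
    qed
    finally show ?thesis by (simp add: f_def)
  qed (simp add: f_def hz has_bochner_integral_zero)
  have Iq: "has_bochner_integral (laplace_measure y) (\<lambda>x. M * h u * x powr q) (M * h u * (Gamma (q + 1) * y powr (- q - 1)))" for u
    using assms q by (intro has_bochner_integral_mult_right lap_powr) auto
  have nf: "norm (f (u, x)) \<le> M * h u * x powr q" if "x > 0" for u x
    using mult_right_mono[OF hJ[OF that, of u], of "x powr q"] by (simp add: f_def abs_mult mult_ac)
  have int: "integrable (lborel \<Otimes>\<^sub>M laplace_measure y) f"
  proof (rule Fubini_integrable[OF f_meas])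
    show "integrable lborel (\<lambda>u. \<integral>x. norm (f (u, x)) \<partial>laplace_measure y)"
    proof (rule Bochner_Integration.integrable_bound)
      show "integrable lborel (\<lambda>u. (M * (Gamma (q + 1) * y powr (- q - 1))) * h u)"
        using h_int by (rule integrable_mult_right)
      show "(\<lambda>u. \<integral>x. norm (f (u, x)) \<partial>laplace_measure y) \<in> borel_measurable lborel"
        using f_meas by (intro M2.borel_measurable_lebesgue_integral) (simp add: split_beta')
      show "AE u in lborel. norm (\<integral>x. norm (f (u, x)) \<partial>laplace_measure y) \<le> norm ((M * (Gamma (q + 1) * y powr (- q - 1))) * h u)"
      proof (rule AE_I2)
        fix u
        have "(\<integral>x. norm (f (u, x)) \<partial>laplace_measure y) \<le> (\<integral>x. M * h u * x powr q \<partial>laplace_measure y)"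
        proof (rule integral_mono_AE)
          show "integrable (laplace_measure y) (\<lambda>x. norm (f (u, x)))"
            using fu[of u] unfolding has_bochner_integral_iff by (intro integrable_norm) (rule conjunct1)
          show "integrable (laplace_measure y) (\<lambda>x. M * h u * x powr q)"
            using Iq[of u] unfolding has_bochner_integral_iff by blast
          show "AE x in laplace_measure y. norm (f (u, x)) \<le> M * h u * x powr q"
            using AE_lap_pos by eventually_elim (rule nf)
        qed
        then have "(\<integral>x. norm (f (u, x)) \<partial>laplace_measure y) \<le> M * (Gamma (q + 1) * y powr (- q - 1)) * h u"
          unfolding has_bochner_integral_integral_eq[OF Iq] by (simp only: mult_ac)
        moreover have "(\<integral>x. norm (f (u, x)) \<partial>laplace_measure y) \<ge> 0"
          by (rule integral_nonneg_AE) (rule AE_I2, rule norm_ge_zero)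
        ultimately show "norm (\<integral>x. norm (f (u, x)) \<partial>laplace_measure y) \<le> norm ((M * (Gamma (q + 1) * y powr (- q - 1))) * h u)"
          unfolding real_norm_def by linarith
      qed
    qed
    show "AE u in lborel. integrable (laplace_measure y) (\<lambda>x. f (u, x))"
      using fu unfolding has_bochner_integral_iff by blast
  qed
  have Kf: "x powr q * K x = (\<integral>u. f (u, x) \<partial>lborel)" for x
  proof -
    have "(\<integral>u. f (u, x) \<partial>lborel) = (\<integral>u. x powr q * (h u * J u x) \<partial>lborel)"
      by (simp only: f_def prod.case mult.left_commute)
    then show ?thesis by (simp add: K_def J_def)
  qed
  have "integrable (laplace_measure y) (\<lambda>x. \<integral>u. f (u, x) \<partial>lborel)"
    using integrable_snd[of "\<lambda>u x. f (u, x)"] int by simp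
  moreover have "(\<integral>x. (\<integral>u. f (u, x) \<partial>lborel) \<partial>laplace_measure y) =
     a powr q * y powr (- \<rho> - 2) * exp (a / y) * ((a / y) powr (k - 1) * upper_Gamma (1 - k) (2 * (a / y)))"
  proof -
    have "(\<integral>x. (\<integral>u. f (u, x) \<partial>lborel) \<partial>laplace_measure y) = (\<integral>u. (\<integral>x. f (u, x) \<partial>laplace_measure y) \<partial>lborel)"
      using Fubini_integral[of "\<lambda>u x. f (u, x)"] int by simp
    also have "\<dots> = a powr q * y powr (- \<rho> - 2) * exp (a / y) * ((a / y) powr (k - 1) * upper_Gamma (1 - k) (2 * (a / y)))"
      unfolding has_bochner_integral_integral_eq[OF fu]
      by (rule has_bochner_integral_integral_eq, rule has_bochner_integral_mult_right, rule upper_Gamma_inverted)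
         (use assms in simp)
    finally show ?thesis .
  qed
  ultimately show "has_bochner_integral (laplace_measure y) (\<lambda>x. x powr ((\<rho> + 1) / 2) * K x)
      (a powr ((\<rho> + 1) / 2) * y powr (- \<rho> - 2) * ((a / y) powr (k - 1) * (exp (a / y) * upper_Gamma (1 - k) (2 * a / y))))"
    unfolding q_def[symmetric] Kf has_bochner_integral_iff by simp
  show "\<bar>K x\<bar> \<le> M * integral\<^sup>L lborel h" if "x > 0" for x
  proof -
    have "\<bar>K x\<bar> \<le> (\<integral>u. M * h u \<partial>lborel)"
      unfolding K_def using h_int hJ[OF that]
      by (intro integral_abs_bound[THEN order_trans] integral_mono_AE')
         (auto simp: J_def h0 \<open>M \<ge> 0\<close>)
    then show ?thesis by simp
  qed
qed

lemma lap_bessel_minus: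
  fixes bm :: "nat \<Rightarrow> complex"
  assumes y: "y > 0" and "N > 0" "\<rho> \<ge> 0" "k + (\<rho> - 3) / 2 > -1"
    and summ: "summable (\<lambda>n. norm (bm (Suc n)) * real (Suc n) powr (- ((\<rho> - 1) / 2 + k)))"
    and sb: "\<And>x. x > 0 \<Longrightarrow> summable (\<lambda>n. Bessel_term_minus k N bm \<rho> x (Suc n))"
    and sp: "summable (\<lambda>n. norm (bm (Suc n) * of_real (exp (real (Suc n) * (4 * pi\<^sup>2 / (real N * y))) *
       upper_Gamma (1 - k) (2 * real (Suc n) * (4 * pi\<^sup>2 / (real N * y))))))"
  shows "has_bochner_integral (laplace_measure y)
     (\<lambda>x. of_real (x powr ((\<rho> + 1) / 2) * (sqrt (real N) / (2 * pi)) powr (\<rho> + k - 1)) * (\<Sum>n. Bessel_term_minus k N bm \<rho> x (Suc n)))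
     (of_real ((2 * pi) powr k / real N powr (k / 2) * y powr (- \<rho> - k - 1)) * minus_part k bm (4 * pi\<^sup>2 / (real N * y)))"
proof -
  define q where "q = (\<rho> + 1) / 2"
  define p where "p = (\<rho> - 1) / 2 + k"
  define A where "A = (sqrt (real N) / (2 * pi)) powr (\<rho> + k - 1)"
  define a where "a = (\<lambda>n. 4 * pi\<^sup>2 * real n / real N)"
  define h where "h = (\<lambda>u. indicator {0<..<1/2} u * (u powr (k + (\<rho> - 3) / 2) / (1 - u) powr ((1 + \<rho>) / 2)))"
  define K where "K = (\<lambda>n x. \<integral>u. h u * Bessel_J (\<rho> + 1) (2 * sqrt (a n * ((1 - u) / u) * x)) \<partial>lborel)"
  define r where "r = (\<lambda>n x. A * real n powr (- p) * (x powr q * K n x))"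
  have N: "real N > 0" using assms by simp
  have A: "A > 0" using N by (simp add: A_def)
  have q: "q \<ge> 0" using assms by (auto simp: q_def)
  have "\<rho> + 1 \<ge> 0" using assms(3) by simp
  then obtain M where M: "\<And>x. x > 0 \<Longrightarrow> \<bar>Bessel_J (\<rho> + 1) x\<bar> \<le> M" using Bessel_J_bounded by blast
  have a: "a (Suc n) > 0" for n using N by (simp add: a_def)
  define D where "D = M * integral\<^sup>L lborel h"
  note ker = lap_bessel_kernel[OF assms(3,4) a y M]
  have K_le: "\<bar>K (Suc n) x\<bar> \<le> D" if "x > 0" for n x
    unfolding K_def D_def h_def by (rule ker(2)[OF _ that])
  let ?R = "\<lambda>n. A * real (Suc n) powr (- p) * (a (Suc n) powr q * y powr (- \<rho> - 2) *
      ((a (Suc n) / y) powr (k - 1) * (exp (a (Suc n) / y) * upper_Gamma (1 - k) (2 * a (Suc n) / y))))"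
  have I: "has_bochner_integral (laplace_measure y) (\<lambda>x. \<Sum>n. bm (Suc n) * of_real (r (Suc n) x)) (\<Sum>n. bm (Suc n) * of_real (?R n))"
  proof (rule has_bochner_integral_lap_series_dominated[where q = q and D = "\<lambda>n. A * D * real (Suc n) powr (- p)"])
    show "has_bochner_integral (laplace_measure y) (r (Suc n)) (?R n)" for n
      unfolding r_def K_def h_def q_def by (rule has_bochner_integral_mult_right, rule ker(1))
    show "\<bar>r (Suc n) x\<bar> \<le> A * D * real (Suc n) powr (- p) * x powr q" if "x > 0" for n x
    proof -
      have "\<bar>r (Suc n) x\<bar> = (A * real (Suc n) powr (- p) * x powr q) * \<bar>K (Suc n) x\<bar>"
        using A by (simp add: r_def abs_mult)
      also have "\<dots> \<le> (A * real (Suc n) powr (- p) * x powr q) * D"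
        using A by (intro mult_left_mono K_le that) auto
      finally show ?thesis by (simp add: mult_ac)
    qed
    show "summable (\<lambda>n. norm (bm (Suc n)) * (A * D * real (Suc n) powr (- p)))"
      using summable_mult[OF summ, of "A * D"] by (simp add: p_def mult_ac)
  qed (use q y in auto)
  have eq: "(\<Sum>n. bm (Suc n) * of_real (r (Suc n) x)) =
      of_real (x powr ((\<rho> + 1) / 2) * A) * (\<Sum>n. Bessel_term_minus k N bm \<rho> x (Suc n))" if x: "x > 0" for x
  proof -
    have Kn: "(LBINT u:{0<..<1/2}. u powr (k + (\<rho> - 3) / 2) / (1 - u) powr ((1 + \<rho>) / 2) *
       Bessel_J (\<rho> + 1) (4 * pi * sqrt (real n * x * (1 - u) / (real N * u)))) = K n x" for n
    proof -
      have J: "4 * pi * sqrt (real n * x * (1 - u) / (real N * u)) = 2 * sqrt (a n * ((1 - u) / u) * x)" for u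
      proof -
        have "a n * ((1 - u) / u) * x = (2 * pi)\<^sup>2 * (real n * x * (1 - u) / (real N * u))"
          by (simp add: a_def power2_eq_square)
        then have "sqrt (a n * ((1 - u) / u) * x) = 2 * pi * sqrt (real n * x * (1 - u) / (real N * u))"
          by (simp only: real_sqrt_mult real_sqrt_abs) simp
        then show ?thesis by simp
      qed
      show ?thesis unfolding K_def h_def set_lebesgue_integral_def real_scaleR_def J by (simp only: mult.assoc)
    qed
    have t: "bm (Suc n) * of_real (r (Suc n) x) = of_real (x powr q * A) * Bessel_term_minus k N bm \<rho> x (Suc n)" for n
      unfolding Bessel_term_minus_def Kn r_def p_def[symmetric]
      by (simp add: powr_minus divide_inverse mult_ac)
    show ?thesis unfolding t q_def[symmetric] by (rule suminf_mult[OF sb[OF x]])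
  qed
  have val: "(\<Sum>n. bm (Suc n) * of_real (?R n)) =
      of_real ((2 * pi) powr k / real N powr (k / 2) * y powr (- \<rho> - k - 1)) * minus_part k bm (4 * pi\<^sup>2 / (real N * y))"
  proof -
    have "?R n = (2 * pi) powr k / real N powr (k / 2) * y powr (- \<rho> - k - 1) *
       (exp (real (Suc n) * (4 * pi\<^sup>2 / (real N * y))) * upper_Gamma (1 - k) (2 * real (Suc n) * (4 * pi\<^sup>2 / (real N * y))))" for n
    proof -
      define m where "m = real (Suc n)"
      have m: "m > 0" by (simp add: m_def)
      \<comment> \<open>The exponent q comes from the Bessel transform and k - 1 from the incomplete
        Gamma integral. Their sum is p, so the denominator n^p cancels here too.\<close>
      have ap: "a (Suc n) powr q * a (Suc n) powr (k - 1) = (2 * pi) powr (2 * p) * m powr p / real N powr p"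
      proof -
        have "a (Suc n) = (2 * pi) powr 2 * m / real N" by (simp add: a_def m_def power_mult_distrib)
        then have "a (Suc n) powr p = ((2 * pi) powr 2) powr p * m powr p / real N powr p"
          by (simp only: powr_divide powr_mult)
        then have "a (Suc n) powr p = (2 * pi) powr (2 * p) * m powr p / real N powr p"
          by (simp only: powr_powr)
        moreover have "q + (k - 1) = p" by (simp add: q_def p_def field_simps)
        ultimately show ?thesis unfolding powr_add[symmetric] by simp
      qed
      have A': "A = real N powr ((\<rho> + k - 1) / 2) / (2 * pi) powr (\<rho> + k - 1)"
        using N by (simp add: A_def powr_divide powr_half_sqrt[symmetric] powr_powr)
      have e1: "(2 * pi) powr (2 * p) / (2 * pi) powr (\<rho> + k - 1) = (2 * pi) powr k"
        unfolding powr_diff[symmetric] by (rule arg_cong[where f = "\<lambda>v. (2 * pi) powr v"]) (simp add: p_def field_simps)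
      have e2: "real N powr ((\<rho> + k - 1) / 2) / real N powr p = 1 / real N powr (k / 2)"
        unfolding powr_diff[symmetric] powr_minus_divide[symmetric]
        by (rule arg_cong[where f = "\<lambda>v. real N powr v"]) (simp add: p_def field_simps)
      have e3: "y powr (- \<rho> - 2) / y powr (k - 1) = y powr (- \<rho> - k - 1)"
        unfolding powr_diff[symmetric] by (rule arg_cong[where f = "\<lambda>v. y powr v"]) simp
      have e4: "m powr (- p) * m powr p = 1" using m by (simp flip: powr_add)
      have ay: "a (Suc n) / y = m * (4 * pi\<^sup>2 / (real N * y))" by (simp add: a_def m_def)
      have ay2: "2 * a (Suc n) / y = 2 * m * (4 * pi\<^sup>2 / (real N * y))" by (simp add: a_def m_def)
      have qy: "(a (Suc n) / y) powr (k - 1) = a (Suc n) powr (k - 1) / y powr (k - 1)"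
        using a[of n] y by (simp add: powr_divide)
      define E where "E = exp (a (Suc n) / y) * upper_Gamma (1 - k) (2 * a (Suc n) / y)"
      have "?R n = A * m powr (- p) * (a (Suc n) powr q * a (Suc n) powr (k - 1)) * (y powr (- \<rho> - 2) / y powr (k - 1)) * E"
        unfolding qy E_def m_def by simp
      also have "\<dots> = (m powr (- p) * m powr p) * ((2 * pi) powr (2 * p) / (2 * pi) powr (\<rho> + k - 1)) *
          (real N powr ((\<rho> + k - 1) / 2) / real N powr p) * (y powr (- \<rho> - 2) / y powr (k - 1)) * E"
        unfolding ap A' by simp
      also have "\<dots> = (2 * pi) powr k / real N powr (k / 2) * y powr (- \<rho> - k - 1) * E"
        unfolding e1 e2 e3 e4 by simp
      finally show ?thesis unfolding E_def ay ay2 by (simp only: m_def)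
    qed
    then show ?thesis unfolding minus_part_def
      by (subst suminf_mult[OF summable_norm_cancel[OF sp], symmetric]) (simp only: of_real_mult mult_ac)
  qed
  have im: "has_bochner_integral (laplace_measure y) f J \<Longrightarrow> f \<in> borel_measurable borel" for f :: "real \<Rightarrow> complex" and J
    by (auto simp: has_bochner_integral_iff dest: borel_measurable_integrable)
  have "has_bochner_integral (laplace_measure y) (\<lambda>x. of_real (x powr ((\<rho> + 1) / 2) * A) * (\<Sum>n. Bessel_term_minus k N bm \<rho> x (Suc n))) (\<Sum>n. bm (Suc n) * of_real (?R n))
     \<longleftrightarrow> has_bochner_integral (laplace_measure y) (\<lambda>x. \<Sum>n. bm (Suc n) * of_real (r (Suc n) x)) (\<Sum>n. bm (Suc n) * of_real (?R n))"
  proof (rule has_bochner_integral_lap_cong)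
    show "(\<lambda>x. of_real (x powr ((\<rho> + 1) / 2) * A) * (\<Sum>n. Bessel_term_minus k N bm \<rho> x (Suc n))) \<in> borel_measurable borel"
      unfolding Bessel_term_minus_def set_lebesgue_integral_def by measurable
  qed (simp_all only: eq im[OF I])
  with I have "has_bochner_integral (laplace_measure y) (\<lambda>x. of_real (x powr ((\<rho> + 1) / 2) * A) * (\<Sum>n. Bessel_term_minus k N bm \<rho> x (Suc n))) (\<Sum>n. bm (Suc n) * of_real (?R n))"
    by (rule iffD2[rotated])
  then show ?thesis unfolding val unfolding A_def .
qed

section \<open>The functional equation\<close>

text \<open>With y = 2 pi v, the point y' equals 2 pi / (N v), so this is the law for \<tau> ->
  -1/(N \<tau>) on the imaginary axis. It results from equating the transforms of both sides of the
  Riesz identity at y; the conclusion no longer contains \<rho>.\<close>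

lemma riesz_identity_imp_transformation:
  fixes k y \<rho> :: real and ap am bp bm :: "nat \<Rightarrow> complex"
  assumes ap: "\<And>n. n \<ge> 1 \<Longrightarrow> norm (ap n) \<le> C1 * real n powr \<mu>1" "C1 \<ge> 0"
    and am: "\<And>n. n \<ge> 1 \<Longrightarrow> norm (am n) \<le> C2 * real n powr \<mu>2" "C2 \<ge> 0"
    and bp: "\<And>n. n \<ge> 1 \<Longrightarrow> norm (bp n) \<le> C3 * real n powr \<mu>3" "C3 \<ge> 0"
    and bm: "\<And>n. n \<ge> 1 \<Longrightarrow> norm (bm n) \<le> C4 * real n powr \<mu>4" "C4 \<ge> 0"
    and N: "N > 0" and y: "y > 0"
    and \<rho>: "\<rho> \<ge> 0" "k + \<rho> > 0" "k + (\<rho> - 3) / 2 > -1"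
      "\<mu>3 - (\<rho> + k) / 2 < -1" "\<mu>4 - ((\<rho> - 1) / 2 + k) < -1"
    and riesz: "\<And>x. x > 0 \<Longrightarrow> Riesz_identity k N ap am bp bm \<rho> x"
  defines "y' \<equiv> 4 * pi\<^sup>2 / (real N * y)"
  shows "ap 0 + plus_part ap y + am 0 * of_real ((2 * pi) powr (k - 1) * y powr (1 - k)) + minus_part k am y =
    \<i> powr of_real k * (of_real ((2 * pi) powr k / real N powr (k / 2) * y powr (- k)) * (bp 0 + plus_part bp y' + minus_part k bm y')
      + bm 0 * of_real (2 * pi * real N powr (k / 2 - 1) / y))"
proof -
  have y': "y' > 0" using N y by (simp add: y'_def)
  have sumc: "summable (\<lambda>n. norm (c (Suc n)) * real (Suc n) powr (- p))"
    if "\<And>n. n \<ge> 1 \<Longrightarrow> norm (c n) \<le> C * real n powr \<mu>" "\<mu> - p < -1" for c :: "nat \<Rightarrow> complex" and C \<mu> p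
  proof (rule summable_comparison_test'[OF summable_mult[OF summable_powr_Suc[OF that(2)], of C], where N = 0])
    fix n
    have "norm (c (Suc n)) * real (Suc n) powr (- p) \<le> (C * real (Suc n) powr \<mu>) * real (Suc n) powr (- p)"
      by (intro mult_right_mono that(1)) auto
    also have "\<dots> = C * real (Suc n) powr (\<mu> - p)" by (simp only: mult.assoc diff_conv_add_uminus powr_add)
    finally show "norm (norm (c (Suc n)) * real (Suc n) powr (- p)) \<le> C * real (Suc n) powr (\<mu> - p)" by simp
  qed
  have sum_plus: "summable (\<lambda>n. norm (c (Suc n) * of_real (exp (- (real (Suc n) * z)))))"
    if "\<And>n. n \<ge> 1 \<Longrightarrow> norm (c n) \<le> C * real n powr \<mu>" "C \<ge> 0" "z > 0" for c :: "nat \<Rightarrow> complex" and C \<mu> z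
    by (rule plus_part_decay[of c C \<mu> z]) (use that in blast)+
  have sum_minus: "summable (\<lambda>n. norm (c (Suc n) * of_real (exp (real (Suc n) * z) * upper_Gamma (1 - k) (2 * real (Suc n) * z))))"
    if "\<And>n. n \<ge> 1 \<Longrightarrow> norm (c n) \<le> C * real n powr \<mu>" "C \<ge> 0" "z > 0" for c :: "nat \<Rightarrow> complex" and C \<mu> z
    by (rule minus_part_decay[of c C \<mu> z k]) (use that in blast)+
  define w where "w = \<i> powr complex_of_real k"
  define Y where "Y = complex_of_real (y powr (- \<rho> - 1))"
  define c where "c = (2 * pi) powr k / real N powr (k / 2) * y powr (- k)"
  have Y: "Y \<noteq> 0" using y by (simp add: Y_def)
  have I1: "has_bochner_integral (laplace_measure y)
     (\<lambda>x. 1 / of_real (Gamma (\<rho> + 1)) * (\<Sum>n | 1 \<le> n \<and> real n \<le> x. ap n * of_real ((x - real n) powr \<rho>)))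
     (Y * plus_part ap y)"
    unfolding Y_def using \<rho> by (intro lap_riesz_plus y sum_plus[OF ap y]) auto
  have I2: "has_bochner_integral (laplace_measure y)
     (\<lambda>x. of_real (x powr \<rho>) / (2 * of_real pi * \<i>) * (\<Sum>n | 1 \<le> n \<and> real n \<le> x. am n * g_fun k \<rho> n x))
     (Y * minus_part k am y)"
    unfolding Y_def using \<rho> by (intro lap_riesz_minus y sum_minus[OF am y]) auto
  have I3: "has_bochner_integral (laplace_measure y) (Q_fun k N (ap 0) (am 0) (bp 0) (bm 0) \<rho>)
    (Y * (- ap 0 + bm 0 * w * of_real (2 * pi * real N powr (k / 2 - 1) / y)
       - am 0 * of_real ((2 * pi) powr (k - 1) * y powr (1 - k)) + bp 0 * w * of_real c))"
    unfolding Y_def w_def c_def using \<rho> by (intro lap_Q_fun y) auto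
  have yk: "(2 * pi) powr k / real N powr (k / 2) * y powr (- \<rho> - k - 1) = y powr (- \<rho> - 1) * c"
  proof -
    have "y powr (- \<rho> - k - 1) = y powr (- \<rho> - 1) * y powr (- k)"
      unfolding powr_add[symmetric] by (rule arg_cong[where f = "\<lambda>v. y powr v"]) simp
    then show ?thesis by (simp add: c_def)
  qed
  have I4: "has_bochner_integral (laplace_measure y)
     (\<lambda>x. of_real (x powr ((\<rho> + k) / 2) * (sqrt (real N) / (2 * pi)) powr \<rho>) * (\<Sum>n. Bessel_term_plus k N bp \<rho> x (Suc n)))
     (of_real ((2 * pi) powr k / real N powr (k / 2) * y powr (- \<rho> - k - 1)) * plus_part bp (4 * pi\<^sup>2 / (real N * y)))"
  proof (rule lap_bessel_plus[OF y N])
    show "summable (\<lambda>n. norm (bp (Suc n)) * real (Suc n) powr (- ((\<rho> + k) / 2)))"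
      by (rule sumc[OF bp(1) \<rho>(4)])
    show "summable (\<lambda>n. norm (bp (Suc n) * of_real (exp (- (real (Suc n) * (4 * pi\<^sup>2 / (real N * y)))))))"
      using y' unfolding y'_def by (intro sum_plus[OF bp])
  qed (use \<rho> riesz in \<open>auto simp: Riesz_identity_def\<close>)
  have I5: "has_bochner_integral (laplace_measure y)
     (\<lambda>x. of_real (x powr ((\<rho> + 1) / 2) * (sqrt (real N) / (2 * pi)) powr (\<rho> + k - 1)) * (\<Sum>n. Bessel_term_minus k N bm \<rho> x (Suc n)))
     (of_real ((2 * pi) powr k / real N powr (k / 2) * y powr (- \<rho> - k - 1)) * minus_part k bm (4 * pi\<^sup>2 / (real N * y)))"
  proof (rule lap_bessel_minus[OF y N \<rho>(1,3)])
    show "summable (\<lambda>n. norm (bm (Suc n)) * real (Suc n) powr (- ((\<rho> - 1) / 2 + k)))"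
      by (rule sumc[OF bm(1) \<rho>(5)])
    show "summable (\<lambda>n. norm (bm (Suc n) * of_real (exp (real (Suc n) * (4 * pi\<^sup>2 / (real N * y))) *
       upper_Gamma (1 - k) (2 * real (Suc n) * (4 * pi\<^sup>2 / (real N * y))))))"
      using y' unfolding y'_def by (intro sum_minus[OF bm])
  qed (use riesz in \<open>auto simp: Riesz_identity_def\<close>)
  note L = has_bochner_integral_diff[OF has_bochner_integral_add[OF I1 I2] I3]
  note R = has_bochner_integral_add[OF has_bochner_integral_mult_right[OF I4, of w] has_bochner_integral_mult_right[OF I5, of w]]
  have im: "has_bochner_integral (laplace_measure y) f J \<Longrightarrow> f \<in> borel_measurable borel" for f :: "real \<Rightarrow> complex" and J
    by (auto simp: has_bochner_integral_iff dest: borel_measurable_integrable)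
  \<comment> \<open>The Riesz identity replaces the left integrand by the right one on x > 0;
    uniqueness of the integral then equates the two values.\<close>
  note L' = has_bochner_integral_lap_cong[OF im[OF L] im[OF R] _ refl, THEN iffD1, OF _ L]
  have "Y * plus_part ap y + Y * minus_part k am y -
      (Y * (- ap 0 + bm 0 * w * of_real (2 * pi * real N powr (k / 2 - 1) / y)
       - am 0 * of_real ((2 * pi) powr (k - 1) * y powr (1 - k)) + bp 0 * w * of_real c)) =
      w * (of_real (y powr (- \<rho> - 1) * c) * plus_part bp y') + w * (of_real (y powr (- \<rho> - 1) * c) * minus_part k bm y')"
  proof (rule has_bochner_integral_eq[OF L' R[unfolded yk y'_def[symmetric]]])
    fix x :: real assume "x > 0"
    from riesz[OF this]
    show "1 / of_real (Gamma (\<rho> + 1)) * (\<Sum>n | 1 \<le> n \<and> real n \<le> x. ap n * of_real ((x - real n) powr \<rho>)) +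
       of_real (x powr \<rho>) / (2 * of_real pi * \<i>) * (\<Sum>n | 1 \<le> n \<and> real n \<le> x. am n * g_fun k \<rho> n x) -
       Q_fun k N (ap 0) (am 0) (bp 0) (bm 0) \<rho> x =
       w * (of_real (x powr ((\<rho> + k) / 2) * (sqrt (real N) / (2 * pi)) powr \<rho>) * (\<Sum>n. Bessel_term_plus k N bp \<rho> x (Suc n))) +
       w * (of_real (x powr ((\<rho> + 1) / 2) * (sqrt (real N) / (2 * pi)) powr (\<rho> + k - 1)) * (\<Sum>n. Bessel_term_minus k N bm \<rho> x (Suc n)))"
      unfolding Riesz_identity_def w_def by (simp only: mult.assoc)
  qed
  then have "Y * (plus_part ap y + minus_part k am y -
      (- ap 0 + bm 0 * w * of_real (2 * pi * real N powr (k / 2 - 1) / y)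
       - am 0 * of_real ((2 * pi) powr (k - 1) * y powr (1 - k)) + bp 0 * w * of_real c)) =
      Y * (w * (of_real c * (plus_part bp y' + minus_part k bm y')))"
    unfolding of_real_mult[of "y powr (- \<rho> - 1)" c] Y_def[symmetric] by (simp only: ring_distribs mult_ac)
  then have e: "plus_part ap y + minus_part k am y -
      (- ap 0 + bm 0 * w * of_real (2 * pi * real N powr (k / 2 - 1) / y)
       - am 0 * of_real ((2 * pi) powr (k - 1) * y powr (1 - k)) + bp 0 * w * of_real c) =
      w * (of_real c * (plus_part bp y' + minus_part k bm y'))"
    using Y by (simp only: mult_cancel_left) simp
  have gen: "A0 + P + U + M = w * (cc * (B0 + P' + M') + b * V)"
    if "P + M - (- A0 + b * w * V - U + B0 * w * cc) = w * (cc * (P' + M'))" for A0 P U M cc B0 P' M' b V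
    using that by (simp add: algebra_simps)
  show ?thesis using gen[OF e] unfolding w_def c_def .
qed

theorem corollary7p2:
  fixes k :: real and N :: nat
    and ap am bp bm :: "nat \<Rightarrow> complex"
    and \<mu>fp \<mu>fm \<mu>gp \<mu>gm :: real
  assumes "2 * k \<in> \<int>" and "k < 2" and "N > 0"
    and "\<mu>fp \<ge> 0" and "\<mu>fm \<ge> 0" and "\<mu>gp \<ge> 0" and "\<mu>gm \<ge> 0"
    and "ap \<in> O(\<lambda>n. of_real (real n powr \<mu>fp))"
    and "am \<in> O(\<lambda>n. of_real (real n powr \<mu>fm))"
    and "bp \<in> O(\<lambda>n. of_real (real n powr \<mu>gp))"
    and "bm \<in> O(\<lambda>n. of_real (real n powr \<mu>gm))"
    and "\<And>\<rho> x. \<rho> > Max {1 - k, \<mu>gp - k / 2 + 3 / 4, 2 * \<mu>gm - 2 * k + 5 / 2} \<Longrightarrow> x > 0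
           \<Longrightarrow> Riesz_identity k N ap am bp bm \<rho> x"
  shows "\<exists>\<Lambda>f \<Lambda>g. is_Lambda k N ap am \<Lambda>f \<and> is_Lambda k N bp bm \<Lambda>g \<and>
           (\<forall>s. \<Lambda>f s = \<i> powr of_real k * \<Lambda>g (of_real k - s))"
proof -
  obtain C1 where ap: "C1 \<ge> 0" "\<And>n. n \<ge> 1 \<Longrightarrow> norm (ap n) \<le> C1 * real n powr \<mu>fp"
    using bigo_powr_bound[OF assms(8,4)] by blast
  obtain C2 where am: "C2 \<ge> 0" "\<And>n. n \<ge> 1 \<Longrightarrow> norm (am n) \<le> C2 * real n powr \<mu>fm"
    using bigo_powr_bound[OF assms(9,5)] by blast
  obtain C3 where bp: "C3 \<ge> 0" "\<And>n. n \<ge> 1 \<Longrightarrow> norm (bp n) \<le> C3 * real n powr \<mu>gp"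
    using bigo_powr_bound[OF assms(10,6)] by blast
  obtain C4 where bm: "C4 \<ge> 0" "\<And>n. n \<ge> 1 \<Longrightarrow> norm (bm n) \<le> C4 * real n powr \<mu>gm"
    using bigo_powr_bound[OF assms(11,7)] by blast
  \<comment> \<open>A crude choice above all three bounds of the hypothesis, and large enough that
    n^(\<mu>gp - (\<rho>+k)/2) and n^(\<mu>gm - (\<rho>-1)/2 - k) are summable.\<close>
  define \<rho> where "\<rho> = 10 + 4 * \<bar>k\<bar> + 2 * \<mu>gp + 2 * \<mu>gm"
  have riesz: "Riesz_identity k N ap am bp bm \<rho> x" if "x > 0" for x
    using assms(6,7) that by (intro assms(12)) (auto simp: \<rho>_def)
  have \<rho>: "\<rho> \<ge> 0" "k + \<rho> > 0" "k + (\<rho> - 3) / 2 > -1"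
      "\<mu>gp - (\<rho> + k) / 2 < -1" "\<mu>gm - ((\<rho> - 1) / 2 + k) < -1"
    using assms(6,7) unfolding \<rho>_def by (auto simp: abs_if field_simps)
  have trans: "ap 0 + plus_part ap y + am 0 * of_real ((2 * pi) powr (k - 1) * y powr (1 - k)) + minus_part k am y =
      \<i> powr of_real k * (of_real ((2 * pi) powr k / real N powr (k / 2) * y powr (- k)) *
        (bp 0 + plus_part bp (4 * pi\<^sup>2 / (real N * y)) + minus_part k bm (4 * pi\<^sup>2 / (real N * y)))
        + bm 0 * of_real (2 * pi * real N powr (k / 2 - 1) / y))" if "y > 0" for y
    by (rule riesz_identity_imp_transformation[OF ap(2,1) am(2,1) bp(2,1) bm(2,1) assms(3) that \<rho> riesz])
  define n where "n = sqrt (real N)"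
  have n: "n > 0" using assms(3) by (simp add: n_def)
  have n_powr: "n powr r = real N powr (r / 2)" for r
    using assms(3) by (simp add: n_def powr_half_sqrt[symmetric] powr_powr)
  define w where "w = \<i> powr complex_of_real k"
  \<comment> \<open>For t > 0, V is the harmonic series at i t / sqrt N; this explicit expression is
    Borel measurable on the whole line.\<close>
  define V where "V = (\<lambda>(cp :: nat \<Rightarrow> complex) cm t. cp 0 + plus_part cp (2 * pi * (t / n)) + cm 0 * of_real ((t / n) powr (1 - k)) + minus_part k cm (2 * pi * (t / n)))"
  have Vm: "V cp cm \<in> borel_measurable borel" for cp cm unfolding V_def by measurable
  have V_harm: "harmonic_series k cp cm (\<i> * of_real (t / sqrt (real N))) = V cp cm t"
    if "C \<ge> 0" "\<And>n. n \<ge> 1 \<Longrightarrow> norm (cp n) \<le> C * real n powr \<mu>" "t > 0" for cp cm C \<mu> t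
    unfolding V_def n_def[symmetric]
    by (rule harmonic_series_imag_axis[of cp C \<mu>]) (use that n in auto)
  define H where "H = (\<lambda>cp cm t. V cp cm t - cp 0 - cm 0 / of_real (real N powr ((1 - k) / 2)) * of_real (t powr (1 - k)))"
  have H_eq: "H cp cm t = plus_part cp (2 * pi / n * t) + minus_part k cm (2 * pi / n * t)" if "t > 0" for cp cm t
    using that n by (simp add: H_def V_def powr_divide n_powr)
  have H_bound: "\<exists>C\<ge>0. \<forall>t\<ge>1. norm (H cp cm t) \<le> C * exp (- (2 * pi / n / 4 * t))"
    if cp: "C \<ge> 0" "\<And>n. n \<ge> 1 \<Longrightarrow> norm (cp n) \<le> C * real n powr \<mu>"
      and cm: "C' \<ge> 0" "\<And>n. n \<ge> 1 \<Longrightarrow> norm (cm n) \<le> C' * real n powr \<mu>'" for cp cm C \<mu> C' \<mu>'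
  proof -
    let ?y0 = "2 * pi / n"
    have y0: "?y0 > 0" using n by simp
    obtain M1 where M1: "M1 \<ge> 0" "\<And>y. y \<ge> ?y0 \<Longrightarrow> norm (plus_part cp y) \<le> M1 * exp (- (y / 4))"
      by (rule plus_part_decay[of cp C \<mu> ?y0]) (use cp y0 in blast)+
    obtain M2 where M2: "M2 \<ge> 0" "\<And>y. y \<ge> ?y0 \<Longrightarrow> norm (minus_part k cm y) \<le> M2 * exp (- (y / 4))"
      by (rule minus_part_decay[of cm C' \<mu>' ?y0 k]) (use cm y0 in blast)+
    have "norm (H cp cm t) \<le> (M1 + M2) * exp (- (?y0 / 4 * t))" if t: "t \<ge> 1" for t
    proof -
      have "?y0 * t \<ge> ?y0 * 1" using y0 t by (intro mult_left_mono) auto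
      then have y: "?y0 * t \<ge> ?y0" by simp
      have "norm (H cp cm t) \<le> norm (plus_part cp (?y0 * t)) + norm (minus_part k cm (?y0 * t))"
        using t by (subst H_eq) (auto intro: norm_triangle_ineq)
      also have "\<dots> \<le> M1 * exp (- (?y0 * t / 4)) + M2 * exp (- (?y0 * t / 4))"
        by (intro add_mono M1 M2 y)
      finally show ?thesis by (simp add: algebra_simps)
    qed
    then show ?thesis using M1(1) M2(1) by (intro exI[of _ "M1 + M2"]) auto
  qed
  obtain Cf where Cf: "Cf \<ge> 0" "\<And>t. t \<ge> 1 \<Longrightarrow> norm (H ap am t) \<le> Cf * exp (- (2 * pi / n / 4 * t))"
    using H_bound[OF ap am] by blast
  obtain Cg where Cg: "Cg \<ge> 0" "\<And>t. t \<ge> 1 \<Longrightarrow> norm (H bp bm t) \<le> Cg * exp (- (2 * pi / n / 4 * t))"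
    using H_bound[OF bp bm] by blast
  \<comment> \<open>\<open>hecke_functional_equation\<close> takes one constant for both
    functions.\<close>
  have hf: "norm (H ap am t) \<le> (Cf + Cg) * exp (- (2 * pi / n / 4 * t))" if "t \<ge> 1" for t
    by (rule order_trans[OF Cf(2)[OF that]], rule mult_right_mono) (use Cg(1) in auto)
  have hg: "norm (H bp bm t) \<le> (Cf + Cg) * exp (- (2 * pi / n / 4 * t))" if "t \<ge> 1" for t
    by (rule order_trans[OF Cg(2)[OF that]], rule mult_right_mono) (use Cf(1) in auto)
  have VV: "V ap am t = w * of_real (t powr (- k)) * V bp bm (1 / t)" if t: "t > 0" for t
  proof -
    let ?y = "2 * pi * (t / n)"
    have y: "?y > 0" using t n by simp
    \<comment> \<open>The normalisation t / sqrt N makes the inversion t -> 1/t.\<close>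
    have y': "4 * pi\<^sup>2 / (real N * ?y) = 2 * pi * (1 / t / n)"
    proof -
      have "real N = n * n" using assms(3) by (simp add: n_def)
      then show ?thesis using n t by (simp add: power2_eq_square)
    qed
    have e1: "(2 * pi) powr (k - 1) * ?y powr (1 - k) = (t / n) powr (1 - k)"
    proof -
      have "?y powr (1 - k) = (2 * pi) powr (1 - k) * (t / n) powr (1 - k)" by (rule powr_mult)
      moreover have "(2 * pi) powr (k - 1) * (2 * pi) powr (1 - k) = 1" unfolding powr_add[symmetric] by simp
      ultimately show ?thesis by (simp add: mult.assoc[symmetric])
    qed
    have e2: "(2 * pi) powr k / real N powr (k / 2) * ?y powr (- k) = t powr (- k)"
    proof -
      have "?y powr (- k) = (2 * pi) powr (- k) * (t powr (- k) / n powr (- k))"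
        by (simp only: powr_mult powr_divide)
      moreover have "(2 * pi) powr k * (2 * pi) powr (- k) = 1" unfolding powr_add[symmetric] by simp
      moreover have "n powr k * n powr (- k) = 1" unfolding powr_add[symmetric] using n by simp
      moreover have "real N powr (k / 2) = n powr k" by (simp add: n_powr)
      moreover have "A / B * (A' * (T / B')) = (A * A') * T / (B * B')" for A B A' T B' :: real by simp
      ultimately show ?thesis by (simp only: mult_1 div_by_1)
    qed
    \<comment> \<open>Both sides equal (sqrt N)^(k-1) / t: the 1/y term of the transformation law is
      the v^(1-k) term of g taken at 1/t.\<close>
    have e3: "2 * pi * real N powr (k / 2 - 1) / ?y = t powr (- k) * (1 / t / n) powr (1 - k)"
    proof -
      have "real N powr (k / 2 - 1) = n powr (k - 2)" by (simp add: n_powr diff_divide_distrib)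
      then have "2 * pi * real N powr (k / 2 - 1) / ?y = n powr (k - 2) * n / t" using n t by simp
      also have "n powr (k - 2) * n = n powr (k - 1)"
        using powr_mult_base[of n "k - 2"] n by (simp add: mult.commute)
      also have "n powr (k - 1) / t = t powr (- k) * (1 / t / n) powr (1 - k)"
      proof -
        have "(1 / t / n) powr (1 - k) = 1 / (t powr (1 - k) * n powr (1 - k))"
          using t n by (simp add: powr_divide powr_mult)
        also have "\<dots> = t powr (k - 1) * n powr (k - 1)"
          using t n powr_minus_divide[of t "1 - k"] powr_minus_divide[of n "1 - k"] by simp
        finally have "t powr (- k) * (1 / t / n) powr (1 - k) = (t powr (- k) * t powr (k - 1)) * n powr (k - 1)" by simp
        also have "t powr (- k) * t powr (k - 1) = 1 / t"
          unfolding powr_add[symmetric] using t by (simp add: powr_minus_divide)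
        finally show ?thesis by simp
      qed
      finally show ?thesis .
    qed
    have d: "w * (T * (B + P + M) + b * (T * U)) = w * T * (B + P + b * U + M)" for T B P M b U :: complex
      by (simp add: algebra_simps)
    have "V ap am t = w * (of_real (t powr (- k)) * (bp 0 + plus_part bp (2 * pi * (1 / t / n)) + minus_part k bm (2 * pi * (1 / t / n)))
       + bm 0 * (of_real (t powr (- k)) * of_real ((1 / t / n) powr (1 - k))))"
      using trans[OF y] unfolding y' e1 e2 e3 w_def of_real_mult V_def .
    then show ?thesis unfolding d by (simp only: V_def)
  qed
  have w: "w \<noteq> 0" by (simp add: w_def)
  have c: "2 * pi / n / 4 > 0" using n by simp
  have is_L: "is_Lambda k N cp cm L"
    if "C \<ge> 0" "\<And>n. n \<ge> 1 \<Longrightarrow> norm (cp n) \<le> C * real n powr \<mu>" and L: "L nicely_meromorphic_on UNIV"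
      and I: "\<And>s. Re s > \<sigma> \<Longrightarrow> has_bochner_integral lborel (\<lambda>t. indicator {0<..} t *\<^sub>R
       ((V cp cm t - cp 0 - cm 0 / of_real (real N powr ((1 - k) / 2)) * of_real (t powr (1 - k))) * of_real t powr (s - 1))) (L s)"
    for C \<mu> cp cm L \<sigma>
  proof -
    have eq: "indicator {0<..} t *\<^sub>R ((V cp cm t - cp 0 - cm 0 / of_real (real N powr ((1 - k) / 2)) * of_real (t powr (1 - k))) * of_real t powr (s - 1)) = indicator {0<..} t *\<^sub>R Lambda_integrand k N cp cm s t" for s t
    proof (cases "t > 0")
      case True
      have "harmonic_series k cp cm (\<i> * of_real (t / sqrt (real N))) = V cp cm t"
        by (rule V_harm[OF that(1,2) True])
      then show ?thesis by (simp only: Lambda_integrand_def)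
    qed simp
    have "integrable lborel (\<lambda>t. indicator {0<..} t *\<^sub>R Lambda_integrand k N cp cm s t) \<and>
        L s = (\<integral>t. indicator {0<..} t *\<^sub>R Lambda_integrand k N cp cm s t \<partial>lborel)" if "Re s > \<sigma>" for s
      using I[OF that, unfolded eq] unfolding has_bochner_integral_iff by simp
    then show ?thesis using L
      unfolding is_Lambda_def set_integrable_def set_lebesgue_integral_def by blast
  qed
  show ?thesis
  proof (rule hecke_functional_equation[OF Vm Vm w c hf[unfolded H_def] hg[unfolded H_def] VV])
    fix Lf Lg \<sigma>
    assume Lf: "Lf nicely_meromorphic_on UNIV" and Lg: "Lg nicely_meromorphic_on UNIV"
      and If: "\<And>s. Re s > \<sigma> \<Longrightarrow> has_bochner_integral lborel (\<lambda>t. indicator {0<..} t *\<^sub>R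
         ((V ap am t - ap 0 - am 0 / of_real (real N powr ((1 - k) / 2)) * of_real (t powr (1 - k))) * of_real t powr (s - 1))) (Lf s)"
      and Ig: "\<And>s. Re s > \<sigma> \<Longrightarrow> has_bochner_integral lborel (\<lambda>t. indicator {0<..} t *\<^sub>R
         ((V bp bm t - bp 0 - bm 0 / of_real (real N powr ((1 - k) / 2)) * of_real (t powr (1 - k))) * of_real t powr (s - 1))) (Lg s)"
      and FE: "\<And>s. Lf s = w * Lg (of_real k - s)"
    show "\<exists>\<Lambda>f \<Lambda>g. is_Lambda k N ap am \<Lambda>f \<and> is_Lambda k N bp bm \<Lambda>g \<and>
           (\<forall>s. \<Lambda>f s = \<i> powr of_real k * \<Lambda>g (of_real k - s))"
    proof (intro exI conjI allI)
      show "is_Lambda k N ap am Lf" by (rule is_L[OF ap Lf If])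
      show "is_Lambda k N bp bm Lg" by (rule is_L[OF bp Lg Ig])
      show "Lf s = \<i> powr of_real k * Lg (of_real k - s)" for s using FE[of s] by (simp only: w_def)
    qed
  qed
qed

end
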